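(* Let $\mathcal{H}$ be a real Hilbert space and $T$ a lower semi-bounded self-adjoint operator in $\mathcal{H}$. Suppose $\mu := \inf \sigma(T)$ is a simple eigenvalue of $T$, and let $u_0 \in \ker(T - \mu I)$ be a unit vector. Let $\{S(\kappa)\}_{\kappa \in J}$ be a family of symmetric operators in $\mathcal{H}$ indexed by a one-dimensional open interval $J$ containing $0$, and put $T(\kappa) := T + S(\kappa)$. Assume the following: (i) For any $\kappa \in J$, $\operatorname{Dom} T \subset \operatorname{Dom} S(\kappa)$. (ii) There exist continuous functions $a, b \colon J \to [0, \infty)$ such that for any $\kappa \in J$, $\|S(\kappa)u\| \leq a(\kappa)\|Tu\| + b(\kappa)\|u\|$ for all $u \in \operatorname{Dom} T$. (iii) $a(0) = b(0) = 0$. (iv) There exists $\kappa_0 > 0$ with $(-\kappa_0,\kappa_0)\subset J$ such that $(T(\kappa))_{|\kappa| < \kappa_0}$ has a uniform spectral gap: $$\delta := \inf_{|\kappa| < \kappa_0} \operatorname{dist}\left(\mu(\kappa),\, \sigma(T(\kappa))\setminus \{\mu(\kappa)\}\right) > 0,$$ where $\mu(\kappa)$ is the lowest eigenvalue of $T(\kappa)$. Fix $s_0 > 0$ and define $$\varepsilon := \frac{\delta}{2}, \qquad c(\kappa) := a(\kappa) + \frac{(|\mu| + \varepsilon)a(\kappa) + b(\kappa)}{\varepsilon} \quad (\kappa \in J),$$ $$\alpha := 1 - e^{-s_0 \delta}, \qquad r := \frac{1-\alpha^2}{4\sqrt{2}\,(1+\alpha^2)}.$$ Then, for any $s \in (0,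 s_0]$ and any $|\kappa| < \kappa_0$ satisfying $$c(\kappa) < \frac{r\sqrt{1 - r^2/4}}{1 + r\sqrt{1 - r^2/4}},$$ the operator $e^{-sT(\kappa)}$ is positivity improving with respect to the cone $\mathcal{P}(u_0)$.
   Context: Operators in $\mathcal{H}$ such as $T$ and $S(\kappa)$ are linear and possibly unbounded, with domain $\operatorname{Dom}$; symmetric and self-adjoint are understood in the usual sense for densely defined operators. $\sigma(\cdot)$ denotes the spectrum; the spectrum of an operator $T$ on the real Hilbert space $\mathcal{H}$ is defined as the spectrum of its complexification $\tilde T$ on $\tilde{\mathcal{H}}=\mathcal{H}+i\mathcal{H}$, where $\operatorname{Dom}\tilde T=\operatorname{Dom}T+i\operatorname{Dom}T$ and $\tilde T(u+iv)=Tu+iTv$. Functions of self-adjoint operators such as $e^{-sT}$ are defined by the spectral functional calculus. A simple eigenvalue is one whose eigenspace is one-dimensional. For a unit vector $u_0 \in \mathcal{H}$, the cone with $u_0$ as its axis is $\mathcal{P}(u_0) := \{ u \in \mathcal{H} \mid \langle u_0, u\rangle \ge \|u\|/\sqrt{2}\}$; it is a Hilbert cone. Here a Hilbert cone in $\mathcal{H}$ is a non-empty subset $\mathcal{C}\subset\mathcal{H}$ such that: (i) $\mathcal{C}+\mathcal{C}\subset\mathcal{C}$, $[0,\infty)\cdot\mathcal{C}\subset\mathcal{C}$ and $\mathcal{C}\cap(-\mathcal{C})=\{0\}$; (ii) $\mathcal{C}$ is closed; (iii) $\langle u,v\rangle\ge 0$ for all $u,v\in\mathcal{C}$; (iv)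 for every $w\in\mathcal{H}$ there exist $u,v\in\mathcal{C}$ with $w=u-v$ and $\langle u,v\rangle=0$. For a Hilbert cone $\mathcal{C}$, the set of strictly positive vectors is $\mathcal{C}_{>0} := \{u\in\mathcal{C}\setminus\{0\} \mid \langle v,u\rangle>0 \text{ for all } v\in\mathcal{C}\setminus\{0\}\}$. A bounded operator $A$ on $\mathcal{H}$ is positivity improving with respect to $\mathcal{C}$ if $A(\mathcal{C}\setminus\{0\})\subset\mathcal{C}_{>0}$. *)

theory Defs
  imports "HOL-Analysis.Analysis"
begin

text \<open>
  A real Hilbert space is a type of sort \<open>{real_inner, banach}\<close>. A possibly unbounded operator
  is a domain together with a total function whose values outside the domain are irrelevant;
  hence operators are compared with \<open>op_eq\<close>, never with \<open>=\<close>.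
\<close>

datatype 'a unbounded_operator = Operator (Dom: "'a set") (app: "'a \<Rightarrow> 'a")

definition op_eq :: "'a unbounded_operator \<Rightarrow> 'a unbounded_operator \<Rightarrow> bool" where
  "op_eq A B \<longleftrightarrow> Dom A = Dom B \<and> (\<forall>u\<in>Dom A. app A u = app B u)"

definition linear_operator :: "'a::real_vector unbounded_operator \<Rightarrow> bool" where
  "linear_operator A \<longleftrightarrow> subspace (Dom A)
     \<and> (\<forall>u\<in>Dom A. \<forall>v\<in>Dom A. app A (u + v) = app A u + app A v)
     \<and> (\<forall>u\<in>Dom A. \<forall>t::real. app A (t *\<^sub>R u) = t *\<^sub>R app A u)"

definition densely_defined :: "'a::topological_space unbounded_operator \<Rightarrow> bool" where
  "densely_defined A \<longleftrightarrow> closure (Dom A) = UNIV"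

definition op_add ::
  "'a::real_vector unbounded_operator \<Rightarrow> 'a unbounded_operator \<Rightarrow> 'a unbounded_operator" where
  "op_add A B = Operator (Dom A \<inter> Dom B) (\<lambda>u. app A u + app B u)"

definition symmetric_operator :: "'a::real_inner unbounded_operator \<Rightarrow> bool" where
  "symmetric_operator A \<longleftrightarrow> linear_operator A \<and> densely_defined A
     \<and> (\<forall>u\<in>Dom A. \<forall>v\<in>Dom A. inner (app A u) v = inner u (app A v))"

definition op_adjoint :: "'a::real_inner unbounded_operator \<Rightarrow> 'a unbounded_operator" where
  "op_adjoint A = Operator
     {v. \<exists>w. \<forall>u\<in>Dom A. inner (app A u) v = inner u w}
     (\<lambda>v. THE w. \<forall>u\<in>Dom A. inner (app A u) v = inner u w)"

definition self_adjoint :: "'a::real_inner unbounded_operator \<Rightarrow> bool" where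
  "self_adjoint A \<longleftrightarrow> linear_operator A \<and> densely_defined A \<and> op_eq (op_adjoint A) A"

definition lower_semibounded :: "'a::real_inner unbounded_operator \<Rightarrow> bool" where
  "lower_semibounded A \<longleftrightarrow> (\<exists>m::real. \<forall>u\<in>Dom A. m * (norm u)\<^sup>2 \<le> inner u (app A u))"


text \<open>
  The complexification of the space is \<open>'a \<times> 'a\<close>, the pair \<open>(u, v)\<close> standing for \<open>u + iv\<close>; the
  norm of the product type is the Hilbert norm of the complexification.
\<close>

definition complex_scale :: "complex \<Rightarrow> 'a::real_vector \<times> 'a \<Rightarrow> 'a \<times> 'a" where
  "complex_scale z w = (Re z *\<^sub>R fst w - Im z *\<^sub>R snd w, Re z *\<^sub>R snd w + Im z *\<^sub>R fst w)"

definition complexification ::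
  "'a unbounded_operator \<Rightarrow> ('a \<times> 'a) unbounded_operator" where
  "complexification A = Operator (Dom A \<times> Dom A) (\<lambda>w. (app A (fst w), app A (snd w)))"

definition resolvent_set :: "'a::real_normed_vector unbounded_operator \<Rightarrow> complex set" where
  "resolvent_set A = {z. \<exists>R::'a \<times> 'a \<Rightarrow> 'a \<times> 'a. bounded_linear R
     \<and> (\<forall>w. R w \<in> Dom (complexification A)
            \<and> app (complexification A) (R w) - complex_scale z (R w) = w)
     \<and> (\<forall>w\<in>Dom (complexification A).
            R (app (complexification A) w - complex_scale z w) = w)}"

definition op_spectrum :: "'a::real_normed_vector unbounded_operator \<Rightarrow> complex set" where
  "op_spectrum A = - resolvent_set A"

definition eigenspace :: "'a::real_vector unbounded_operator \<Rightarrow> real \<Rightarrow> 'a set" where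
  "eigenspace A l = {u \<in> Dom A. app A u = l *\<^sub>R u}"

definition is_eigenvalue :: "'a::real_vector unbounded_operator \<Rightarrow> real \<Rightarrow> bool" where
  "is_eigenvalue A l \<longleftrightarrow> (\<exists>u\<in>eigenspace A l. u \<noteq> 0)"

definition simple_eigenvalue :: "'a::real_vector unbounded_operator \<Rightarrow> real \<Rightarrow> bool" where
  "simple_eigenvalue A l \<longleftrightarrow> is_eigenvalue A l \<and> dim (eigenspace A l) = 1"

definition lowest_eigenvalue :: "'a::real_vector unbounded_operator \<Rightarrow> real \<Rightarrow> bool" where
  "lowest_eigenvalue A l \<longleftrightarrow> is_eigenvalue A l \<and> (\<forall>l'. is_eigenvalue A l' \<longrightarrow> l \<le> l')"

text \<open>Extended-real-valued, so that the distance to the empty set is \<open>\<infinity>\<close> (\<open>infdist\<close> gives \<open>0\<close>).\<close>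

definition dist_to_set :: "'a::metric_space \<Rightarrow> 'a set \<Rightarrow> ereal" where
  "dist_to_set x A = (INF y\<in>A. ereal (dist x y))"


definition projection_valued_measure :: "(real set \<Rightarrow> 'a::real_inner \<Rightarrow> 'a) \<Rightarrow> bool" where
  "projection_valued_measure E \<longleftrightarrow>
     (\<forall>A\<in>sets borel. bounded_linear (E A) \<and> (\<forall>u. E A (E A u) = E A u)
        \<and> (\<forall>u v. inner (E A u) v = inner u (E A v)))
     \<and> (\<forall>u. E UNIV u = u)
     \<and> (\<forall>A::nat \<Rightarrow> real set. range A \<subseteq> sets borel \<longrightarrow> disjoint_family A \<longrightarrow>
          (\<forall>u. (\<lambda>n. E (A n) u) sums E (\<Union>n. A n) u))"

definition vector_measure :: "(real set \<Rightarrow> 'a::real_inner \<Rightarrow> 'a) \<Rightarrow> 'a \<Rightarrow> real measure" where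
  "vector_measure E u = measure_of UNIV (sets borel) (\<lambda>A. ennreal (inner u (E A u)))"

text \<open>
  The operator \<open>\<integral> f dE\<close>: its domain is \<open>{u. \<integral> f\<^sup>2 d\<langle>u, E u\<rangle> < \<infinity>}\<close>, and its value at \<open>u\<close> is the
  vector \<open>w\<close> with \<open>\<langle>v, w\<rangle> = \<integral> f d\<langle>v, E u\<rangle>\<close> for all \<open>v\<close> in the (dense) domain, where the signed
  measure \<open>\<langle>v, E u\<rangle>\<close> is expressed through the positive ones by polarization.
\<close>

definition spectral_integral ::
  "(real set \<Rightarrow> 'a::real_inner \<Rightarrow> 'a) \<Rightarrow> (real \<Rightarrow> real) \<Rightarrow> 'a unbounded_operator" where
  "spectral_integral E f =
     (let D = {u. integrable (vector_measure E u) (\<lambda>x. (f x)\<^sup>2)}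
      in Operator D
           (\<lambda>u. THE w. \<forall>v\<in>D. inner v w =
              ((\<integral>x. f x \<partial>vector_measure E (v + u)) - (\<integral>x. f x \<partial>vector_measure E (v - u))) / 4))"

definition is_spectral_measure ::
  "'a::real_inner unbounded_operator \<Rightarrow> (real set \<Rightarrow> 'a \<Rightarrow> 'a) \<Rightarrow> bool" where
  "is_spectral_measure A E \<longleftrightarrow>
     projection_valued_measure E \<and> op_eq A (spectral_integral E (\<lambda>x. x))"

text \<open>
  For self-adjoint \<open>A\<close> the spectral theorem gives a spectral measure, unique on the Borel sets;
  the choice below only concerns values on non-Borel sets, which are not used.
\<close>

definition functional_calculus ::
  "(real \<Rightarrow> real) \<Rightarrow> 'a::real_inner unbounded_operator \<Rightarrow> 'a unbounded_operator" where
  "functional_calculus f A = spectral_integral (SOME E. is_spectral_measure A E) f"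


definition axis_cone :: "'a::real_inner \<Rightarrow> 'a set" where
  "axis_cone u0 = {u. inner u0 u \<ge> norm u / sqrt 2}"

definition strictly_positive :: "'a::real_inner set \<Rightarrow> 'a set" where
  "strictly_positive C = {u \<in> C - {0}. \<forall>v\<in>C - {0}. inner v u > 0}"

definition bounded_operator :: "'a::real_normed_vector unbounded_operator \<Rightarrow> bool" where
  "bounded_operator A \<longleftrightarrow> Dom A = UNIV \<and> bounded_linear (app A)"

definition positivity_improving ::
  "'a::real_inner set \<Rightarrow> 'a unbounded_operator \<Rightarrow> bool" where
  "positivity_improving C A \<longleftrightarrow>
     bounded_operator A \<and> app A ` (C - {0}) \<subseteq> strictly_positive C"

end

theory Submission
  imports Defs "HOL-Probability.Helly_Selection" "HOL-Real_Asymp.Real_Asymp"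
begin

text \<open>
  Write \<open>A = T + S(\<kappa>)\<close> and \<open>w(s) = e\<^sup>-\<^sup>s\<^sup>A u\<close>. A vector \<open>x = p u0 + y\<close> with \<open>y\<close> orthogonal to \<open>u0\<close> lies
  in the cone iff \<open>p \<ge> 0\<close> and \<open>K(x) = 2\<langle>u0, x\<rangle>\<^sup>2 - \<parallel>x\<parallel>\<^sup>2 = p\<^sup>2 - \<parallel>y\<parallel>\<^sup>2 \<ge> 0\<close>. Along the flow \<open>w' = - A w\<close>
  the cross terms between \<open>u0\<close> and its complement cancel, and
    \<open>d/ds K(w) = 2\<langle>y, A y\<rangle> - 2 p\<^sup>2 \<langle>u0, A u0\<rangle>\<close>.
  If the form of \<open>A\<close> on the complement of \<open>u0\<close> exceeds \<open>b = \<langle>u0, A u0\<rangle>\<close> by some \<open>g > 0\<close>, then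
  \<open>d/ds K \<ge> - 2 b K + 2 g \<parallel>y\<parallel>\<^sup>2\<close>, so \<open>e\<^sup>2\<^sup>b\<^sup>s K\<close> is increasing; if \<open>u \<noteq> 0\<close>
  lies in the cone, it is strictly positive for \<open>s > 0\<close>.
  This is \<open>positivity_improving_semigroup\<close>.

  It remains to compare two quadratic forms. The spectral gap gives \<open>\<langle>y, T y\<rangle> \<ge> (\<mu> + \<delta>) \<parallel>y\<parallel>\<^sup>2\<close> for
  \<open>y\<close> orthogonal to \<open>u0\<close> (\<open>spectral_gap_form_bound\<close>). The relative bound gives
  \<open>\<parallel>S v\<parallel> \<le> c \<parallel>(T - \<mu> + \<epsilon>) v\<parallel>\<close>, and by Reid's inequality the same constant bounds the forms:
  \<open>\<bar>\<langle>v, S v\<rangle>\<bar> \<le> c \<langle>v, (T - \<mu> + \<epsilon>) v\<rangle>\<close> (\<open>form_bound_if_relatively_bounded\<close>). With \<open>\<delta> = 2 \<epsilon>\<close> this yields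
  the form gap \<open>g = \<epsilon> (2 - 4 c)\<close>, and the smallness condition on \<open>c\<close> forces \<open>c < 1/2\<close>.

  The operators \<open>e\<^sup>-\<^sup>s\<^sup>A\<close> are integrals against a spectral measure, whose existence is
  \<open>spectral_measure_exists\<close>. A resolvent \<open>N\<close> of a semibounded operator, suitably scaled, satisfies
  \<open>0 \<le> N \<le> 1\<close>; hence Bernstein polynomials are nonnegative on \<open>N\<close>, the numbers \<open>\<langle>u, N\<^sup>k u\<rangle>\<close> are the
  moments of a measure on the unit interval, and a Dynkin argument turns these measures into projections.
  The spectral measure of the unbounded operator is the image of that of \<open>N\<close>. The operator \<open>T + S(\<kappa>)\<close>
  has such a resolvent by a fixed point argument in the style of Kato and Rellich.
\<close>

section \<open>Symmetric operators and their resolvents\<close>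

lemma Cauchy_if_dist_square_le:
  fixes X :: "nat \<Rightarrow> 'a::real_normed_vector"
  assumes le: "\<And>n m. (norm (X n - X m))\<^sup>2 \<le> 2 * I n + 2 * I m" and lim: "I \<longlonglongrightarrow> 0"
  shows "Cauchy X"
proof (rule metric_CauchyI)
  fix e :: real assume e: "0 < e"
  then obtain N where N: "\<And>n. n \<ge> N \<Longrightarrow> norm (I n) < e\<^sup>2 / 4"
    using LIMSEQ_D[OF lim, of "e\<^sup>2 / 4"] by auto
  have "dist (X n) (X m) < e" if "n \<ge> N" "m \<ge> N" for n m
  proof -
    have "(norm (X n - X m))\<^sup>2 < e\<^sup>2"
      using le[of n m] N[OF that(1)] N[OF that(2)] by simp
    then show ?thesis using e by (simp add: dist_norm power2_less_imp_less)
  qed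
  then show "\<exists>N. \<forall>m\<ge>N. \<forall>n\<ge>N. dist (X m) (X n) < e" by blast
qed

text \<open>
  The projection theorem: the difference between a point outside \<open>V\<close> and its nearest point in \<open>V\<close>.
  By the parallelogram law a minimising sequence for the distance is Cauchy.
\<close>

lemma orthogonal_vector_exists:
  fixes V :: "'a::{real_inner, banach} set"
  assumes "closed V" "subspace V" "V \<noteq> UNIV"
  obtains w where "w \<noteq> 0" "\<And>v. v \<in> V \<Longrightarrow> inner v w = 0"
proof -
  obtain x where x: "x \<notin> V" using assms(3) by blast
  define d where "d = (infdist x V)\<^sup>2"
  have ne: "V \<noteq> {}" using subspace_0[OF assms(2)] by blast
  have dle: "d \<le> (norm (x - v))\<^sup>2" if "v \<in> V" for v
    unfolding d_def using infdist_le[OF that, of x] by (intro power_mono) (auto simp: dist_norm infdist_nonneg)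
  have "\<exists>v\<in>V. (norm (x - v))\<^sup>2 < d + 1 / real (Suc n)" for n
  proof -
    have "infdist x V < sqrt (d + 1 / real (Suc n))"
      by (rule real_less_rsqrt) (simp add: d_def)
    then obtain v where v: "v \<in> V" "dist x v < sqrt (d + 1 / real (Suc n))"
      using infdist_attains_inf cInf_less_iff[of "dist x ` V"] ne unfolding infdist_def
      by (auto intro!: bdd_belowI[where m=0])
    have "(norm (x - v))\<^sup>2 < (sqrt (d + 1 / real (Suc n)))\<^sup>2"
      using v(2) by (intro power_strict_mono) (auto simp: dist_norm)
    then show ?thesis using v(1) by (auto simp: d_def)
  qed
  then obtain v where v: "\<And>n. v n \<in> V" "\<And>n. (norm (x - v n))\<^sup>2 < d + 1 / real (Suc n)" by metis
  have close: "(norm (v n - v m))\<^sup>2 \<le> 2 / real (Suc n) + 2 / real (Suc m)" for n m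
  proof -
    have "(1/2) *\<^sub>R (v n + v m) \<in> V"
      using v(1) assms(2) by (simp add: subspace_add subspace_scale)
    then have "d \<le> (norm (x - (1/2) *\<^sub>R (v n + v m)))\<^sup>2" by (rule dle)
    moreover have "(norm (v n - v m))\<^sup>2 = 2 * (norm (x - v n))\<^sup>2 + 2 * (norm (x - v m))\<^sup>2
        - 4 * (norm (x - (1/2) *\<^sub>R (v n + v m)))\<^sup>2"
      unfolding power2_norm_eq_inner by (simp add: algebra_simps inner_commute)
    ultimately show ?thesis using v(2)[of n] v(2)[of m] by simp
  qed
  \<comment> \<open>With \<open>I n = 1 / (n + 1)\<close>, the excess of the squared distances over their infimum.\<close>
  have "Cauchy v"
    by (rule Cauchy_if_dist_square_le[OF _ LIMSEQ_Suc[OF lim_1_over_n]]) (use close in simp)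
  then obtain p where p: "v \<longlonglongrightarrow> p" using Cauchy_convergent_iff convergent_def by blast
  have pV: "p \<in> V" using closed_sequentially[OF assms(1) v(1) p] .
  have "(norm (x - p))\<^sup>2 \<le> d"
  proof (rule LIMSEQ_le)
    show "(\<lambda>n. (norm (x - v n))\<^sup>2) \<longlonglongrightarrow> (norm (x - p))\<^sup>2" by (intro tendsto_intros p)
    show "(\<lambda>n. d + 1 / real (Suc n)) \<longlonglongrightarrow> d"
      using tendsto_add[OF tendsto_const[of d] LIMSEQ_Suc[OF lim_1_over_n]] by simp
  qed (use v(2) less_imp_le in blast)
  define w where "w = x - p"
  have "inner u w = 0" if u: "u \<in> V" for u
  proof (cases "u = 0")
    case False
    \<comment> \<open>The minimiser of \<open>\<parallel>w - t u\<parallel>\<close>.\<close>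
    define t where "t = inner u w / (norm u)\<^sup>2"
    have "p + t *\<^sub>R u \<in> V" using pV u assms(2) by (simp add: subspace_add subspace_scale)
    from dle[OF this] have "(norm w)\<^sup>2 \<le> (norm (w - t *\<^sub>R u))\<^sup>2"
      using \<open>(norm (x - p))\<^sup>2 \<le> d\<close> unfolding w_def diff_diff_eq by (rule order_trans[rotated])
    also have "\<dots> = (norm w)\<^sup>2 - 2 * t * inner u w + t\<^sup>2 * (norm u)\<^sup>2"
      unfolding power2_norm_eq_inner by (simp add: algebra_simps inner_commute power2_eq_square)
    also have "t\<^sup>2 * (norm u)\<^sup>2 = t * inner u w"
      using False by (simp add: t_def power2_eq_square)
    finally have "t * inner u w \<le> 0" by simp
    then have "(inner u w)\<^sup>2 / (norm u)\<^sup>2 \<le> 0" by (simp add: t_def power2_eq_square)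
    then show ?thesis using False by (simp add: divide_le_0_iff)
  qed simp
  moreover have "w \<noteq> 0" using x pV by (auto simp: w_def)
  ultimately show ?thesis using that by blast
qed

lemma dense_orthogonal_zero:
  fixes w :: "'a::real_inner"
  assumes "closure D = UNIV" "\<And>u. u \<in> D \<Longrightarrow> inner u w = 0"
  shows "w = 0"
proof -
  have "closed {u. inner u w = 0}" by (intro closed_Collect_eq continuous_intros)
  then have "closure D \<subseteq> {u. inner u w = 0}" using assms(2) by (intro closure_minimal) auto
  then have "inner w w = 0" using assms(1) by blast
  then show ?thesis by simp
qed

text \<open>
  The domain of a self-adjoint operator is maximal: membership and value can be tested weakly.
  This is how closedness of the operator enters later.
\<close>

lemma self_adjoint_mem:
  assumes T: "self_adjoint T" and w: "\<And>u. u \<in> Dom T \<Longrightarrow> inner (app T u) v = inner u w"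
  shows "v \<in> Dom T" "app T v = w"
proof -
  have eq: "Dom (op_adjoint T) = Dom T" "\<And>u. u \<in> Dom T \<Longrightarrow> app (op_adjoint T) u = app T u"
    and dense: "closure (Dom T) = UNIV"
    using T by (auto simp: self_adjoint_def op_eq_def densely_defined_def)
  have "v \<in> Dom (op_adjoint T)" using w by (auto simp: op_adjoint_def)
  then show v: "v \<in> Dom T" using eq by simp
  have "(THE w. \<forall>u\<in>Dom T. inner (app T u) v = inner u w) = w"
  proof (rule the_equality)
    fix w' assume "\<forall>u\<in>Dom T. inner (app T u) v = inner u w'"
    then have "w' - w = 0"
      using w by (intro dense_orthogonal_zero[OF dense]) (simp add: inner_diff_right)
    then show "w' = w" by simp
  qed (use w in blast)
  then show "app T v = w" using eq(2)[OF v] by (simp add: op_adjoint_def)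
qed

lemma self_adjoint_imp_symmetric:
  assumes T: "self_adjoint T" shows "symmetric_operator T"
proof -
  have "inner (app T u) v = inner u (app T v)" if u: "u \<in> Dom T" and v: "v \<in> Dom T" for u v
  proof -
    have "v \<in> Dom (op_adjoint T)" using T v by (auto simp: self_adjoint_def op_eq_def)
    then obtain w where "\<And>u. u \<in> Dom T \<Longrightarrow> inner (app T u) v = inner u w"
      by (auto simp: op_adjoint_def)
    then show ?thesis using self_adjoint_mem(2)[OF T] u by metis
  qed
  then show ?thesis using T by (auto simp: self_adjoint_def symmetric_operator_def)
qed

lemma symmetric_operatorD:
  assumes "symmetric_operator A"
  shows "subspace (Dom A)"
    and "u \<in> Dom A \<Longrightarrow> v \<in> Dom A \<Longrightarrow> app A (u + v) = app A u + app A v"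
    and "u \<in> Dom A \<Longrightarrow> v \<in> Dom A \<Longrightarrow> app A (u - v) = app A u - app A v"
    and "u \<in> Dom A \<Longrightarrow> app A (t *\<^sub>R u) = t *\<^sub>R app A u"
    and "u \<in> Dom A \<Longrightarrow> v \<in> Dom A \<Longrightarrow> inner (app A u) v = inner u (app A v)"
proof -
  have A: "subspace (Dom A)" "\<And>u v. u \<in> Dom A \<Longrightarrow> v \<in> Dom A \<Longrightarrow> app A (u + v) = app A u + app A v"
    "\<And>u t. u \<in> Dom A \<Longrightarrow> app A (t *\<^sub>R u) = t *\<^sub>R app A u"
    using assms unfolding symmetric_operator_def linear_operator_def by auto
  then show "subspace (Dom A)" "u \<in> Dom A \<Longrightarrow> v \<in> Dom A \<Longrightarrow> app A (u + v) = app A u + app A v"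
    "u \<in> Dom A \<Longrightarrow> app A (t *\<^sub>R u) = t *\<^sub>R app A u" by auto
  show "app A (u - v) = app A u - app A v" if "u \<in> Dom A" "v \<in> Dom A"
    using A(2)[of u "(-1) *\<^sub>R v"] A(3)[of v "-1"] subspace_scale[OF A(1), of v "-1"] that by simp
  show "u \<in> Dom A \<Longrightarrow> v \<in> Dom A \<Longrightarrow> inner (app A u) v = inner u (app A v)"
    using assms unfolding symmetric_operator_def by auto
qed

text \<open>
  The two-sided inverse of \<open>A - l\<close> on the real space itself, the real counterpart of the complexified
  condition in \<^const>\<open>resolvent_set\<close>.
\<close>

definition is_resolvent :: "'a::real_normed_vector unbounded_operator \<Rightarrow> real \<Rightarrow> ('a \<Rightarrow> 'a) \<Rightarrow> bool" where
  "is_resolvent A l N \<longleftrightarrow> bounded_linear N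
     \<and> (\<forall>w. N w \<in> Dom A \<and> app A (N w) - l *\<^sub>R N w = w)
     \<and> (\<forall>u\<in>Dom A. N (app A u - l *\<^sub>R u) = u)"

lemma coercive_norm_bound:
  fixes A :: "'a::real_inner unbounded_operator"
  assumes "k * (norm u)\<^sup>2 \<le> inner u (app A u) - l * (norm u)\<^sup>2"
  shows "k * norm u \<le> norm (app A u - l *\<^sub>R u)"
proof (cases "u = 0")
  case False
  have "k * (norm u)\<^sup>2 \<le> inner u (app A u - l *\<^sub>R u)"
    using assms by (simp add: inner_diff_right power2_norm_eq_inner)
  also have "\<dots> \<le> norm u * norm (app A u - l *\<^sub>R u)" by (rule norm_cauchy_schwarz)
  finally have "norm u * (k * norm u) \<le> norm u * norm (app A u - l *\<^sub>R u)"
    by (simp add: power2_eq_square mult_ac)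
  then show ?thesis using False by simp
qed simp

lemma resolvent_if_surjective:
  assumes A: "symmetric_operator A" and k: "k > 0"
    and bound: "\<And>u. u \<in> Dom A \<Longrightarrow> k * (norm u)\<^sup>2 \<le> inner u (app A u) - l * (norm u)\<^sup>2"
    and surj: "\<And>w. \<exists>u\<in>Dom A. app A u - l *\<^sub>R u = w"
  obtains N where "is_resolvent A l N" "\<And>u v. inner (N u) v = inner u (N v)"
    "\<And>w. k * (norm (N w))\<^sup>2 \<le> inner w (N w)"
proof -
  note AD = symmetric_operatorD[OF A]
  let ?B = "\<lambda>u. app A u - l *\<^sub>R u"
  have Bdiff: "?B (u - v) = ?B u - ?B v" if "u \<in> Dom A" "v \<in> Dom A" for u v
    using AD(3)[OF that] by (simp add: algebra_simps)
  obtain N where N: "\<And>w. N w \<in> Dom A" "\<And>w. ?B (N w) = w" using surj by metis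
  have inj: "u = v" if "u \<in> Dom A" "v \<in> Dom A" "?B u = ?B v" for u v
  proof -
    have "k * norm (u - v) \<le> norm (?B (u - v))"
      by (rule coercive_norm_bound[OF bound]) (simp add: that subspace_diff[OF AD(1)])
    then show ?thesis using k that Bdiff[OF that(1,2)] by (simp add: mult_le_0_iff)
  qed
  have left: "N (?B u) = u" if "u \<in> Dom A" for u using inj[of "N (?B u)" u] N that by blast
  have "bounded_linear N"
  proof (rule bounded_linear_intro)
    show "N (u + v) = N u + N v" for u v
    proof (rule inj)
      show "?B (N (u + v)) = ?B (N u + N v)"
        using N(2)[of u] N(2)[of v] N(2)[of "u + v"] AD(2)[OF N(1) N(1), of u v] by (simp add: algebra_simps)
    qed (use N(1) AD(1) in \<open>auto intro: subspace_add\<close>)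
    show "N (t *\<^sub>R u) = t *\<^sub>R N u" for t u
    proof (rule inj)
      have "?B (t *\<^sub>R N u) = t *\<^sub>R ?B (N u)" using AD(4)[OF N(1)] by (simp add: algebra_simps)
      then show "?B (N (t *\<^sub>R u)) = ?B (t *\<^sub>R N u)" using N(2)[of u] N(2)[of "t *\<^sub>R u"] by simp
    qed (use N(1) AD(1) in \<open>auto intro: subspace_scale\<close>)
    show "norm (N w) \<le> norm w * (1 / k)" for w
      using coercive_norm_bound[OF bound[OF N(1)], of w] N(2)[of w] k by (simp add: field_simps)
  qed
  then have "is_resolvent A l N" unfolding is_resolvent_def using N left by blast
  moreover have "inner (N u) v = inner u (N v)" for u v
  proof -
    have "inner (N u) (?B (N v)) = inner (?B (N u)) (N v)"
      using AD(5)[OF N(1) N(1), of u v] by (simp add: inner_diff_left inner_diff_right)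
    then show ?thesis using N(2) by simp
  qed
  moreover have "k * (norm (N w))\<^sup>2 \<le> inner w (N w)" for w
  proof -
    have "inner (N w) (?B (N w)) = inner w (N w)" using N(2) by (simp add: inner_commute)
    then show ?thesis using bound[OF N(1), of w] by (simp add: inner_diff_right power2_norm_eq_inner)
  qed
  ultimately show ?thesis using that by blast
qed

text \<open>
  The range of \<open>T - l\<close> is closed because \<open>T - l\<close> is bounded below and \<open>T\<close> is closed; it is dense
  because a vector orthogonal to it would be an eigenvector for \<open>l\<close>, which the form bound excludes.
\<close>

lemma self_adjoint_surjective:
  fixes T :: "'a::{real_inner, banach} unbounded_operator"
  assumes T: "self_adjoint T" and k: "k > 0"
    and bound: "\<And>u. u \<in> Dom T \<Longrightarrow> k * (norm u)\<^sup>2 \<le> inner u (app T u) - l * (norm u)\<^sup>2"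
  shows "\<exists>u\<in>Dom T. app T u - l *\<^sub>R u = w"
proof -
  note TD = symmetric_operatorD[OF self_adjoint_imp_symmetric[OF T]]
  let ?B = "\<lambda>u. app T u - l *\<^sub>R u"
  let ?R = "?B ` Dom T"
  have Bdiff: "?B (u - v) = ?B u - ?B v" if "u \<in> Dom T" "v \<in> Dom T" for u v
    using TD(3)[OF that] by (simp add: algebra_simps)
  have "subspace ?R"
  proof (rule subspaceI)
    show "0 \<in> ?R"
      using subspace_0[OF TD(1)] TD(4)[of 0 0] by (auto intro!: image_eqI[of _ _ 0])
    fix x y assume "x \<in> ?R" "y \<in> ?R"
    then obtain u v where uv: "u \<in> Dom T" "x = ?B u" "v \<in> Dom T" "y = ?B v" by blast
    then have "x + y = ?B (u + v)" using TD(2)[of u v] by (simp add: scaleR_right_distrib)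
    then show "x + y \<in> ?R" by (simp only:) (intro imageI subspace_add TD(1) uv)
  next
    fix x t assume "x \<in> ?R"
    then obtain u where u: "u \<in> Dom T" "x = ?B u" by blast
    then have "t *\<^sub>R x = ?B (t *\<^sub>R u)" using TD(4) by (simp add: scaleR_diff_right mult.commute)
    then show "t *\<^sub>R x \<in> ?R" by (simp only:) (intro imageI subspace_scale TD(1) u)
  qed
  moreover have "closed ?R"
    unfolding closed_sequential_limits
  proof (intro allI impI, elim conjE)
    fix y z assume "\<forall>n. y n \<in> ?R" and lim: "y \<longlonglongrightarrow> z"
    then have "\<forall>n. \<exists>u. u \<in> Dom T \<and> y n = ?B u" by blast
    then obtain u where "\<forall>n. u n \<in> Dom T \<and> y n = ?B (u n)" by (rule choice[THEN exE])
    then have u: "\<And>n. u n \<in> Dom T" "\<And>n. y n = ?B (u n)" by blast+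
    have "k * norm (u n - u m) \<le> norm (y n - y m)" for n m
      using coercive_norm_bound[OF bound, of "u n - u m"] u Bdiff subspace_diff[OF TD(1)] by auto
    then have le: "norm (u n - u m) \<le> norm (y n - y m) / k" for n m
      using k by (simp add: field_simps)
    have "Cauchy y" using lim LIMSEQ_imp_Cauchy by blast
    have "Cauchy u"
    proof (rule metric_CauchyI)
      fix e :: real assume "0 < e"
      then obtain N where N: "\<And>m n. m \<ge> N \<Longrightarrow> n \<ge> N \<Longrightarrow> dist (y m) (y n) < e * k"
        using metric_CauchyD[OF \<open>Cauchy y\<close>, of "e * k"] k by auto
      have "dist (u m) (u n) < e" if "m \<ge> N" "n \<ge> N" for m n
        using order_le_less_trans[OF le[of m n]] N[OF that] k by (simp add: dist_norm pos_divide_less_eq)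
      then show "\<exists>N. \<forall>m\<ge>N. \<forall>n\<ge>N. dist (u m) (u n) < e" by blast
    qed
    then obtain x where x: "u \<longlonglongrightarrow> x" using Cauchy_convergent_iff convergent_def by blast
    have "inner (app T v) x = inner v (z + l *\<^sub>R x)" if v: "v \<in> Dom T" for v
    proof (rule LIMSEQ_unique)
      show "(\<lambda>n. inner (app T v) (u n)) \<longlonglongrightarrow> inner (app T v) x" by (intro tendsto_intros x)
      have "inner (app T v) (u n) = inner v (y n + l *\<^sub>R u n)" for n
        using TD(5)[OF v u(1)] u(2) by simp
      then show "(\<lambda>n. inner (app T v) (u n)) \<longlonglongrightarrow> inner v (z + l *\<^sub>R x)"
        by simp (intro tendsto_intros x lim)
    qed
    from self_adjoint_mem[OF T this] have "x \<in> Dom T" "?B x = z" by auto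
    then show "z \<in> ?R" by blast
  qed
  moreover have "w = 0" if "\<And>v. v \<in> ?R \<Longrightarrow> inner v w = 0" for w
  proof -
    have "inner (app T u) w = inner u (l *\<^sub>R w)" if "u \<in> Dom T" for u
      using \<open>\<And>v. v \<in> ?R \<Longrightarrow> inner v w = 0\<close>[of "?B u"] that by (auto simp: inner_diff_left)
    from self_adjoint_mem[OF T this] have "w \<in> Dom T" "app T w = l *\<^sub>R w" by auto
    then have "k * (norm w)\<^sup>2 \<le> 0" using bound[of w] by (simp add: power2_norm_eq_inner)
    then show "w = 0" using k by (simp add: mult_le_0_iff)
  qed
  ultimately have "?R = UNIV" using orthogonal_vector_exists[of ?R] by metis
  then have "w \<in> ?R" by simp
  then show ?thesis by (rule imageE) auto
qed

section \<open>Integration against a projection-valued measure\<close>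

locale pvm =
  fixes E :: "real set \<Rightarrow> 'a::{real_inner, banach} \<Rightarrow> 'a"
  assumes pvm: "projection_valued_measure E"
begin

lemma linear_E: "A \<in> sets borel \<Longrightarrow> bounded_linear (E A)"
  and idem_E: "A \<in> sets borel \<Longrightarrow> E A (E A u) = E A u"
  and sym_E: "A \<in> sets borel \<Longrightarrow> inner (E A u) v = inner u (E A v)"
  and E_UNIV: "E UNIV u = u"
  and E_sums: "range F \<subseteq> sets borel \<Longrightarrow> disjoint_family F \<Longrightarrow> (\<lambda>n. E (F n) u) sums E (\<Union>n::nat. F n) u"
  using pvm unfolding projection_valued_measure_def by blast+

lemma E_add: "A \<in> sets borel \<Longrightarrow> E A (u + v) = E A u + E A v"
  and E_diff: "A \<in> sets borel \<Longrightarrow> E A (u - v) = E A u - E A v"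
  and E_scale: "A \<in> sets borel \<Longrightarrow> E A (c *\<^sub>R u) = c *\<^sub>R E A u"
  and E_minus: "A \<in> sets borel \<Longrightarrow> E A (- u) = - E A u"
  and E_zero: "A \<in> sets borel \<Longrightarrow> E A 0 = 0"
  and E_sum: "A \<in> sets borel \<Longrightarrow> E A (\<Sum>i\<in>I. g i) = (\<Sum>i\<in>I. E A (g i))"
  using linear_E[of A] by (simp_all add: linear_simps bounded_linear.linear linear_sum)

lemma inner_E: "A \<in> sets borel \<Longrightarrow> inner u (E A u) = (norm (E A u))\<^sup>2"
  by (metis idem_E power2_norm_eq_inner sym_E)

lemma norm_E_le: assumes "A \<in> sets borel" shows "norm (E A u) \<le> norm u"
proof -
  have "norm (E A u) * norm (E A u) \<le> norm u * norm (E A u)"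
    using norm_cauchy_schwarz[of u "E A u"] inner_E[OF assms, of u] by (simp add: power2_eq_square)
  then show ?thesis
    by (cases "E A u = 0") auto
qed

lemma E_empty: "E {} u = 0"
proof -
  have "(\<lambda>n::nat. E {} u) sums E (\<Union>n::nat. {}) u"
    by (rule E_sums) (auto simp: disjoint_family_on_def)
  then have "summable (\<lambda>n::nat. E {} u)" by (auto simp: summable_def)
  then show ?thesis by (simp add: summable_const_iff)
qed

lemma E_Un:
  assumes [measurable]: "A \<in> sets borel" "B \<in> sets borel" and "A \<inter> B = {}"
  shows "E (A \<union> B) u = E A u + E B u"
proof -
  have "(\<lambda>n. E (binaryset A B n) u) sums E (\<Union>n. binaryset A B n) u"
    using assms by (intro E_sums) (auto simp: range_binaryset_eq disjoint_family_on_def binaryset_def)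
  moreover have "(\<lambda>n. E (binaryset A B n) u) sums (E A u + E B u)"
    by (rule binaryset_sums[of "\<lambda>A. E A u"]) (simp add: E_empty)
  ultimately show ?thesis
    using sums_unique2 by (fastforce simp: UN_binaryset_eq)
qed

text \<open>
  For \<open>w\<close> in the range of \<open>E B\<close>, the form of \<open>E (A \<union> B)\<close> at \<open>w\<close> is \<open>\<parallel>E A w\<parallel>\<^sup>2 + \<parallel>w\<parallel>\<^sup>2\<close>, but it cannot
  exceed \<open>\<parallel>w\<parallel>\<^sup>2\<close>.
\<close>

lemma E_orthogonal:
  assumes [measurable]: "A \<in> sets borel" "B \<in> sets borel" and "A \<inter> B = {}"
  shows "E A (E B u) = 0"
proof -
  let ?w = "E B u"
  have AB: "A \<union> B \<in> sets borel" by measurable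
  have "inner ?w (E (A \<union> B) ?w) = (norm (E A ?w))\<^sup>2 + (norm ?w)\<^sup>2"
    using assms by (simp add: E_Un inner_add_right inner_E idem_E power2_norm_eq_inner[of "E B u"])
  moreover have "inner ?w (E (A \<union> B) ?w) \<le> (norm ?w)\<^sup>2"
    using norm_E_le[OF AB, of ?w] by (simp add: inner_E[OF AB] power_mono)
  ultimately show ?thesis by simp
qed

lemma E_Int:
  assumes [measurable]: "A \<in> sets borel" "B \<in> sets borel"
  shows "E A (E B u) = E (A \<inter> B) u"
proof -
  have 1: "E B u = E (A \<inter> B) u + E (B - A) u"
    using E_Un[of "A \<inter> B" "B - A" u] assms by (metis Diff_disjoint Int_Diff_Un Int_assoc Int_commute Int_empty_right sets.Diff sets.Int)
  have "E A (E (A \<inter> B) u) = E (A \<inter> B) (E (A \<inter> B) u) + E (A - B) (E (A \<inter> B) u)"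
    using E_Un[of "A \<inter> B" "A - B" "E (A \<inter> B) u"] assms
    by (metis Diff_disjoint Int_Diff_Un Int_assoc Int_empty_right sets.Diff sets.Int)
  also have "\<dots> = E (A \<inter> B) u"
    using E_orthogonal[of "A - B" "A \<inter> B" u] by (auto simp: idem_E)
  finally have 2: "E A (E (A \<inter> B) u) = E (A \<inter> B) u" .
  have "E A (E (B - A) u) = 0" by (rule E_orthogonal) auto
  then show ?thesis using 1 2 by (simp add: E_add)
qed

abbreviation M where "M \<equiv> vector_measure E"

lemma sets_M [measurable_cong, simp]: "sets (M u) = sets borel"
  and space_M [simp]: "space (M u) = UNIV"
  unfolding vector_measure_def by (simp_all add: sets_measure_of_conv space_measure_of_conv sets.sigma_sets_eq[of borel, simplified])

lemma emeasure_M: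
  assumes "A \<in> sets borel" shows "emeasure (M u) A = ennreal ((norm (E A u))\<^sup>2)"
proof -
  have "emeasure (M u) A = ennreal (inner u (E A u))"
  proof (rule emeasure_measure_of[OF vector_measure_def])
    show "positive (sets (M u)) (\<lambda>A. ennreal (inner u (E A u)))"
      by (simp add: positive_def E_empty)
    show "countably_additive (sets (M u)) (\<lambda>A. ennreal (inner u (E A u)))"
    proof (rule countably_additiveI)
      fix F :: "nat \<Rightarrow> real set" assume F: "range F \<subseteq> sets (M u)" "disjoint_family F"
      then have "(\<lambda>n. E (F n) u) sums E (\<Union>n. F n) u" by (intro E_sums) auto
      then have "(\<lambda>n. inner u (E (F n) u)) sums inner u (E (\<Union>n. F n) u)"
        by (rule bounded_linear.sums[OF bounded_linear_inner_right])
      moreover have "0 \<le> inner u (E (F n) u)" for n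
        using F by (subst inner_E) auto
      ultimately show "(\<Sum>n. ennreal (inner u (E (F n) u))) = ennreal (inner u (E (\<Union>n. F n) u))"
        using F by (intro sums_unique[symmetric] iffD2[OF sums_ennreal])
          (auto simp: inner_E sets.countable_UN)
    qed
  qed (use assms in auto)
  then show ?thesis using assms by (simp add: inner_E)
qed

lemma finite_M [simp]: "finite_measure (M u)"
  by (rule finite_measureI) (simp add: emeasure_M E_UNIV)

lemma measure_M: "A \<in> sets borel \<Longrightarrow> measure (M u) A = (norm (E A u))\<^sup>2"
  by (simp add: measure_def emeasure_M)

text \<open>
  Shows that the domain of a spectral integral is closed under addition.
\<close>

lemma nn_integral_M_parallelogram:
  assumes "f \<in> borel_measurable borel"
  shows "(\<integral>\<^sup>+x. f x \<partial>M (u + v)) + (\<integral>\<^sup>+x. f x \<partial>M (u - v)) =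
    2 * (\<integral>\<^sup>+x. f x \<partial>M u) + 2 * (\<integral>\<^sup>+x. f x \<partial>M v)"
  using assms
proof (induction rule: borel_measurable_induct)
  case (cong f g)
  then show ?case by (simp cong: nn_integral_cong)
next
  case (set A)
  have "(norm (E A (u + v)))\<^sup>2 + (norm (E A (u - v)))\<^sup>2 = 2 * (norm (E A u))\<^sup>2 + 2 * (norm (E A v))\<^sup>2"
    using set by (simp add: E_add E_diff power2_norm_eq_inner algebra_simps inner_commute)
  then have "ennreal ((norm (E A (u + v)))\<^sup>2) + ennreal ((norm (E A (u - v)))\<^sup>2)
     = 2 * ennreal ((norm (E A u))\<^sup>2) + 2 * ennreal ((norm (E A v))\<^sup>2)"
    by (metis ennreal_mult ennreal_numeral ennreal_plus zero_le_power2 zero_le_numeral mult_nonneg_nonneg)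
  then show ?case using set by (simp add: emeasure_M)
next
  case (mult g c)
  have "c * a + c * b = 2 * (c * a') + 2 * (c * b')" if "a + b = 2 * a' + 2 * b'" for a b a' b' :: ennreal
  proof -
    have "c * a + c * b = c * (2 * a' + 2 * b')" by (simp only: that flip: distrib_left)
    then show ?thesis by (simp only: distrib_left ac_simps)
  qed
  from this[OF mult(4)] show ?case using mult by (simp add: nn_integral_cmult)
next
  case (add g h)
  have "(a + c) + (b + d) = 2 * (a' + c') + 2 * (b' + d')"
    if "a + b = 2 * a' + 2 * b'" "c + d = 2 * c' + 2 * d'" for a b a' b' c d c' d' :: ennreal
  proof -
    have "(a + c) + (b + d) = (a + b) + (c + d)" by (simp add: ac_simps)
    also have "\<dots> = 2 * a' + 2 * b' + (2 * c' + 2 * d')" by (simp only: that)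
    also have "\<dots> = 2 * (a' + c') + 2 * (b' + d')" unfolding distrib_left by (simp only: ac_simps)
    finally show ?thesis .
  qed
  from this[OF add.IH(2) add.IH(1)] show ?case using add.hyps by (simp add: nn_integral_add)
next
  case (seq F)
  have eq: "(\<integral>\<^sup>+x. (SUP i. F i) x \<partial>M w) = (SUP i. \<integral>\<^sup>+x. F i x \<partial>M w)" for w
    using seq by (simp add: nn_integral_monotone_convergence_SUP image_comp)
  have inc: "incseq (\<lambda>i. \<integral>\<^sup>+x. F i x \<partial>M w)" for w
    using seq(3) by (auto simp: incseq_def le_fun_def intro!: nn_integral_mono)
  have inc2: "incseq (\<lambda>i. 2 * \<integral>\<^sup>+x. F i x \<partial>M w)" for w
    using inc[of w] by (auto simp: incseq_def intro!: mult_left_mono)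
  show ?case
    unfolding eq SUP_mult_left_ennreal ennreal_SUP_add[OF inc inc, symmetric]
      ennreal_SUP_add[OF inc2 inc2, symmetric] using seq.IH by simp
qed

lemma nn_integral_M_scale:
  assumes "f \<in> borel_measurable borel"
  shows "(\<integral>\<^sup>+x. f x \<partial>M (c *\<^sub>R u)) = ennreal (c\<^sup>2) * (\<integral>\<^sup>+x. f x \<partial>M u)"
proof -
  have "M (c *\<^sub>R u) = scale_measure (ennreal (c\<^sup>2)) (M u)"
    by (rule measure_eqI) (auto simp: emeasure_M E_scale power_mult_distrib ennreal_mult)
  then show ?thesis using assms by (simp add: nn_integral_scale_measure)
qed

lemma M_minus: "M (- u) = M u"
  by (rule measure_eqI) (auto simp: emeasure_M E_minus)

lemma M_diff_commute: "M (u - v) = M (v - u)"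
  using M_minus[of "u - v"] by simp

lemma M_zero: "emeasure (M 0) A = 0"
  by (cases "A \<in> sets borel") (auto simp: emeasure_M E_zero emeasure_notin_sets)

definition L2_dom :: "(real \<Rightarrow> real) \<Rightarrow> 'a set" where
  "L2_dom f = {u. integrable (M u) (\<lambda>x. (f x)\<^sup>2)}"

definition polar :: "(real \<Rightarrow> real) \<Rightarrow> 'a \<Rightarrow> 'a \<Rightarrow> real" where
  "polar f v u = ((\<integral>x. f x \<partial>M (v + u)) - (\<integral>x. f x \<partial>M (v - u))) / 4"

text \<open>
  \<open>L2_dom f\<close> and \<open>Phi f\<close> are the two components of the operator \<^const>\<open>spectral_integral\<close>, and
  \<open>polar f v u\<close> is the integral of \<open>f\<close> against the signed measure \<open>\<langle>v, E u\<rangle>\<close>.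
\<close>

definition Phi :: "(real \<Rightarrow> real) \<Rightarrow> 'a \<Rightarrow> 'a" where
  "Phi f u = (THE w. \<forall>v\<in>L2_dom f. inner v w = polar f v u)"

lemma spectral_integral_eq: "spectral_integral E f = Operator (L2_dom f) (Phi f)"
  unfolding spectral_integral_def L2_dom_def Phi_def polar_def Let_def by simp

lemma L2_dom_mono:
  assumes "u \<in> L2_dom g" "f \<in> borel_measurable borel" "AE x in M u. \<bar>f x\<bar> \<le> c * \<bar>g x\<bar>"
  shows "u \<in> L2_dom f"
  unfolding L2_dom_def mem_Collect_eq
proof (rule Bochner_Integration.integrable_bound)
  show "integrable (M u) (\<lambda>x. c\<^sup>2 * (g x)\<^sup>2)" using assms(1) by (simp add: L2_dom_def)
  show "AE x in M u. norm ((f x)\<^sup>2) \<le> norm (c\<^sup>2 * (g x)\<^sup>2)"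
    using assms(3)
  proof eventually_elim
    case (elim x)
    then have "\<bar>f x\<bar>\<^sup>2 \<le> (c * \<bar>g x\<bar>)\<^sup>2" by (intro power_mono) auto
    then show ?case by (simp add: power_mult_distrib)
  qed
  show "(\<lambda>x. (f x)\<^sup>2) \<in> borel_measurable (M u)" using assms(2) by simp
qed

lemma L2_dom_const: "u \<in> L2_dom (\<lambda>x. c)"
  unfolding L2_dom_def using finite_measure.integrable_const[OF finite_M] by simp

lemma L2_dom_bounded:
  assumes "f \<in> borel_measurable borel" "AE x in M u. \<bar>f x\<bar> \<le> c"
  shows "u \<in> L2_dom f"
  by (rule L2_dom_mono[OF L2_dom_const[of u 1] assms(1), of c]) (use assms(2) in simp)

lemma L2_dom_add_fun:
  assumes "u \<in> L2_dom f" "u \<in> L2_dom g" and [measurable]: "f \<in> borel_measurable borel" "g \<in> borel_measurable borel"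
  shows "u \<in> L2_dom (\<lambda>x. f x + g x)"
  unfolding L2_dom_def mem_Collect_eq
proof (rule Bochner_Integration.integrable_bound)
  show "integrable (M u) (\<lambda>x. 2 * (f x)\<^sup>2 + 2 * (g x)\<^sup>2)" using assms(1,2) by (simp add: L2_dom_def)
  have "(a + b)\<^sup>2 \<le> 2 * a\<^sup>2 + 2 * b\<^sup>2" for a b :: real
    using zero_le_power2[of "a - b"] by (simp add: power2_eq_square algebra_simps)
  then show "AE x in M u. norm ((f x + g x)\<^sup>2) \<le> norm (2 * (f x)\<^sup>2 + 2 * (g x)\<^sup>2)"
    by (intro AE_I2) simp
qed measurable

lemma L2_dom_cmult: "u \<in> L2_dom f \<Longrightarrow> u \<in> L2_dom (\<lambda>x. c * f x)"
  by (simp add: L2_dom_def power_mult_distrib)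

lemma L2_dom_diff_fun:
  assumes "u \<in> L2_dom f" "u \<in> L2_dom g" "f \<in> borel_measurable borel" "g \<in> borel_measurable borel"
  shows "u \<in> L2_dom (\<lambda>x. f x - g x)"
  using L2_dom_add_fun[OF assms(1) L2_dom_cmult[OF assms(2), of "-1"]] assms(3,4) by simp

lemma L2_dom_iff_nn:
  assumes "f \<in> borel_measurable borel"
  shows "u \<in> L2_dom f \<longleftrightarrow> (\<integral>\<^sup>+x. ennreal ((f x)\<^sup>2) \<partial>M u) < \<infinity>"
  using assms by (simp add: L2_dom_def integrable_iff_bounded)

lemma L2_dom_add:
  assumes "f \<in> borel_measurable borel" "u \<in> L2_dom f" "v \<in> L2_dom f"
  shows "u + v \<in> L2_dom f" and "u - v \<in> L2_dom f"
proof -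
  let ?I = "\<lambda>w. \<integral>\<^sup>+x. ennreal ((f x)\<^sup>2) \<partial>M w"
  have "?I (u + v) + ?I (u - v) = 2 * ?I u + 2 * ?I v"
    by (rule nn_integral_M_parallelogram) (use assms(1) in simp)
  also have "\<dots> < \<infinity>"
    using assms by (simp add: L2_dom_iff_nn ennreal_mult_less_top)
  finally show "u + v \<in> L2_dom f" "u - v \<in> L2_dom f"
    using assms(1) by (simp_all add: L2_dom_iff_nn)
qed

lemma L2_dom_scale:
  assumes "f \<in> borel_measurable borel" "u \<in> L2_dom f"
  shows "c *\<^sub>R u \<in> L2_dom f"
  using nn_integral_M_scale[of "\<lambda>x. ennreal ((f x)\<^sup>2)" c u] assms
  by (simp add: L2_dom_iff_nn ennreal_mult_less_top)

lemma integrable_M: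
  assumes "f \<in> borel_measurable borel" "u \<in> L2_dom f"
  shows "integrable (M u) f"
proof (rule Bochner_Integration.integrable_bound)
  show "integrable (M u) (\<lambda>x. 1 + (f x)\<^sup>2)"
    using assms L2_dom_const[of u 1] by (intro Bochner_Integration.integrable_add) (simp_all add: L2_dom_def)
  have "\<bar>a\<bar> \<le> 1 + a\<^sup>2" for a :: real
    using zero_le_power2[of "\<bar>a\<bar> - 1"] by (auto simp: power2_eq_square algebra_simps)
  then show "AE x in M u. norm (f x) \<le> norm (1 + (f x)\<^sup>2)" by (intro AE_I2) simp
qed (use assms in simp)

lemma AE_E: assumes [measurable]: "B \<in> sets borel" shows "AE x in M (E B u). x \<in> B"
proof (rule AE_I)
  show "emeasure (M (E B u)) (- B) = 0"
    using E_orthogonal[of "- B" B u] by (simp add: emeasure_M borel_comp)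
qed (auto simp: borel_comp)

lemma E_in_L2_dom:
  assumes "B \<in> sets borel" "f \<in> borel_measurable borel" "\<And>x. x \<in> B \<Longrightarrow> \<bar>f x\<bar> \<le> c"
  shows "E B u \<in> L2_dom f"
  by (rule L2_dom_bounded[OF assms(2), where c = c]) (use AE_E[OF assms(1), of u] assms(3) in auto)

text \<open>
  Density of the domain, in the form in which it is used: the cut-offs \<open>E {\<bar>f\<bar> \<le> n} w\<close> lie in the
  domain, and orthogonality of \<open>w\<close> to them says that its spectral measure vanishes on each \<open>{\<bar>f\<bar> \<le> n}\<close>.
\<close>

lemma zero_if_orthogonal_L2_dom:
  assumes f[measurable]: "f \<in> borel_measurable borel" and ortho: "\<And>v. v \<in> L2_dom f \<Longrightarrow> inner v w = 0"
  shows "w = 0"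
proof -
  let ?B = "\<lambda>n::nat. {x. \<bar>f x\<bar> \<le> real n}"
  have B[measurable]: "?B n \<in> sets borel" for n by measurable
  have "E (?B n) w \<in> L2_dom f" for n
    by (rule E_in_L2_dom[OF B f]) auto
  then have "inner (E (?B n) w) w = 0" for n by (rule ortho)
  then have 0: "measure (M w) (?B n) = 0" for n
    by (metis B inner_E inner_commute measure_M)
  have "(\<lambda>n. measure (M w) (?B n)) \<longlonglongrightarrow> measure (M w) (\<Union>n. ?B n)"
    by (rule finite_measure.finite_Lim_measure_incseq[OF finite_M]) (auto simp: incseq_def)
  moreover have "(\<Union>n. ?B n) = UNIV"
    using real_arch_simple by auto
  ultimately have "measure (M w) UNIV = 0"
    by (simp add: 0 LIMSEQ_const_iff)
  then show ?thesis by (simp add: measure_M E_UNIV)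
qed

text \<open>
  Removes the definite description in \<open>Phi\<close>: a vector with the right inner products is the value.
\<close>

lemma Phi_eqI:
  assumes "f \<in> borel_measurable borel" "\<And>v. v \<in> L2_dom f \<Longrightarrow> inner v w = polar f v u"
  shows "Phi f u = w"
  unfolding Phi_def
proof (rule the_equality)
  fix w' assume w': "\<forall>v\<in>L2_dom f. inner v w' = polar f v u"
  have "w' - w = 0"
    by (rule zero_if_orthogonal_L2_dom[OF assms(1)]) (use w' assms(2) in \<open>simp add: inner_diff_right\<close>)
  then show "w' = w" by simp
qed (use assms(2) in blast)

definition simple_integral :: "(real \<Rightarrow> real) \<Rightarrow> 'a \<Rightarrow> 'a" where
  "simple_integral s u = (\<Sum>y\<in>range s. y *\<^sub>R E (s -` {y}) u)"

lemma simple_sets: "simple_function borel s \<Longrightarrow> s -` {y} \<in> sets borel"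
  using simple_functionD(2)[of borel s "{y}"] by simp

lemma simple_finite: "simple_function borel s \<Longrightarrow> finite (range s)"
  using simple_functionD(1)[of borel s] by simp

lemma simple_sum:
  fixes h :: "real \<Rightarrow> real"
  assumes "simple_function (borel :: real measure) s"
  shows "h (s x) = (\<Sum>y\<in>range s. h y * indicator (s -` {y}) x)"
proof -
  have "(\<Sum>y\<in>range s. h y * indicator (s -` {y}) x) = (\<Sum>y\<in>range s. if y = s x then h y else 0)"
    by (intro sum.cong) (auto simp: indicator_def)
  then show ?thesis using simple_finite[OF assms] by simp
qed

lemma integral_simple:
  fixes h :: "real \<Rightarrow> real"
  assumes s: "simple_function borel s"
  shows "integrable (M w) (\<lambda>x. h (s x))"
    and "(\<integral>x. h (s x) \<partial>M w) = (\<Sum>y\<in>range s. h y * measure (M w) (s -` {y}))"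
proof -
  have int: "integrable (M w) (\<lambda>x. h y * indicator (s -` {y}) x)" for y
    using simple_sets[OF s, of y] by (simp add: emeasure_M less_top[symmetric])
  show "integrable (M w) (\<lambda>x. h (s x))"
    unfolding simple_sum[OF s, of h] using int by (rule Bochner_Integration.integrable_sum)
  show "(\<integral>x. h (s x) \<partial>M w) = (\<Sum>y\<in>range s. h y * measure (M w) (s -` {y}))"
    unfolding simple_sum[OF s, of h] using int
    by (subst Bochner_Integration.integral_sum) (auto intro!: sum.cong)
qed

lemma L2_dom_simple: "simple_function borel s \<Longrightarrow> u \<in> L2_dom s"
  unfolding L2_dom_def using integral_simple(1)[of s u "\<lambda>y. y\<^sup>2"] by simp

lemma polar_measure:
  assumes "B \<in> sets borel"
  shows "(measure (M (v + u)) B - measure (M (v - u)) B) / 4 = inner v (E B u)"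
proof -
  have "measure (M w) B = inner w (E B w)" for w using assms by (simp add: measure_M inner_E)
  then show ?thesis using sym_E[OF assms, of u v] assms
    by (simp add: E_add E_diff inner_add_left inner_add_right
      inner_diff_left inner_diff_right inner_commute)
qed

lemma simple_integral_inner:
  assumes s: "simple_function borel s"
  shows "inner v (simple_integral s u) = polar s v u"
proof -
  have "polar s v u = (\<Sum>y\<in>range s. y * ((measure (M (v + u)) (s -` {y}) - measure (M (v - u)) (s -` {y})) / 4))"
    unfolding polar_def using integral_simple(2)[OF s, where h="\<lambda>y. y"]
    by (simp add: sum_subtractf sum_divide_distrib right_diff_distrib diff_divide_distrib)
  then show ?thesis
    using simple_sets[OF s] by (simp add: simple_integral_def inner_sum_right polar_measure)
qed

lemma simple_integral_norm:
  assumes s: "simple_function borel s"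
  shows "(norm (simple_integral s u))\<^sup>2 = (\<integral>x. (s x)\<^sup>2 \<partial>M u)"
proof -
  note ss = simple_sets[OF s]
  have o: "inner (E (s -` {y}) u) (E (s -` {z}) u) = (if z = y then measure (M u) (s -` {y}) else 0)" for y z
  proof (cases "y = z")
    case True
    then show ?thesis using ss by (simp add: measure_M power2_norm_eq_inner)
  next
    case False
    then have "E (s -` {y}) (E (s -` {z}) u) = 0" by (intro E_orthogonal ss) auto
    then show ?thesis using False ss by (simp add: sym_E)
  qed
  have "(norm (simple_integral s u))\<^sup>2 = (\<Sum>y\<in>range s. \<Sum>z\<in>range s. y * z * inner (E (s -` {y}) u) (E (s -` {z}) u))"
    unfolding power2_norm_eq_inner simple_integral_def
    by (simp add: inner_sum_left inner_sum_right sum_distrib_left mult_ac inner_commute)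
  also have "\<dots> = (\<Sum>y\<in>range s. \<Sum>z\<in>range s. if z = y then y\<^sup>2 * measure (M u) (s -` {y}) else 0)"
    unfolding o by (intro sum.cong) (auto simp: power2_eq_square)
  also have "\<dots> = (\<Sum>y\<in>range s. y\<^sup>2 * measure (M u) (s -` {y}))"
    using simple_finite[OF s] by simp
  finally show ?thesis using integral_simple(2)[OF s, where h="\<lambda>y. y\<^sup>2"] by simp
qed

lemma simple_integral_diff:
  assumes s: "simple_function borel s" and t: "simple_function borel t"
  shows "simple_integral (\<lambda>x. s x - t x) u = simple_integral s u - simple_integral t u"
proof -
  have st: "simple_function borel (\<lambda>x. s x - t x)" using s t by auto
  have "inner v (simple_integral (\<lambda>x. s x - t x) u) = inner v (simple_integral s u - simple_integral t u)" for v
    unfolding inner_diff_right simple_integral_inner[OF s] simple_integral_inner[OF t] simple_integral_inner[OF st] polar_def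
    using integral_simple(1)[OF s, where h="\<lambda>y. y"] integral_simple(1)[OF t, where h="\<lambda>y. y"]
    by (simp add: diff_divide_distrib)
  then show ?thesis using vector_eq_ldot by blast
qed

lemma simple_approximation:
  fixes f :: "real \<Rightarrow> real"
  assumes "f \<in> borel_measurable borel"
  obtains s where "\<And>n::nat. simple_function borel (s n)" "\<And>x. (\<lambda>n. s n x) \<longlonglongrightarrow> f x"
    "\<And>n x. \<bar>s n x\<bar> \<le> 2 * \<bar>f x\<bar>"
  using borel_measurable_implies_sequence_metric[OF assms, of 0] by auto

lemma L2_convergence:
  assumes f: "f \<in> borel_measurable borel" and u: "u \<in> L2_dom f"
    and s: "\<And>n::nat. simple_function borel (s n)" "\<And>x. (\<lambda>n. s n x) \<longlonglongrightarrow> f x"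
      "\<And>n x. \<bar>s n x\<bar> \<le> 2 * \<bar>f x\<bar>"
  shows "(\<lambda>n. \<integral>x. (s n x - f x)\<^sup>2 \<partial>M u) \<longlonglongrightarrow> 0"
proof -
  have "(\<lambda>n. \<integral>x. (s n x - f x)\<^sup>2 \<partial>M u) \<longlonglongrightarrow> (\<integral>x. 0 \<partial>M u)"
  proof (rule integral_dominated_convergence[where w="\<lambda>x. 9 * (f x)\<^sup>2"])
    show "(\<lambda>x. (s n x - f x)\<^sup>2) \<in> borel_measurable (M u)" for n
      using f borel_measurable_simple_function[OF s(1)] by simp
    show "integrable (M u) (\<lambda>x. 9 * (f x)\<^sup>2)" using u by (simp add: L2_dom_def)
    have "(\<lambda>n. (s n x - f x)\<^sup>2) \<longlonglongrightarrow> (f x - f x)\<^sup>2" for x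
      by (intro tendsto_intros s)
    then show "AE x in M u. (\<lambda>n. (s n x - f x)\<^sup>2) \<longlonglongrightarrow> 0" by simp
    have "\<bar>s n x - f x\<bar>\<^sup>2 \<le> (3 * \<bar>f x\<bar>)\<^sup>2" for n x
      using s(3)[of n x] by (intro power_mono) auto
    then show "AE x in M u. norm ((s n x - f x)\<^sup>2) \<le> 9 * (f x)\<^sup>2" for n
      by (simp add: power_mult_distrib)
  qed simp
  then show ?thesis by simp
qed

text \<open>
  For simple functions the map \<open>s \<mapsto> simple_integral s u\<close> is isometric from \<open>L\<^sup>2\<close> of the spectral
  measure of \<open>u\<close>. Simple approximations of \<open>f\<close> are Cauchy there, so their integrals converge.
\<close>

lemma Phi_ex:
  assumes f[measurable]: "f \<in> borel_measurable borel" and u: "u \<in> L2_dom f"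
  obtains w where "\<And>v. v \<in> L2_dom f \<Longrightarrow> inner v w = polar f v u" "(norm w)\<^sup>2 = (\<integral>x. (f x)\<^sup>2 \<partial>M u)"
proof -
  obtain s where s: "\<And>n::nat. simple_function borel (s n)" "\<And>x. (\<lambda>n. s n x) \<longlonglongrightarrow> f x"
    "\<And>n x. \<bar>s n x\<bar> \<le> 2 * \<bar>f x\<bar>"
    using simple_approximation[OF f] by blast
  have sb: "s n \<in> borel_measurable borel" for n using borel_measurable_simple_function[OF s(1)] .
  note L2 = L2_convergence[OF f u s]
  let ?I = "\<lambda>n. \<integral>x. (s n x - f x)\<^sup>2 \<partial>M u"
  have du: "u \<in> L2_dom (\<lambda>x. s n x - f x)" for n by (intro L2_dom_diff_fun L2_dom_simple s u sb f)
  have diff: "(norm (simple_integral (s n) u - simple_integral (s m) u))\<^sup>2 \<le> 2 * ?I n + 2 * ?I m" for n m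
  proof -
    have st: "simple_function borel (\<lambda>x. s n x - s m x)" using s by auto
    have "(norm (simple_integral (s n) u - simple_integral (s m) u))\<^sup>2 = (\<integral>x. (s n x - s m x)\<^sup>2 \<partial>M u)"
      using simple_integral_norm[OF st, of u] simple_integral_diff[OF s(1) s(1)] by simp
    also have "\<dots> \<le> (\<integral>x. 2 * (s n x - f x)\<^sup>2 + 2 * (s m x - f x)\<^sup>2 \<partial>M u)"
    proof (rule integral_mono)
      show "integrable (M u) (\<lambda>x. (s n x - s m x)\<^sup>2)" using L2_dom_simple[OF st] by (simp add: L2_dom_def)
      show "integrable (M u) (\<lambda>x. 2 * (s n x - f x)\<^sup>2 + 2 * (s m x - f x)\<^sup>2)"
        using du by (simp add: L2_dom_def)
      fix x
      show "(s n x - s m x)\<^sup>2 \<le> 2 * (s n x - f x)\<^sup>2 + 2 * (s m x - f x)\<^sup>2"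
        using zero_le_power2[of "(s n x - f x) + (s m x - f x)"] by (simp add: power2_eq_square algebra_simps)
    qed
    also have "\<dots> = 2 * ?I n + 2 * ?I m" using du by (simp add: L2_dom_def)
    finally show ?thesis .
  qed
  have "Cauchy (\<lambda>n. simple_integral (s n) u)"
    by (rule Cauchy_if_dist_square_le[OF diff L2])
  then obtain w where w: "(\<lambda>n. simple_integral (s n) u) \<longlonglongrightarrow> w"
    using Cauchy_convergent_iff convergent_def by blast
  have lim1: "(\<lambda>n. \<integral>x. s n x \<partial>M v) \<longlonglongrightarrow> (\<integral>x. f x \<partial>M v)" if "v \<in> L2_dom f" for v
    by (rule integral_dominated_convergence[where w="\<lambda>x. 2 * \<bar>f x\<bar>"])
      (use s sb integrable_M[OF f that] in \<open>auto simp: integrable_abs\<close>)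
  have "(\<lambda>n. inner v (simple_integral (s n) u)) \<longlonglongrightarrow> polar f v u" if v: "v \<in> L2_dom f" for v
    unfolding simple_integral_inner[OF s(1)] polar_def by (intro tendsto_intros lim1 L2_dom_add f v u) simp
  moreover have "(\<lambda>n. inner v (simple_integral (s n) u)) \<longlonglongrightarrow> inner v w" for v
    by (intro tendsto_intros w)
  ultimately have 1: "inner v w = polar f v u" if "v \<in> L2_dom f" for v
    using LIMSEQ_unique that by blast
  have "(\<lambda>n. \<integral>x. (s n x)\<^sup>2 \<partial>M u) \<longlonglongrightarrow> (\<integral>x. (f x)\<^sup>2 \<partial>M u)"
  proof (rule integral_dominated_convergence[where w="\<lambda>x. 4 * (f x)\<^sup>2"])
    show "AE x in M u. (\<lambda>n. (s n x)\<^sup>2) \<longlonglongrightarrow> (f x)\<^sup>2" by (intro AE_I2 tendsto_intros s)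
    have "\<bar>s n x\<bar>\<^sup>2 \<le> (2 * \<bar>f x\<bar>)\<^sup>2" for n x
      using s(3)[of n x] by (intro power_mono) auto
    then show "AE x in M u. norm ((s n x)\<^sup>2) \<le> 4 * (f x)\<^sup>2" for n
      by (simp add: power_mult_distrib)
  qed (use sb u in \<open>auto simp: L2_dom_def\<close>)
  moreover have "(\<lambda>n. (norm (simple_integral (s n) u))\<^sup>2) \<longlonglongrightarrow> (norm w)\<^sup>2"
    by (intro tendsto_intros w)
  ultimately have "(norm w)\<^sup>2 = (\<integral>x. (f x)\<^sup>2 \<partial>M u)"
    unfolding simple_integral_norm[OF s(1)] using LIMSEQ_unique by blast
  with 1 that show ?thesis by blast
qed

lemma Phi_inner: "f \<in> borel_measurable borel \<Longrightarrow> u \<in> L2_dom f \<Longrightarrow> v \<in> L2_dom f \<Longrightarrow> inner v (Phi f u) = polar f v u"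
  and Phi_norm: "f \<in> borel_measurable borel \<Longrightarrow> u \<in> L2_dom f \<Longrightarrow> (norm (Phi f u))\<^sup>2 = (\<integral>x. (f x)\<^sup>2 \<partial>M u)"
  using Phi_ex[of f u thesis] Phi_eqI[of f _ u] by (metis Phi_eqI Phi_ex)+

lemma Phi_simple:
  assumes s: "simple_function borel s"
  shows "Phi s u = (\<Sum>y\<in>range s. y *\<^sub>R E (s -` {y}) u)"
  by (rule Phi_eqI[OF borel_measurable_simple_function[OF s]]) (simp add: simple_integral_inner[OF s] flip: simple_integral_def)

lemma L2_dom_add_abs:
  assumes [measurable]: "f \<in> borel_measurable borel" "g \<in> borel_measurable borel"
    and v: "v \<in> L2_dom (\<lambda>x. \<bar>f x\<bar> + \<bar>g x\<bar>)"
  shows "v \<in> L2_dom f" "v \<in> L2_dom g"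
  by (rule L2_dom_mono[OF v _ AE_I2, where c = 1]; simp)+

lemma Phi_add_fun:
  assumes fg[measurable]: "f \<in> borel_measurable borel" "g \<in> borel_measurable borel"
    and u: "u \<in> L2_dom f" "u \<in> L2_dom g"
  shows "Phi (\<lambda>x. f x + g x) u = Phi f u + Phi g u"
proof -
  have "Phi (\<lambda>x. f x + g x) u - (Phi f u + Phi g u) = 0"
  proof (rule zero_if_orthogonal_L2_dom[where f = "\<lambda>x. \<bar>f x\<bar> + \<bar>g x\<bar>"])
    fix v assume "v \<in> L2_dom (\<lambda>x. \<bar>f x\<bar> + \<bar>g x\<bar>)"
    from L2_dom_add_abs[OF fg this] have v: "v \<in> L2_dom f" "v \<in> L2_dom g" .
    have vfg: "v \<in> L2_dom (\<lambda>x. f x + g x)" "u \<in> L2_dom (\<lambda>x. f x + g x)"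
      using L2_dom_add_fun fg u v by blast+
    have i: "integrable (M (v + u)) h \<and> integrable (M (v - u)) h" if "h = f \<or> h = g" for h
      using that fg u v by (auto intro!: integrable_M L2_dom_add)
    have "polar (\<lambda>x. f x + g x) v u = polar f v u + polar g v u"
      unfolding polar_def using i by (simp add: add_divide_distrib diff_divide_distrib)
    then show "inner v (Phi (\<lambda>x. f x + g x) u - (Phi f u + Phi g u)) = 0"
      using u v vfg by (simp add: inner_diff_right inner_add_right Phi_inner)
  qed measurable
  then show ?thesis by simp
qed

lemma Phi_cmult_fun:
  assumes f[measurable]: "f \<in> borel_measurable borel" and u: "u \<in> L2_dom f"
  shows "Phi (\<lambda>x. c * f x) u = c *\<^sub>R Phi f u"
proof -
  have "Phi (\<lambda>x. c * f x) u - c *\<^sub>R Phi f u = 0"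
  proof (rule zero_if_orthogonal_L2_dom[OF f])
    fix v assume v: "v \<in> L2_dom f"
    have "polar (\<lambda>x. c * f x) v u = c * polar f v u"
      unfolding polar_def by (simp add: algebra_simps)
    then show "inner v (Phi (\<lambda>x. c * f x) u - c *\<^sub>R Phi f u) = 0"
      using u v by (simp add: inner_diff_right Phi_inner L2_dom_cmult)
  qed
  then show ?thesis by simp
qed

lemma Phi_diff_fun:
  assumes fg: "f \<in> borel_measurable borel" "g \<in> borel_measurable borel"
    and u: "u \<in> L2_dom f" "u \<in> L2_dom g"
  shows "Phi (\<lambda>x. f x - g x) u = Phi f u - Phi g u"
  using Phi_add_fun[of f "\<lambda>x. -1 * g x" u] Phi_cmult_fun[of g u "-1"] L2_dom_cmult[OF u(2), of "-1"] assms
  by simp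

lemma Phi_sum_fun:
  assumes "finite I" "\<And>i. i \<in> I \<Longrightarrow> f i \<in> borel_measurable borel" "\<And>i. i \<in> I \<Longrightarrow> u \<in> L2_dom (f i)"
  shows "Phi (\<lambda>x. \<Sum>i\<in>I. f i x) u = (\<Sum>i\<in>I. Phi (f i) u) \<and> u \<in> L2_dom (\<lambda>x. \<Sum>i\<in>I. f i x)"
  using assms
proof (induction I)
  case empty
  have "Phi (\<lambda>x. 0) u = 0" using Phi_cmult_fun[of "\<lambda>x. 0" u 0] L2_dom_const[of u 0] by simp
  then show ?case using L2_dom_const[of u 0] by simp
next
  case (insert i I)
  have m: "(\<lambda>x. \<Sum>i\<in>I. f i x) \<in> borel_measurable borel"
    using insert.prems by (intro borel_measurable_sum) auto
  show ?case
    using insert Phi_add_fun[of "f i" "\<lambda>x. \<Sum>i\<in>I. f i x" u] L2_dom_add_fun[of u "f i" "\<lambda>x. \<Sum>i\<in>I. f i x"] m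
    by simp
qed

lemma Phi_cong_AE:
  assumes fg: "f \<in> borel_measurable borel" "g \<in> borel_measurable borel"
    and u: "u \<in> L2_dom f" and eq: "AE x in M u. f x = g x"
  shows "Phi g u = Phi f u" "u \<in> L2_dom g"
proof -
  show ug: "u \<in> L2_dom g" by (rule L2_dom_mono[OF u fg(2), where c = 1]) (use eq in eventually_elim, simp)
  have "(norm (Phi (\<lambda>x. g x - f x) u))\<^sup>2 = (\<integral>x. (g x - f x)\<^sup>2 \<partial>M u)"
    using fg u ug by (intro Phi_norm L2_dom_diff_fun) auto
  also have "\<dots> = (\<integral>x. 0 \<partial>M u)"
    by (rule integral_cong_AE) (use fg eq in auto)
  finally show "Phi g u = Phi f u"
    using Phi_diff_fun[OF fg(2,1) ug u] by simp
qed

lemma Phi_symmetric: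
  assumes "f \<in> borel_measurable borel" "u \<in> L2_dom f" "v \<in> L2_dom f"
  shows "inner (Phi f v) u = inner v (Phi f u)"
  using assms Phi_inner[of f v u] Phi_inner[of f u v]
  by (simp add: inner_commute[of "Phi f v"] polar_def M_diff_commute[of u v] add.commute)

lemma Phi_add:
  assumes f: "f \<in> borel_measurable borel" and uv: "u \<in> L2_dom f" "v \<in> L2_dom f"
  shows "Phi f (u + v) = Phi f u + Phi f v"
proof -
  have "Phi f (u + v) - (Phi f u + Phi f v) = 0"
    by (rule zero_if_orthogonal_L2_dom[OF f])
      (use assms L2_dom_add[OF f uv] in \<open>simp add: inner_diff_right inner_add_right flip: Phi_symmetric\<close>)
  then show ?thesis by simp
qed

lemma Phi_scale:
  assumes f: "f \<in> borel_measurable borel" and u: "u \<in> L2_dom f"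
  shows "Phi f (c *\<^sub>R u) = c *\<^sub>R Phi f u"
proof -
  have "Phi f (c *\<^sub>R u) - c *\<^sub>R Phi f u = 0"
    by (rule zero_if_orthogonal_L2_dom[OF f])
      (use assms L2_dom_scale[OF f u] in \<open>simp add: inner_diff_right flip: Phi_symmetric\<close>)
  then show ?thesis by simp
qed

lemma inner_Phi_self:
  assumes f: "f \<in> borel_measurable borel" and u: "u \<in> L2_dom f"
  shows "inner u (Phi f u) = (\<integral>x. f x \<partial>M u)"
proof -
  have m4: "M (u + u) = density (M u) (\<lambda>x. ennreal 4)"
  proof (rule measure_eqI)
    fix A assume "A \<in> sets (M (u + u))"
    then have "emeasure (M (u + u)) A = ennreal (4 * (norm (E A u))\<^sup>2)"
      by (simp add: emeasure_M E_scale power_mult_distrib flip: scaleR_2)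
    also have "\<dots> = 4 * ennreal ((norm (E A u))\<^sup>2)" by (subst ennreal_mult) auto
    finally show "emeasure (M (u + u)) A = emeasure (density (M u) (\<lambda>x. ennreal 4)) A"
      using \<open>A \<in> sets (M (u + u))\<close> by (simp add: emeasure_M emeasure_density_const)
  qed simp
  have "M (u - u) = null_measure borel"
    by (rule measure_eqI) (auto simp: M_zero)
  then have "(\<integral>x. f x \<partial>M (u - u)) = 0" by simp
  moreover have "(\<integral>x. f x \<partial>M (u + u)) = 4 * (\<integral>x. f x \<partial>M u)"
    unfolding m4 by (subst integral_density) (use f in auto)
  ultimately show ?thesis using Phi_inner[OF f u u] by (simp add: polar_def)
qed

lemma Phi_dist:
  assumes fg: "f \<in> borel_measurable borel" "g \<in> borel_measurable borel"
    and u: "u \<in> L2_dom f" "u \<in> L2_dom g"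
  shows "(norm (Phi f u - Phi g u))\<^sup>2 = (\<integral>x. (f x - g x)\<^sup>2 \<partial>M u)"
  using Phi_norm[of "\<lambda>x. f x - g x" u] Phi_diff_fun[OF assms] L2_dom_diff_fun[OF u fg] fg by simp

lemma Phi_indicator:
  assumes B: "B \<in> sets borel"
  shows "Phi (indicator B) u = E B u"
proof (rule Phi_eqI)
  fix v
  show "inner v (E B u) = polar (indicator B) v u"
    unfolding polar_def using B by (simp add: polar_measure)
qed (use B in simp)

lemma Phi_const: "Phi (\<lambda>x. c) u = c *\<^sub>R u"
  using Phi_cmult_fun[of "indicator UNIV" u c] Phi_indicator[of UNIV u] E_UNIV[of u] L2_dom_const[of u 1]
  by (simp add: indicator_def[abs_def])

lemma L2_dom_indicator_mult:
  assumes B: "B \<in> sets borel" and f: "f \<in> borel_measurable borel" and u: "u \<in> L2_dom f"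
  shows "u \<in> L2_dom (\<lambda>x. indicator B x * f x)"
  by (rule L2_dom_mono[OF u _ AE_I2, where c = 1]) (use B f in \<open>auto simp: indicator_def\<close>)

lemma E_Phi_simple:
  assumes B: "B \<in> sets borel" and s: "simple_function borel s"
  shows "E B (Phi s u) = Phi (\<lambda>x. indicator B x * s x) u"
proof -
  note ss = simple_sets[OF s]
  have Bs: "B \<inter> s -` {y} \<in> sets borel" for y using B ss by auto
  have eq: "(\<lambda>x. indicator B x * s x) = (\<lambda>x. \<Sum>y\<in>range s. y * indicator (B \<inter> s -` {y}) x)"
  proof
    fix x
    have "indicator B x * s x = (\<Sum>y\<in>range s. indicator B x * (y * indicator (s -` {y}) x))"
      unfolding simple_sum[OF s, of "\<lambda>y. y" x] by (rule sum_distrib_left)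
    also have "\<dots> = (\<Sum>y\<in>range s. y * indicator (B \<inter> s -` {y}) x)"
      by (intro sum.cong) (auto simp: indicator_def)
    finally show "indicator B x * s x = (\<Sum>y\<in>range s. y * indicator (B \<inter> s -` {y}) x)" .
  qed
  have d: "u \<in> L2_dom (indicator (B \<inter> s -` {y}))" for y
    by (rule L2_dom_bounded[where c = 1]) (use Bs in auto)
  have "Phi (\<lambda>x. indicator B x * s x) u = (\<Sum>y\<in>range s. Phi (\<lambda>x. y * indicator (B \<inter> s -` {y}) x) u)"
    unfolding eq using Phi_sum_fun[of "range s" "\<lambda>y x. y * indicator (B \<inter> s -` {y}) x" u]
      simple_finite[OF s] Bs d L2_dom_cmult by simp
  also have "\<dots> = (\<Sum>y\<in>range s. y *\<^sub>R E (B \<inter> s -` {y}) u)"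
    using Phi_cmult_fun[OF _ d] Bs by (simp add: Phi_indicator)
  also have "\<dots> = E B (Phi s u)"
    using B ss by (simp add: Phi_simple[OF s] E_sum E_scale E_Int)
  finally show ?thesis ..
qed

lemma tendsto_if_dist_square:
  fixes X :: "nat \<Rightarrow> 'a"
  assumes "(\<lambda>n. (norm (X n - L))\<^sup>2) \<longlonglongrightarrow> 0"
  shows "X \<longlonglongrightarrow> L"
proof -
  have "(\<lambda>n. sqrt ((norm (X n - L))\<^sup>2)) \<longlonglongrightarrow> sqrt 0"
    by (intro tendsto_intros assms)
  then have "(\<lambda>n. norm (X n - L)) \<longlonglongrightarrow> 0" by simp
  then show ?thesis by (simp add: tendsto_norm_zero_iff LIM_zero_iff)
qed

text \<open>
  By the isometry it suffices to treat simple functions, where it is \<open>E_Int\<close>.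
\<close>

lemma E_Phi:
  assumes B[measurable]: "B \<in> sets borel" and f[measurable]: "f \<in> borel_measurable borel" and u: "u \<in> L2_dom f"
  shows "E B (Phi f u) = Phi (\<lambda>x. indicator B x * f x) u"
proof -
  obtain s where s: "\<And>n::nat. simple_function borel (s n)" "\<And>x. (\<lambda>n. s n x) \<longlonglongrightarrow> f x"
    "\<And>n x. \<bar>s n x\<bar> \<le> 2 * \<bar>f x\<bar>"
    using simple_approximation[OF f] by blast
  have sb[measurable]: "s n \<in> borel_measurable borel" for n using borel_measurable_simple_function[OF s(1)] .
  note L2 = L2_convergence[OF f u s]
  have 1: "(\<lambda>n. Phi (s n) u) \<longlonglongrightarrow> Phi f u"
    by (rule tendsto_if_dist_square) (use L2 in \<open>simp add: Phi_dist sb f u L2_dom_simple s\<close>)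
  have dB: "u \<in> L2_dom (\<lambda>x. indicator B x * s n x)" for n
    by (intro L2_dom_indicator_mult B sb L2_dom_simple s)
  have dBf: "u \<in> L2_dom (\<lambda>x. indicator B x * f x)"
    by (intro L2_dom_indicator_mult B f u)
  have "(\<lambda>n. \<integral>x. (indicator B x * s n x - indicator B x * f x)\<^sup>2 \<partial>M u) \<longlonglongrightarrow> 0"
  proof (rule tendsto_sandwich[OF _ _ tendsto_const L2])
    show "\<forall>\<^sub>F n in sequentially. (\<integral>x. (indicator B x * s n x - indicator B x * f x)\<^sup>2 \<partial>M u)
        \<le> (\<integral>x. (s n x - f x)\<^sup>2 \<partial>M u)"
    proof (intro always_eventually allI integral_mono)
      show "integrable (M u) (\<lambda>x. (indicator B x * s n x - indicator B x * f x)\<^sup>2)" for n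
        using L2_dom_diff_fun[OF dB dBf] by (simp add: L2_dom_def)
      show "integrable (M u) (\<lambda>x. (s n x - f x)\<^sup>2)" for n
        using L2_dom_diff_fun[OF L2_dom_simple[OF s(1)] u sb f] by (simp add: L2_dom_def)
    qed (auto simp: indicator_def)
  qed simp
  then have "(\<lambda>n. Phi (\<lambda>x. indicator B x * s n x) u) \<longlonglongrightarrow> Phi (\<lambda>x. indicator B x * f x) u"
    by (intro tendsto_if_dist_square) (simp add: Phi_dist dB dBf)
  moreover have "(\<lambda>n. E B (Phi (s n) u)) \<longlonglongrightarrow> E B (Phi f u)"
    by (intro bounded_linear.tendsto[OF linear_E] B 1)
  ultimately show ?thesis
    unfolding E_Phi_simple[OF B s(1)] using LIMSEQ_unique by blast
qed

text \<open>
  The spectral measure of \<open>Phi f u\<close>. All domain questions for products of spectral integrals reduce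
  to this density.
\<close>

lemma M_Phi:
  assumes f[measurable]: "f \<in> borel_measurable borel" and u: "u \<in> L2_dom f"
  shows "M (Phi f u) = density (M u) (\<lambda>x. ennreal ((f x)\<^sup>2))"
proof (rule measure_eqI)
  fix A assume "A \<in> sets (M (Phi f u))"
  then have A[measurable]: "A \<in> sets borel" by simp
  have d: "u \<in> L2_dom (\<lambda>x. indicator A x * f x)" by (intro L2_dom_indicator_mult A f u)
  have "emeasure (M (Phi f u)) A = ennreal (\<integral>x. (indicator A x * f x)\<^sup>2 \<partial>M u)"
    using E_Phi[OF A f u] Phi_norm[OF _ d] by (simp add: emeasure_M)
  also have "\<dots> = (\<integral>\<^sup>+x. ennreal ((indicator A x * f x)\<^sup>2) \<partial>M u)"
    by (rule nn_integral_eq_integral[symmetric]) (use d in \<open>simp_all add: L2_dom_def\<close>)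
  also have "\<dots> = (\<integral>\<^sup>+x. ennreal ((f x)\<^sup>2) * indicator A x \<partial>M u)"
    by (intro nn_integral_cong) (auto simp: indicator_def)
  also have "\<dots> = emeasure (density (M u) (\<lambda>x. ennreal ((f x)\<^sup>2))) A"
    by (simp add: emeasure_density)
  finally show "emeasure (M (Phi f u)) A = emeasure (density (M u) (\<lambda>x. ennreal ((f x)\<^sup>2))) A" .
qed simp

lemma L2_dom_Phi_iff:
  assumes f[measurable]: "f \<in> borel_measurable borel" and u: "u \<in> L2_dom f" and g[measurable]: "g \<in> borel_measurable borel"
  shows "Phi f u \<in> L2_dom g \<longleftrightarrow> u \<in> L2_dom (\<lambda>x. g x * f x)"
  unfolding L2_dom_def mem_Collect_eq M_Phi[OF f u]
  by (simp add: integrable_density power_mult_distrib mult.commute)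

lemma integral_M_Phi:
  assumes f[measurable]: "f \<in> borel_measurable borel" and u: "u \<in> L2_dom f" and g[measurable]: "g \<in> borel_measurable borel"
  shows "(\<integral>x. g x \<partial>M (Phi f u)) = (\<integral>x. (f x)\<^sup>2 * g x \<partial>M u)"
  unfolding M_Phi[OF f u] by (simp add: integral_density)

text \<open>
  Multiplicativity of the functional calculus, including the unbounded case. Both sides are limits along
  the same simple approximations of \<open>g\<close>: by \<open>M_Phi\<close> the two \<open>L\<^sup>2\<close> errors are equal.
\<close>

lemma Phi_Phi:
  assumes f[measurable]: "f \<in> borel_measurable borel" and u: "u \<in> L2_dom f" and g[measurable]: "g \<in> borel_measurable borel"
    and w: "Phi f u \<in> L2_dom g"
  shows "Phi g (Phi f u) = Phi (\<lambda>x. g x * f x) u"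
proof -
  let ?w = "Phi f u"
  obtain s where s: "\<And>n::nat. simple_function borel (s n)" "\<And>x. (\<lambda>n. s n x) \<longlonglongrightarrow> g x"
    "\<And>n x. \<bar>s n x\<bar> \<le> 2 * \<bar>g x\<bar>"
    using simple_approximation[OF g] by blast
  have sb[measurable]: "s n \<in> borel_measurable borel" for n using borel_measurable_simple_function[OF s(1)] .
  have dsf: "u \<in> L2_dom (\<lambda>x. s n x * f x)" for n
    using L2_dom_Phi_iff[OF f u sb] L2_dom_simple[OF s(1)] by blast
  have dgf: "u \<in> L2_dom (\<lambda>x. g x * f x)"
    using L2_dom_Phi_iff[OF f u g] w by blast
  have simple: "Phi (s n) ?w = Phi (\<lambda>x. s n x * f x) u" for n
  proof -
    note ss = simple_sets[OF s(1)]
    have d: "u \<in> L2_dom (\<lambda>x. y * (indicator (s n -` {y}) x * f x))" for y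
      by (intro L2_dom_cmult L2_dom_indicator_mult ss f u)
    have eq: "(\<lambda>x. s n x * f x) = (\<lambda>x. \<Sum>y\<in>range (s n). y * (indicator (s n -` {y}) x * f x))"
    proof
      fix x
      have "s n x * f x = (\<Sum>y\<in>range (s n). (y * indicator (s n -` {y}) x) * f x)"
        by (subst simple_sum[OF s(1), of "\<lambda>y. y" n x]) (rule sum_distrib_right)
      then show "s n x * f x = (\<Sum>y\<in>range (s n). y * (indicator (s n -` {y}) x * f x))"
        by (simp only: mult.assoc)
    qed
    have "Phi (\<lambda>x. s n x * f x) u = (\<Sum>y\<in>range (s n). Phi (\<lambda>x. y * (indicator (s n -` {y}) x * f x)) u)"
      unfolding eq using Phi_sum_fun[of "range (s n)" "\<lambda>y x. y * (indicator (s n -` {y}) x * f x)" u]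
        simple_finite[OF s(1)] d ss by simp
    also have "\<dots> = (\<Sum>y\<in>range (s n). y *\<^sub>R E (s n -` {y}) ?w)"
      using Phi_cmult_fun[OF _ L2_dom_indicator_mult[OF ss f u]] ss by (simp add: E_Phi u)
    also have "\<dots> = Phi (s n) ?w" by (simp add: Phi_simple[OF s(1)])
    finally show ?thesis ..
  qed
  have lim0: "(\<lambda>n. \<integral>x. (s n x - g x)\<^sup>2 \<partial>M ?w) \<longlonglongrightarrow> 0"
    by (rule L2_convergence[OF g w s])
  then have "(\<lambda>n. Phi (s n) ?w) \<longlonglongrightarrow> Phi g ?w"
    by (intro tendsto_if_dist_square) (simp add: Phi_dist sb g w L2_dom_simple s)
  moreover have "(\<integral>x. (s n x - g x)\<^sup>2 \<partial>M ?w) = (\<integral>x. (s n x * f x - g x * f x)\<^sup>2 \<partial>M u)" for n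
    by (subst integral_M_Phi[OF f u])
      (simp_all add: power_mult_distrib[symmetric] left_diff_distrib mult.commute[of "f _"])
  then have "(\<lambda>n. Phi (\<lambda>x. s n x * f x) u) \<longlonglongrightarrow> Phi (\<lambda>x. g x * f x) u"
    using lim0 by (intro tendsto_if_dist_square) (simp add: Phi_dist dsf dgf)
  ultimately show ?thesis
    unfolding simple using LIMSEQ_unique by blast
qed

end

section \<open>Polynomials of a positive contraction\<close>

text \<open>
  The third assumption is \<open>N\<^sup>2 \<le> N\<close> as forms, hence \<open>0 \<le> N \<le> 1\<close>.
\<close>

locale positive_contraction =
  fixes N :: "'a::{real_inner, banach} \<Rightarrow> 'a"
  assumes linear_N: "bounded_linear N"
    and sym_N: "inner (N u) v = inner u (N v)"
    and norm_N_le_form: "(norm (N w))\<^sup>2 \<le> inner w (N w)"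
begin

lemma norm_N_le: "norm (N w) \<le> norm w"
proof -
  have "norm (N w) * norm (N w) \<le> norm w * norm (N w)"
    using norm_N_le_form[of w] norm_cauchy_schwarz[of w "N w"] by (simp add: power2_eq_square)
  then show ?thesis by (cases "N w = 0") auto
qed

lemma N_add: "N (u + v) = N u + N v" and N_scale: "N (c *\<^sub>R u) = c *\<^sub>R N u" and N_diff: "N (u - v) = N u - N v"
  and N_sum: "N (\<Sum>i\<in>I. g i) = (\<Sum>i\<in>I. N (g i))" and N_zero: "N 0 = 0"
  using linear_N by (simp_all add: linear_simps bounded_linear.linear linear_sum)

definition polyop :: "real poly \<Rightarrow> 'a \<Rightarrow> 'a" where
  "polyop p u = (\<Sum>i\<le>degree p. coeff p i *\<^sub>R (N ^^ i) u)"

lemma polyop_altdef: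
  assumes "degree p \<le> n"
  shows "polyop p u = (\<Sum>i\<le>n. coeff p i *\<^sub>R (N ^^ i) u)"
  unfolding polyop_def
  by (rule sum.mono_neutral_left) (use assms in \<open>auto simp: coeff_eq_0\<close>)

lemma polyop_0 [simp]: "polyop 0 u = 0"
  by (simp add: polyop_def)

lemma polyop_add: "polyop (p + q) u = polyop p u + polyop q u"
proof -
  let ?n = "max (degree p) (degree q)"
  have "degree (p + q) \<le> ?n" by (rule degree_add_le) auto
  then show ?thesis
    by (simp add: polyop_altdef[of _ ?n] scaleR_left_distrib sum.distrib)
qed

lemma polyop_smult: "polyop (smult c p) u = c *\<^sub>R polyop p u"
  by (simp add: polyop_altdef[OF degree_smult_le] polyop_def scaleR_sum_right)

lemma polyop_pCons: "polyop (pCons a p) u = a *\<^sub>R u + N (polyop p u)"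
proof -
  have "polyop (pCons a p) u = (\<Sum>i\<le>Suc (degree p). coeff (pCons a p) i *\<^sub>R (N ^^ i) u)"
    by (rule polyop_altdef) (rule degree_pCons_le)
  also have "\<dots> = a *\<^sub>R u + (\<Sum>i\<le>degree p. coeff p i *\<^sub>R N ((N ^^ i) u))"
    by (subst sum.atMost_Suc_shift) simp
  finally show ?thesis by (simp add: polyop_def N_sum N_scale)
qed

lemma polyop_diff: "polyop (p - q) u = polyop p u - polyop q u"
  using polyop_add[of p "- q" u] polyop_smult[of "-1" q u] by simp

lemma polyop_sum: "polyop (\<Sum>i\<in>I. f i) u = (\<Sum>i\<in>I. polyop (f i) u)"
  by (induction I rule: infinite_finite_induct) (simp_all add: polyop_add)

lemma polyop_linear: "bounded_linear (polyop p)"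
proof (induction p)
  case 0
  have "polyop 0 = (\<lambda>u. 0)" by (simp add: fun_eq_iff)
  then show ?case by simp
next
  case (pCons a p)
  have "polyop (pCons a p) = (\<lambda>u. a *\<^sub>R u + N (polyop p u))" by (simp add: fun_eq_iff polyop_pCons)
  then show ?case
    by (simp only:) (intro bounded_linear_add bounded_linear_scaleR_right
        bounded_linear_compose[OF linear_N] pCons.IH)
qed

lemma polyop_mult: "polyop (p * q) u = polyop p (polyop q u)"
  by (induction p) (simp_all add: polyop_pCons polyop_add polyop_smult)

lemma polyop_1 [simp]: "polyop 1 u = u"
  unfolding one_pCons by (simp add: polyop_pCons N_zero)

lemma polyop_sym: "inner (polyop p u) v = inner u (polyop p v)"
proof (induction p arbitrary: u v)
  case (pCons a p)
  have "polyop p (N v) = N (polyop p v)"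
    using polyop_mult[of p "[:0, 1:]" v] polyop_mult[of "[:0, 1:]" p v]
    by (simp add: polyop_pCons mult.commute N_zero)
  with pCons show ?case by (simp add: polyop_pCons inner_add_left inner_add_right sym_N)
qed simp

lemma norm_polyop: "(norm (polyop p u))\<^sup>2 = inner u (polyop (p * p) u)"
  by (simp add: power2_norm_eq_inner polyop_sym polyop_mult)

abbreviation X :: "real poly" where "X \<equiv> [:0, 1:]"

lemma polyop_X [simp]: "polyop X u = N u"
  by (simp add: polyop_pCons N_zero)

text \<open>
  Even powers split off as a square \<open>q\<^sup>2\<close> and are moved to both sides of the inner product. This leaves
  the exponents \<open>0\<close> and \<open>1\<close>, where the only nontrivial case is \<open>N (1 - N) = N - N\<^sup>2 \<ge> 0\<close>.
\<close>

lemma bernstein_nonneg: "0 \<le> inner w (polyop (X ^ k * (1 - X) ^ l) w)"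
proof -
  have base: "0 \<le> inner v (polyop (X ^ a * (1 - X) ^ b) v)" if "a \<le> 1" "b \<le> 1" for a b v
  proof -
    have "inner v (N v) \<le> (norm v)\<^sup>2"
      using norm_cauchy_schwarz[of v "N v"] norm_N_le[of v] mult_left_mono[OF norm_N_le[of v], of "norm v"]
      by (simp add: power2_eq_square)
    moreover have "inner v (N (N v)) \<le> inner v (N v)"
      using norm_N_le_form[of v] sym_N[of v "N v"] by (simp add: power2_norm_eq_inner)
    moreover have "0 \<le> inner v (N v)"
      using norm_N_le_form[of v] zero_le_power2 order_trans by blast
    moreover have "a = 0 \<or> a = 1" "b = 0 \<or> b = 1" using that by auto
    ultimately show ?thesis
      by (auto simp: polyop_mult polyop_diff N_diff inner_diff_right power2_norm_eq_inner)
  qed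
  define q where "q = X ^ (k div 2) * (1 - X) ^ (l div 2)"
  have "X ^ k * (1 - X) ^ l = q * (X ^ (k mod 2) * (1 - X) ^ (l mod 2) * q)"
  proof -
    have "X ^ k = X ^ (k div 2) * X ^ (k div 2) * X ^ (k mod 2)"
      by (simp flip: power_add mult_2)
    moreover have "(1 - X) ^ l = (1 - X) ^ (l div 2) * (1 - X) ^ (l div 2) * (1 - X) ^ (l mod 2)"
      by (simp flip: power_add mult_2)
    ultimately show ?thesis unfolding q_def by (simp only: mult_ac)
  qed
  then have "inner w (polyop (X ^ k * (1 - X) ^ l) w)
      = inner (polyop q w) (polyop (X ^ (k mod 2) * (1 - X) ^ (l mod 2)) (polyop q w))"
    by (simp only: polyop_mult polyop_sym)
  also have "\<dots> \<ge> 0" by (rule base) auto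
  finally show ?thesis .
qed

definition bern :: "nat \<Rightarrow> nat \<Rightarrow> real poly" where
  "bern n k = smult (real (n choose k)) (X ^ k * (1 - X) ^ (n - k))"

lemma poly_bern: "poly (bern n k) x = Bernstein n k x"
  by (simp add: bern_def Bernstein_def)

lemma bern_sum: "(\<Sum>k\<le>n. bern n k) = 1"
  using binomial_ring[of X "1 - X" n] by (simp add: bern_def of_nat_poly)

text \<open>
  Bernstein polynomials reproduce \<open>x\<^sup>j\<close> exactly when the grid values \<open>(k/n)\<^sup>j\<close> are replaced by ratios of
  binomial coefficients; as a polynomial identity this transfers to operators.
\<close>

lemma bern_moment:
  assumes "j \<le> n"
  shows "(\<Sum>k\<le>n. smult (real (k choose j) / real (n choose j)) (bern n k)) = X ^ j"
proof -
  have "(\<Sum>k\<le>n. smult (real (k choose j) / real (n choose j)) (bern n k))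
      = (\<Sum>k\<in>{j..n}. smult (real (k choose j) / real (n choose j)) (bern n k))"
    by (rule sum.mono_neutral_right) auto
  also have "\<dots> = (\<Sum>k\<in>{j..n}. X ^ j * bern (n - j) (k - j))"
  proof (rule sum.cong)
    fix k assume k: "k \<in> {j..n}"
    have "real (n choose k) * real (k choose j) = real (n choose j) * real ((n - j) choose (k - j))"
      using choose_mult[of j k n] k by (simp flip: of_nat_mult)
    then have c: "real (k choose j) / real (n choose j) * real (n choose k) = real ((n - j) choose (k - j))"
      using assms by (simp add: field_simps)
    have "X ^ k = X ^ j * X ^ (k - j)" using k by (simp flip: power_add)
    then show "smult (real (k choose j) / real (n choose j)) (bern n k) = X ^ j * bern (n - j) (k - j)"
      unfolding bern_def using c k by (simp add: mult_ac)
  qed simp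
  also have "\<dots> = X ^ j * (\<Sum>k\<in>{j..n}. bern (n - j) (k - j))" by (simp add: sum_distrib_left)
  also have "(\<Sum>k\<in>{j..n}. bern (n - j) (k - j)) = (\<Sum>i\<le>n - j. bern (n - j) i)"
    by (rule sum.reindex_bij_witness[of _ "\<lambda>i. i + j" "\<lambda>k. k - j"]) (use assms in auto)
  finally show ?thesis by (simp add: bern_sum)
qed

end

text \<open>
  The ratio is the product of the factors \<open>(k - i) / (n - i)\<close> for \<open>i < j\<close>, each of which is uniformly close to
  \<open>k / n\<close>. It makes the values \<open>(k/n)\<^sup>j\<close> interchangeable with those in \<open>bern_moment\<close> in the limit.
\<close>

lemma binomial_ratio_limit:
  "\<exists>e. e \<longlonglongrightarrow> 0 \<and> (\<forall>n k. k \<le> n \<and> j \<le> n \<and> 0 < n \<longrightarrow>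
     \<bar>real (k choose j) / real (n choose j) - (real k / real n) ^ j\<bar> \<le> e n)"
proof (induction j)
  case 0
  show ?case by (intro exI[of _ "\<lambda>n. 0"]) auto
next
  case (Suc j)
  then obtain e where e: "e \<longlonglongrightarrow> 0" and
    le: "\<And>n k. k \<le> n \<Longrightarrow> j \<le> n \<Longrightarrow> 0 < n \<Longrightarrow> \<bar>real (k choose j) / real (n choose j) - (real k / real n) ^ j\<bar> \<le> e n"
    by blast
  define e' where "e' n = e n + real j / (real n - real j)" for n
  have "(\<lambda>n. real j / (real n - real j)) \<longlonglongrightarrow> 0" by real_asymp
  then have "e' \<longlonglongrightarrow> 0" unfolding e'_def using tendsto_add[OF e] by simp
  moreover have "\<bar>real (k choose Suc j) / real (n choose Suc j) - (real k / real n) ^ Suc j\<bar> \<le> e' n"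
    if k: "k \<le> n" "Suc j \<le> n" "0 < n" for n k
  proof -
    define r where "r = real (k choose j) / real (n choose j)"
    have cs: "real (m choose Suc j) * real (Suc j) = real (m choose j) * (real m - real j)" for m
    proof (cases "j \<le> m")
      case True
      have "Suc j * (m choose Suc j) = (m - j) * (m choose j)"
        by (metis binomial_absorb_comp binomial_absorption)
      then show ?thesis using True by (metis mult.commute of_nat_diff of_nat_mult)
    qed (simp add: binomial_eq_0)
    have nj: "real n - real j > 0" using k by simp
    have npos: "real (n choose j) > 0" "real (n choose Suc j) > 0" using k by (simp_all add: zero_less_binomial)
    have rS: "real (k choose Suc j) / real (n choose Suc j) = r * ((real k - real j) / (real n - real j))"
    proof -
      have "real (k choose Suc j) / real (n choose Suc j)
         = (real (k choose Suc j) * real (Suc j)) / (real (n choose Suc j) * real (Suc j))" by simp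
      then show ?thesis unfolding cs r_def by simp
    qed
    have r01: "0 \<le> r" "r \<le> 1"
      using npos binomial_right_mono[of k n j] k by (simp_all add: r_def)
    have "\<bar>r * ((real k - real j) / (real n - real j)) - r * (real k / real n)\<bar> \<le> real j / (real n - real j)"
    proof (cases "k < j")
      case True
      then have "r = 0" by (simp add: r_def binomial_eq_0)
      then show ?thesis using nj by simp
    next
      case False
      have "(real k - real j) / (real n - real j) - real k / real n = - (real j * (real n - real k)) / (real n * (real n - real j))"
        using nj k by (simp add: field_simps)
      then have "\<bar>(real k - real j) / (real n - real j) - real k / real n\<bar> = real j * (real n - real k) / (real n * (real n - real j))"
        using nj k by (simp add: abs_mult)
      also have "\<dots> = (real j / (real n - real j)) * ((real n - real k) / real n)" by simp
      also have "\<dots> \<le> real j / (real n - real j) * 1"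
        using nj k by (intro mult_left_mono) auto
      finally have "\<bar>(real k - real j) / (real n - real j) - real k / real n\<bar> \<le> real j / (real n - real j)" by simp
      then have "r * \<bar>(real k - real j) / (real n - real j) - real k / real n\<bar> \<le> 1 * (real j / (real n - real j))"
        using r01 nj by (intro mult_mono) auto
      then show ?thesis
        unfolding right_diff_distrib[symmetric] abs_mult using r01 by (simp only: abs_of_nonneg mult_1)
    qed
    moreover have "\<bar>r * (real k / real n) - (real k / real n) ^ j * (real k / real n)\<bar> \<le> e n"
    proof -
      have "\<bar>r - (real k / real n) ^ j\<bar> * (real k / real n) \<le> e n * 1"
        using le[of k n] k by (intro mult_mono) (auto simp: r_def intro: order_trans[OF abs_ge_zero])
      then show ?thesis
        unfolding left_diff_distrib[symmetric] abs_mult using k by (simp only: abs_of_nonneg mult_1_right of_nat_0_le_iff divide_nonneg_nonneg)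
    qed
    ultimately show ?thesis unfolding rS e'_def power_Suc2 by linarith
  qed
  ultimately show ?case by blast
qed

section \<open>The spectral measures of a positive contraction\<close>

context positive_contraction
begin

text \<open>
  The solution of the Hausdorff moment problem. The weights \<open>\<langle>u, bern n k (N) u\<rangle>\<close> at the points \<open>k / n\<close> form
  probability measures on the unit interval, and by Helly's theorem a subsequence converges weakly.
\<close>

lemma moment_measure_unit:
  assumes u: "norm u = 1"
  shows "\<exists>m. real_distribution m \<and> (AE x in m. x \<in> {0..1}) \<and>
    (\<forall>p. (\<integral>x. poly p x \<partial>m) = inner u (polyop p u))"
proof -
  define w where "w n k = inner u (polyop (bern n k) u)" for n k
  have w0: "0 \<le> w n k" for n k
    unfolding w_def bern_def using bernstein_nonneg[of u k "n - k"] by (simp add: polyop_smult)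
  have w1: "(\<Sum>k\<le>n. w n k) = 1" for n
    unfolding w_def using u by (simp flip: inner_sum_right polyop_sum add: bern_sum norm_eq_sqrt_inner)
  \<comment> \<open>The index is shifted by one, so that the grid \<open>k / Suc n\<close> is never degenerate.\<close>
  define P where "P n = point_measure {..Suc n} (\<lambda>k. ennreal (w (Suc n) k))" for n
  define \<nu> where "\<nu> n = distr (P n) borel (\<lambda>k. real k / real (Suc n))" for n
  have sP: "sets (P n) = Pow {..Suc n}" "space (P n) = {..Suc n}" for n
    by (simp_all add: P_def sets_point_measure space_point_measure)
  have mP: "g \<in> measurable (P n) borel" for g :: "nat \<Rightarrow> real" and n
    by (simp add: P_def)
  have "emeasure (P n) (space (P n)) = 1" for n
    unfolding P_def space_point_measure
    by (subst emeasure_point_measure_finite) (simp_all only: finite_atMost subset_refl sum_ennreal[OF w0] w1 ennreal_1)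
  then have "prob_space (P n)" for n by (rule prob_spaceI)
  then have rd: "real_distribution (\<nu> n)" for n
    unfolding \<nu>_def real_distribution_def real_distribution_axioms_def
    by (auto intro!: prob_space.prob_space_distr mP)
  have int: "(\<integral>x. f x \<partial>\<nu> n) = (\<Sum>k\<le>Suc n. w (Suc n) k * f (real k / real (Suc n)))"
    if "f \<in> borel_measurable borel" for f :: "real \<Rightarrow> real" and n
  proof -
    have "(\<integral>x. f x \<partial>\<nu> n) = (\<integral>k. f (real k / real (Suc n)) \<partial>P n)"
      unfolding \<nu>_def by (rule integral_distr[OF mP that])
    also have "\<dots> = (\<Sum>k\<le>Suc n. w (Suc n) k *\<^sub>R f (real k / real (Suc n)))"
      unfolding P_def by (rule lebesgue_integral_point_measure_finite) (simp_all only: finite_atMost w0)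
    finally show ?thesis by (simp only: real_scaleR_def)
  qed
  have grid: "real k / real (Suc n) \<in> {0..1}" if "k \<le> Suc n" for k n
    using that by (simp add: divide_le_eq del: of_nat_Suc)
  have "tight \<nu>"
    unfolding tight_def
  proof (intro conjI allI impI rd)
    fix e :: real assume "0 < e"
    have "measure (\<nu> n) {-1<..1} = 1" for n
    proof -
      have "(\<lambda>k. real k / real (Suc n)) -` {-1<..1} \<inter> space (P n) = space (P n)"
      proof -
        have "real k / real (Suc n) \<in> {-1<..1}" if "k \<in> space (P n)" for k
        proof -
          have "real k / real (Suc n) \<in> {0..1}" using that unfolding sP(2) by (intro grid) simp
          then show ?thesis unfolding greaterThanAtMost_iff atLeastAtMost_iff by linarith
        qed
        then show ?thesis by blast
      qed
      moreover have "measure (P n) (space (P n)) = 1"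
        by (rule prob_space.prob_space) fact
      ultimately show ?thesis unfolding \<nu>_def
        by (subst measure_distr) (simp_all only: mP greaterThanAtMost_borel)
    qed
    then show "\<exists>a b. a < b \<and> (\<forall>n. 1 - e < measure (\<nu> n) {a<..b})"
      using \<open>0 < e\<close> by (intro exI[of _ "-1"] exI[of _ 1]) auto
  qed
  then obtain r m where r: "strict_mono (r :: nat \<Rightarrow> nat)" and m: "real_distribution m"
    and weak: "weak_conv_m (\<nu> \<circ> id \<circ> r) m"
    using tight_imp_convergent_subsubsequence[of \<nu> id] strict_mono_id by blast
  interpret m: real_distribution m by (rule m)
  have conv: "(\<lambda>n. \<integral>x. f x \<partial>\<nu> (r n)) \<longlonglongrightarrow> (\<integral>x. f x \<partial>m)"
    if "\<And>x. isCont f x" "\<And>x. \<bar>f x\<bar> \<le> B" for f :: "real \<Rightarrow> real" and B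
  proof -
    have "(\<lambda>n. \<integral>x. f x \<partial>(\<nu> \<circ> id \<circ> r) n) \<longlonglongrightarrow> (\<integral>x. f x \<partial>m)"
      by (rule weak_conv_imp_integral_bdd_continuous_conv[OF _ m weak, of f B]) (use rd that in auto)
    then show ?thesis by simp
  qed
  \<comment> \<open>Monomials are unbounded on the line, so they are tested through the retraction onto the unit interval.\<close>
  define cl where "cl x = max 0 (min 1 x)" for x :: real
  have cl01: "cl x = x" if "x \<in> {0..1}" for x using that by (auto simp: cl_def)
  have cl_bd: "\<bar>cl x\<bar> \<le> 1" for x by (auto simp: cl_def)
  have cl_cont: "isCont cl x" for x unfolding cl_def by (intro continuous_intros)
  have cl_m[measurable]: "cl \<in> borel_measurable borel" unfolding cl_def by measurable
  \<comment> \<open>A bounded continuous function that vanishes exactly on the unit interval.\<close>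
  define h where "h x = min 1 \<bar>x - cl x\<bar>" for x
  have h_m[measurable]: "h \<in> borel_measurable borel" unfolding h_def by measurable
  have h_cont: "isCont h x" for x unfolding h_def by (intro continuous_intros cl_cont)
  have "(\<integral>x. h x \<partial>\<nu> n) = 0" for n
    unfolding int[OF h_m] by (intro sum.neutral) (use grid cl01 in \<open>simp add: h_def\<close>)
  then have h0: "(\<integral>x. h x \<partial>m) = 0"
    using conv[of h 1] h_cont by (simp add: h_def LIMSEQ_const_iff)
  have "integrable m h"
    by (rule m.integrable_const_bound[of _ 1]) (auto simp: h_def)
  then have "AE x in m. h x = 0"
    using h0 by (subst (asm) integral_nonneg_eq_0_iff_AE) (auto simp: h_def)
  then have supp: "AE x in m. x \<in> {0..1}"
    by eventually_elim (auto simp: h_def cl_def split: if_splits)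
  have mom: "(\<integral>x. x ^ j \<partial>m) = inner u (polyop (X ^ j) u)" for j
  proof -
    have 1: "(\<lambda>n. \<integral>x. cl x ^ j \<partial>\<nu> (r n)) \<longlonglongrightarrow> (\<integral>x. cl x ^ j \<partial>m)"
      by (rule conv[of "\<lambda>x. cl x ^ j" 1]) (use cl_bd in \<open>auto intro!: continuous_intros cl_cont simp: power_abs power_le_one\<close>)
    obtain e where e: "e \<longlonglongrightarrow> 0" and le: "\<And>n k. k \<le> n \<Longrightarrow> j \<le> n \<Longrightarrow> 0 < n \<Longrightarrow>
        \<bar>real (k choose j) / real (n choose j) - (real k / real n) ^ j\<bar> \<le> e n"
      using binomial_ratio_limit[of j] by blast
    have "(\<lambda>n. (\<integral>x. cl x ^ j \<partial>\<nu> n) - inner u (polyop (X ^ j) u)) \<longlonglongrightarrow> 0"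
    proof (rule Lim_null_comparison)
      show "(\<lambda>n. e (Suc n)) \<longlonglongrightarrow> 0" using LIMSEQ_Suc[OF e] .
      show "\<forall>\<^sub>F n in sequentially. norm ((\<integral>x. cl x ^ j \<partial>\<nu> n) - inner u (polyop (X ^ j) u)) \<le> e (Suc n)"
        using eventually_ge_at_top[of j]
      proof eventually_elim
        case (elim n)
        let ?n = "Suc n"
        have "inner u (polyop (X ^ j) u) = (\<Sum>k\<le>?n. w ?n k * (real (k choose j) / real (?n choose j)))"
          using elim by (subst bern_moment[of j ?n, symmetric])
            (simp_all only: polyop_sum polyop_smult w_def inner_sum_right inner_scaleR_right mult.commute le_SucI)
        moreover have "(\<integral>x. cl x ^ j \<partial>\<nu> n) = (\<Sum>k\<le>?n. w ?n k * (real k / real ?n) ^ j)"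
          by (subst int) (use grid cl01 in \<open>auto intro!: sum.cong\<close>)
        ultimately have "\<bar>(\<integral>x. cl x ^ j \<partial>\<nu> n) - inner u (polyop (X ^ j) u)\<bar>
           = \<bar>\<Sum>k\<le>?n. w ?n k * ((real k / real ?n) ^ j - real (k choose j) / real (?n choose j))\<bar>"
          by (simp add: sum_subtractf right_diff_distrib)
        also have "\<dots> \<le> (\<Sum>k\<le>?n. \<bar>w ?n k * ((real k / real ?n) ^ j - real (k choose j) / real (?n choose j))\<bar>)"
          by (rule sum_abs)
        also have "\<dots> \<le> (\<Sum>k\<le>?n. w ?n k * e ?n)"
          using le[of _ ?n] elim w0
          by (intro sum_mono) (auto simp: abs_mult abs_minus_commute intro!: mult_left_mono)
        also have "\<dots> = e ?n" using w1[of ?n] by (simp only: mult_1 flip: sum_distrib_right)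
        finally show ?case by simp
      qed
    qed
    then have "(\<lambda>n. \<integral>x. cl x ^ j \<partial>\<nu> n) \<longlonglongrightarrow> inner u (polyop (X ^ j) u)"
      by (simp add: LIM_zero_iff)
    from LIMSEQ_subseq_LIMSEQ[OF this r] have 2: "(\<lambda>n. \<integral>x. cl x ^ j \<partial>\<nu> (r n)) \<longlonglongrightarrow> inner u (polyop (X ^ j) u)"
      by (simp add: comp_def)
    have "(\<integral>x. cl x ^ j \<partial>m) = (\<integral>x. x ^ j \<partial>m)"
      by (rule integral_cong_AE) (use supp in \<open>auto simp: cl01\<close>)
    then show ?thesis using LIMSEQ_unique[OF 1 2] by simp
  qed
  have pint: "integrable m (\<lambda>x. x ^ j)" for j
    by (rule m.integrable_const_bound[of _ 1])
      (use supp in \<open>eventually_elim, auto simp: power_abs intro: power_le_one\<close>)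
  have "(\<integral>x. poly p x \<partial>m) = inner u (polyop p u)" for p
  proof -
    have "(\<integral>x. poly p x \<partial>m) = (\<Sum>i\<le>degree p. coeff p i * (\<integral>x. x ^ i \<partial>m))"
      unfolding poly_altdef using pint by simp
    also have "\<dots> = inner u (polyop (\<Sum>i\<le>degree p. smult (coeff p i) (X ^ i)) u)"
      unfolding mom by (simp add: polyop_sum polyop_smult inner_sum_right)
    also have "(\<Sum>i\<le>degree p. smult (coeff p i) (X ^ i)) = p"
      using poly_as_sum_of_monoms[of p] by (simp only: monom_altdef)
    finally show ?thesis .
  qed
  then show ?thesis using m supp by blast
qed

lemma moment_measure_exists:
  "\<exists>m. sets m = sets borel \<and> finite_measure m \<and> (AE x in m. x \<in> {0..1}) \<and>
    (\<forall>p. (\<integral>x. poly p x \<partial>m) = inner u (polyop p u))"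
proof (cases "u = 0")
  case True
  have "polyop p 0 = 0" for p using polyop_linear[of p] by (simp add: linear_simps)
  then show ?thesis
    using True by (intro exI[of _ "null_measure borel"]) (auto simp: AE_iff_null null_sets_def intro!: finite_measureI)
next
  case False
  define v where "v = (1 / norm u) *\<^sub>R u"
  have uv: "u = norm u *\<^sub>R v" and "norm v = 1" using False by (simp_all add: v_def)
  then obtain m where m: "real_distribution m" "AE x in m. x \<in> {0..1}" "\<And>p. (\<integral>x. poly p x \<partial>m) = inner v (polyop p v)"
    using moment_measure_unit by blast
  interpret m: real_distribution m by (rule m(1))
  define c where "c = (norm u)\<^sup>2"
  let ?m = "density m (\<lambda>x. ennreal c)"
  have c: "0 \<le> c" by (simp add: c_def)
  have "finite_measure ?m"
    by (rule finite_measureI) (simp add: emeasure_density_const ennreal_mult_eq_top_iff)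
  moreover have "AE x in ?m. x \<in> {0..1}"
    using m(2) by (subst AE_density) auto
  moreover have "(\<integral>x. poly p x \<partial>?m) = inner u (polyop p u)" for p
  proof -
    have pm: "(\<lambda>x. poly p x) \<in> borel_measurable m"
      unfolding poly_altdef by simp
    have "(\<integral>x. poly p x \<partial>?m) = c * inner v (polyop p v)"
      using integral_density[OF pm, of "\<lambda>x. c"] c m(3) by simp
    also have "\<dots> = inner (norm u *\<^sub>R v) (polyop p (norm u *\<^sub>R v))"
      using polyop_linear[of p] by (simp add: linear_simps c_def power2_eq_square)
    finally show ?thesis using uv by simp
  qed
  ultimately show ?thesis by (intro exI[of _ ?m]) auto
qed

end

section \<open>The spectral theorem for semibounded operators\<close>

text \<open>
  Polarization: a symmetric operator is determined by its quadratic form.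
\<close>

lemma symmetric_form_eqI:
  fixes P Q :: "'a::real_inner \<Rightarrow> 'a"
  assumes "linear P" "linear Q"
    and sym: "\<And>u v. inner (P u) v = inner u (P v)" "\<And>u v. inner (Q u) v = inner u (Q v)"
    and eq: "\<And>u. inner u (P u) = inner u (Q u)"
  shows "P u = Q u"
proof -
  let ?D = "\<lambda>u. P u - Q u"
  have "inner v (?D u) = 0" for v
  proof -
    have "inner (u + v) (P (u + v)) = inner (u + v) (Q (u + v))" by (rule eq)
    then have "inner u (P v) + inner v (P u) = inner u (Q v) + inner v (Q u)"
      using eq[of u] eq[of v] by (simp add: linear_add assms(1,2) inner_add_left inner_add_right)
    moreover have "inner u (P v) = inner v (P u)" "inner u (Q v) = inner v (Q u)"
      using sym(1)[of u v] sym(2)[of u v] by (simp_all add: inner_commute)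
    ultimately show ?thesis by (simp add: inner_diff_right)
  qed
  from this[of "?D u"] show ?thesis by simp
qed

context positive_contraction
begin

definition moments :: "'a \<Rightarrow> real measure" where
  "moments u = (SOME \<nu>. sets \<nu> = sets borel \<and> finite_measure \<nu> \<and> (AE x in \<nu>. x \<in> {0..1}) \<and>
    (\<forall>p. (\<integral>x. poly p x \<partial>\<nu>) = inner u (polyop p u)))"

lemma moments: "sets (moments u) = sets borel" "finite_measure (moments u)" "AE x in moments u. x \<in> {0..1}"
    "(\<integral>x. poly p x \<partial>moments u) = inner u (polyop p u)"
  using someI_ex[OF moment_measure_exists[of u]] unfolding moments_def[symmetric] by blast+

lemma space_moments [simp]: "space (moments u) = UNIV" and sets_moments [simp, measurable_cong]: "sets (moments u) = sets borel"
  using moments(1)[of u] sets_eq_imp_space_eq[of "moments u" borel] by simp_all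

lemma norm_polyop_integral: "(norm (polyop p u))\<^sup>2 = (\<integral>x. (poly p x)\<^sup>2 \<partial>moments u)"
  using moments(4)[of u "p * p"] unfolding norm_polyop by (simp add: power2_eq_square)

lemma moments_UNIV: "measure (moments u) UNIV = (norm u)\<^sup>2"
  using moments(4)[of u 1] by (simp add: power2_norm_eq_inner)

lemma integrable_moments_bounded:
  fixes f :: "real \<Rightarrow> real"
  assumes [measurable]: "f \<in> borel_measurable borel" and "\<And>x. x \<in> {0..1} \<Longrightarrow> \<bar>f x\<bar> \<le> c"
  shows "integrable (moments u) f"
proof (rule finite_measure.integrable_const_bound[OF moments(2)])
  show "AE x in moments u. norm (f x) \<le> c" using moments(3)[of u] assms(2) by auto
qed simp

lemma poly_measurable [measurable]: "poly p \<in> borel_measurable borel" for p :: "real poly"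
  using borel_measurable_continuous_onI[of "poly p"] by (simp add: continuous_on_poly)

text \<open>
  \<open>P\<close> is the orthogonal projection belonging to \<open>B\<close> in the spectral resolution of \<open>N\<close>. Idempotence is encoded
  by the equality of \<open>\<langle>u, P u\<rangle>\<close> and \<open>\<parallel>P u\<parallel>\<^sup>2\<close>, which passes to strong limits.
\<close>

definition represents :: "('a \<Rightarrow> 'a) \<Rightarrow> real set \<Rightarrow> bool" where
  "represents P B \<longleftrightarrow> linear P \<and> (\<forall>u v. inner (P u) v = inner u (P v)) \<and>
    (\<forall>u. inner u (P u) = measure (moments u) B \<and> (norm (P u))\<^sup>2 = measure (moments u) B)"

lemma representsD:
  assumes "represents P B"
  shows "linear P" "inner (P u) v = inner u (P v)" "inner u (P u) = measure (moments u) B"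
    "(norm (P u))\<^sup>2 = measure (moments u) B"
  using assms unfolding represents_def by blast+

lemma represents_unique: "represents P B \<Longrightarrow> represents Q B \<Longrightarrow> P u = Q u"
  using symmetric_form_eqI[of P Q u] by (simp add: representsD)

lemma represents_idem:
  assumes P: "represents P B" shows "P (P u) = P u"
proof (rule symmetric_form_eqI[of "\<lambda>u. P (P u)" P])
  show "linear (\<lambda>u. P (P u))" using linear_compose[OF representsD(1)[OF P] representsD(1)[OF P]] by (simp add: comp_def)
  show "inner u (P (P u)) = inner u (P u)" for u
    using representsD(2)[OF P, of u "P u"] representsD(3,4)[OF P, of u] by (simp add: power2_norm_eq_inner)
qed (use representsD[OF P] in auto)

text \<open>
  The vector \<open>w = P u\<close> has its whole measure on \<open>A\<close>, hence on \<open>B\<close>; so \<open>\<langle>w, Q w\<rangle> = \<parallel>Q w\<parallel>\<^sup>2 = \<parallel>w\<parallel>\<^sup>2\<close>, and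
  expanding \<open>\<parallel>Q w - w\<parallel>\<^sup>2\<close> gives \<open>0\<close>.
\<close>

lemma represents_mono:
  assumes P: "represents P A" and Q: "represents Q B" and AB: "A \<subseteq> B" "B \<in> sets borel"
  shows "Q (P u) = P u"
proof -
  let ?w = "P u"
  have "(norm ?w)\<^sup>2 \<le> measure (moments ?w) B"
    using representsD(4)[OF P, of ?w] finite_measure.finite_measure_mono[OF moments(2)[of ?w] AB(1)] AB(2)
    by (simp add: represents_idem[OF P])
  moreover have "measure (moments ?w) B \<le> (norm ?w)\<^sup>2"
    using finite_measure.finite_measure_mono[OF moments(2)[of ?w], of B UNIV] by (simp add: moments_UNIV)
  ultimately have "measure (moments ?w) B = (norm ?w)\<^sup>2" by simp
  then have "inner ?w (Q ?w) = (norm ?w)\<^sup>2" "(norm (Q ?w))\<^sup>2 = (norm ?w)\<^sup>2"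
    using representsD(3,4)[OF Q] by simp_all
  then have "(norm (Q ?w - ?w))\<^sup>2 = 0"
    by (simp add: power2_norm_eq_inner inner_diff_left inner_diff_right inner_commute)
  then show ?thesis by simp
qed

lemma represents_Compl:
  assumes P: "represents P A" and A: "A \<in> sets borel"
  shows "represents (\<lambda>u. u - P u) (- A)"
  unfolding represents_def
proof (intro conjI allI)
  show "linear (\<lambda>u. u - P u)" by (intro linear_compose_sub linear_ident representsD(1)[OF P])
  fix u
  have c: "measure (moments u) (- A) = (norm u)\<^sup>2 - measure (moments u) A"
    using finite_measure.finite_measure_compl[OF moments(2), of A u] A by (simp add: Compl_eq_Diff_UNIV moments_UNIV)
  show "inner u (u - P u) = measure (moments u) (- A)"
    using representsD(3)[OF P, of u] by (simp add: c inner_diff_right power2_norm_eq_inner)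
  show "(norm (u - P u))\<^sup>2 = measure (moments u) (- A)"
    using representsD(3,4)[OF P, of u]
    by (simp add: c power2_norm_eq_inner inner_diff_left inner_diff_right inner_commute)
qed (simp add: inner_diff_left inner_diff_right representsD(2)[OF P])

lemma represents_Un:
  assumes P: "represents P A" and Q: "represents Q B" and AB: "A \<in> sets borel" "B \<in> sets borel" "A \<inter> B = {}"
  shows "represents (\<lambda>u. P u + Q u) (A \<union> B)"
  unfolding represents_def
proof (intro conjI allI)
  show "linear (\<lambda>u. P u + Q u)" by (intro linear_compose_add representsD(1)[OF P] representsD(1)[OF Q])
  fix u
  have "P u - Q (P u) = P u"
    by (rule represents_mono[OF P represents_Compl[OF Q AB(2)]]) (use AB in auto)
  then have "inner (P u) (Q u) = 0"
    using representsD(2)[OF Q, of "P u" u] by simp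
  moreover have c: "measure (moments u) (A \<union> B) = measure (moments u) A + measure (moments u) B"
    using finite_measure.finite_measure_Union[OF moments(2), of A u B] AB by simp
  ultimately show "(norm (P u + Q u))\<^sup>2 = measure (moments u) (A \<union> B)"
    using representsD(4)[OF P, of u] representsD(4)[OF Q, of u]
    by (simp add: power2_norm_eq_inner inner_add_left inner_add_right inner_commute)
  show "inner u (P u + Q u) = measure (moments u) (A \<union> B)"
    using representsD(3)[OF P, of u] representsD(3)[OF Q, of u] by (simp add: c inner_add_right)
qed (simp add: inner_add_left inner_add_right representsD(2)[OF P] representsD(2)[OF Q])

lemma represents_limit:
  assumes lin: "\<And>n. linear (R n)" and sym: "\<And>n u v. inner (R n u) v = inner u (R n v)"
    and Cauchy: "\<And>u. Cauchy (\<lambda>n. R n u)"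
    and form: "\<And>u. (\<lambda>n. inner u (R n u)) \<longlonglongrightarrow> measure (moments u) B"
    and norm: "\<And>u. (\<lambda>n. (norm (R n u))\<^sup>2) \<longlonglongrightarrow> measure (moments u) B"
  shows "\<exists>P. represents P B \<and> (\<forall>u. (\<lambda>n. R n u) \<longlonglongrightarrow> P u)"
proof -
  have "\<forall>u. \<exists>w. (\<lambda>n. R n u) \<longlonglongrightarrow> w" using Cauchy Cauchy_convergent_iff convergent_def by blast
  then obtain P where P: "\<And>u. (\<lambda>n. R n u) \<longlonglongrightarrow> P u" by metis
  have "represents P B"
    unfolding represents_def
  proof (intro conjI allI)
    show "linear P"
    proof (rule linearI)
      show "P (u + v) = P u + P v" for u v
        using LIMSEQ_unique[OF P[of "u + v"]] tendsto_add[OF P[of u] P[of v]] by (simp add: linear_add lin)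
      show "P (c *\<^sub>R u) = c *\<^sub>R P u" for c u
        using LIMSEQ_unique[OF P[of "c *\<^sub>R u"]] tendsto_scaleR[OF tendsto_const P[of u], of c] by (simp add: linear_scale lin)
    qed
    show "inner (P u) v = inner u (P v)" for u v
      using LIMSEQ_unique[OF tendsto_inner[OF P[of u] tendsto_const[of v]], of "inner u (P v)"]
        tendsto_inner[OF tendsto_const[of u] P[of v]] by (simp add: sym)
    show "inner u (P u) = measure (moments u) B" for u
      using LIMSEQ_unique[OF tendsto_inner[OF tendsto_const[of u] P[of u]] form] .
    show "(norm (P u))\<^sup>2 = measure (moments u) B" for u
      using LIMSEQ_unique[OF tendsto_power[OF tendsto_norm[OF P[of u]], of 2] norm] .
  qed
  then show ?thesis using P by blast
qed

lemma represents_incseq: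
  assumes R: "\<And>n. represents (R n) (G n)" and G: "incseq G" "range G \<subseteq> sets borel"
  shows "\<exists>P. represents P (\<Union>n. G n) \<and> (\<forall>u. (\<lambda>n. R n u) \<longlonglongrightarrow> P u)"
proof (rule represents_limit)
  have lim: "(\<lambda>n. measure (moments u) (G n)) \<longlonglongrightarrow> measure (moments u) (\<Union>n. G n)" for u
    by (rule finite_measure.finite_Lim_measure_incseq[OF moments(2)]) (use G in auto)
  then show "(\<lambda>n. inner u (R n u)) \<longlonglongrightarrow> measure (moments u) (\<Union>n. G n)"
    "(\<lambda>n. (norm (R n u))\<^sup>2) \<longlonglongrightarrow> measure (moments u) (\<Union>n. G n)" for u
    using representsD[OF R] by simp_all
  show "linear (R n)" "inner (R n u) v = inner u (R n v)" for n u v using representsD[OF R] by simp_all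
  show "Cauchy (\<lambda>n. R n u)" for u
  proof (rule Cauchy_if_dist_square_le)
    let ?I = "\<lambda>n. measure (moments u) (\<Union>n. G n) - measure (moments u) (G n)"
    show "?I \<longlonglongrightarrow> 0" using tendsto_diff[OF tendsto_const[of "measure (moments u) (\<Union>n. G n)"] lim[of u]] by simp
    have I0: "0 \<le> ?I n" for n
      using finite_measure.finite_measure_mono[OF moments(2)[of u], of "G n" "\<Union>n. G n"] G by auto
    have le: "(norm (R k u - R l u))\<^sup>2 \<le> ?I k" if "k \<le> l" for k l
    proof -
      have "R l (R k u) = R k u"
        using represents_mono[OF R R] G that by (auto simp: incseq_def)
      then have "inner (R k u) (R l u) = (norm (R k u))\<^sup>2"
        using representsD(2)[OF R[of l], of "R k u" u] representsD(3,4)[OF R[of k], of u] by (simp add: inner_commute)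
      then have "(norm (R k u - R l u))\<^sup>2 = measure (moments u) (G l) - measure (moments u) (G k)"
        using representsD(4)[OF R[of l], of u] representsD(4)[OF R[of k], of u]
        by (simp add: power2_norm_eq_inner inner_diff_left inner_diff_right inner_commute)
      then show ?thesis using I0[of l] by simp
    qed
    show "(norm (R k u - R l u))\<^sup>2 \<le> 2 * ?I k + 2 * ?I l" for k l
      using le[of k l] le[of l k] I0[of k] I0[of l] by (cases "k \<le> l") (auto simp: norm_minus_commute)
  qed
qed

lemma uniform_polynomial_approximation:
  fixes f :: "real \<Rightarrow> real"
  assumes "continuous_on {0..1} f" "0 < e"
  obtains p where "\<And>x. x \<in> {0..1} \<Longrightarrow> \<bar>f x - poly p x\<bar> < e"
proof -
  obtain n where n: "\<And>x. x \<in> {0..1} \<Longrightarrow> \<bar>f x - (\<Sum>k\<le>n. f (k / n) * Bernstein n k x)\<bar> < e"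
    using Bernstein_Weierstrass[OF assms] by blast
  show ?thesis
    by (rule that[of "\<Sum>k\<le>n. smult (f (k / n)) (bern n k)"]) (use n in \<open>simp add: poly_sum poly_bern\<close>)
qed

text \<open>
  Continuous ramps decrease to the indicator of the half-line, and polynomials uniformly close to them on the
  unit interval converge to it pointwise and boundedly. The corresponding operators converge strongly, since
  differences are \<open>L\<^sup>2\<close> distances with respect to the moment measures.
\<close>

lemma represents_atMost: "\<exists>P. represents P {..a}"
proof -
  define \<phi> where "\<phi> n x = max 0 (min 1 (1 - real n * (x - a)))" for n x
  have "\<exists>p. \<forall>x\<in>{0..1}. \<bar>\<phi> n x - poly p x\<bar> < 1 / real (Suc n)" for n
  proof -
    have "continuous_on {0..1} (\<phi> n)" unfolding \<phi>_def by (intro continuous_intros)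
    then obtain p where "\<And>x. x \<in> {0..1} \<Longrightarrow> \<bar>\<phi> n x - poly p x\<bar> < 1 / real (Suc n)"
      by (rule uniform_polynomial_approximation[of "\<phi> n" "1 / real (Suc n)"]) (simp, blast)
    then show ?thesis by blast
  qed
  then obtain p where p: "\<And>n x. x \<in> {0..1} \<Longrightarrow> \<bar>\<phi> n x - poly (p n) x\<bar> < 1 / real (Suc n)" by metis
  let ?i = "indicator {..a} :: real \<Rightarrow> real"
  have \<phi>_lim: "(\<lambda>n. \<phi> n x) \<longlonglongrightarrow> ?i x" for x
  proof (cases "x \<le> a")
    case True
    have "real n * (x - a) \<le> 0" for n using True by (simp add: mult_nonneg_nonpos)
    then have "\<phi> n x = 1" for n unfolding \<phi>_def by (simp add: min_def max_def)
    then show ?thesis using True by simp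
  next
    case False
    obtain N where N: "1 / (x - a) < real N" using reals_Archimedean2 by blast
    have "\<phi> n x = 0" if "n \<ge> N" for n
    proof -
      have "1 / (x - a) < real n" using N that by linarith
      then have "1 < real n * (x - a)" using False by (simp add: field_simps)
      then show ?thesis by (simp add: \<phi>_def)
    qed
    then have "\<forall>\<^sub>F n in sequentially. \<phi> n x = 0" by (auto simp: eventually_sequentially)
    then show ?thesis using False by (simp add: tendsto_eventually)
  qed
  have p_lim: "(\<lambda>n. poly (p n) x) \<longlonglongrightarrow> ?i x" if "x \<in> {0..1}" for x
  proof -
    have "(\<lambda>n. poly (p n) x - \<phi> n x) \<longlonglongrightarrow> 0"
      by (rule Lim_null_comparison[OF _ LIMSEQ_Suc[OF lim_1_over_n]])
        (use p[OF that] in \<open>auto intro!: always_eventually less_imp_le simp: abs_minus_commute\<close>)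
    from tendsto_add[OF this \<phi>_lim[of x]] show ?thesis by simp
  qed
  have p_bd: "\<bar>poly (p n) x\<bar> \<le> 2" if "x \<in> {0..1}" for n x
  proof -
    have "\<bar>\<phi> n x - poly (p n) x\<bar> < 1 / real (Suc n)" by (rule p[OF that])
    also have "\<dots> \<le> 1" by simp
    finally have "\<bar>\<phi> n x - poly (p n) x\<bar> < 1" .
    moreover have "\<bar>\<phi> n x\<bar> \<le> 1" by (auto simp: \<phi>_def)
    ultimately show ?thesis by linarith
  qed
  have lim: "(\<lambda>n. \<integral>x. h (poly (p n) x) x \<partial>moments u) \<longlonglongrightarrow> (\<integral>x. h (?i x) x \<partial>moments u)"
    if [measurable]: "\<And>n. (\<lambda>x. h (poly (p n) x) x) \<in> borel_measurable borel" "(\<lambda>x. h (?i x) x) \<in> borel_measurable borel"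
      and cont: "\<And>x. isCont (\<lambda>y. h y x) (?i x)" and bd: "\<And>y x. \<bar>y\<bar> \<le> 2 \<Longrightarrow> \<bar>h y x\<bar> \<le> 9"
    for h :: "real \<Rightarrow> real \<Rightarrow> real" and u
  proof (rule integral_dominated_convergence[where w = "\<lambda>x. 9"])
    show "integrable (moments u) (\<lambda>x. 9::real)" by (rule integrable_moments_bounded[of _ 9]) auto
    show "AE x in moments u. (\<lambda>n. h (poly (p n) x) x) \<longlonglongrightarrow> h (?i x) x"
      using moments(3)
    proof eventually_elim
      case (elim x)
      show ?case by (rule isCont_tendsto_compose[OF cont p_lim[OF elim]])
    qed
    show "AE x in moments u. norm (h (poly (p n) x) x) \<le> 9" for n
      using moments(3) by eventually_elim (use p_bd bd in auto)
  qed (use that in simp_all)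
  have L2: "(\<lambda>n. \<integral>x. (poly (p n) x - ?i x)\<^sup>2 \<partial>moments u) \<longlonglongrightarrow> 0" for u
  proof -
    have "\<bar>(y - ?i x)\<^sup>2\<bar> \<le> 9" if "\<bar>y\<bar> \<le> 2" for y x
    proof -
      have "\<bar>y - ?i x\<bar>\<^sup>2 \<le> 3\<^sup>2" using that by (intro power_mono) (auto simp: indicator_def)
      then show ?thesis by simp
    qed
    then show ?thesis using lim[of "\<lambda>y x. (y - ?i x)\<^sup>2" u] by simp
  qed
  have int: "integrable (moments u) (\<lambda>x. (poly (p n) x - ?i x)\<^sup>2)" for n u
  proof (rule integrable_moments_bounded)
    fix x :: real assume "x \<in> {0..1}"
    then have "\<bar>poly (p n) x - ?i x\<bar>\<^sup>2 \<le> 3\<^sup>2" using p_bd[of x n] by (intro power_mono) (auto simp: indicator_def)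
    then show "\<bar>(poly (p n) x - ?i x)\<^sup>2\<bar> \<le> 9" by simp
  qed measurable
  have "\<exists>P. represents P {..a} \<and> (\<forall>u. (\<lambda>n. polyop (p n) u) \<longlonglongrightarrow> P u)"
  proof (rule represents_limit)
    show "linear (polyop (p n))" for n by (rule bounded_linear.linear[OF polyop_linear])
    show "inner (polyop (p n) u) v = inner u (polyop (p n) v)" for n u v by (rule polyop_sym)
    show "Cauchy (\<lambda>n. polyop (p n) u)" for u
    proof (rule Cauchy_if_dist_square_le[OF _ L2[of u]])
      fix k l
      have "(norm (polyop (p k) u - polyop (p l) u))\<^sup>2 = (\<integral>x. (poly (p k) x - poly (p l) x)\<^sup>2 \<partial>moments u)"
        using norm_polyop_integral[of "p k - p l" u] by (simp add: polyop_diff)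
      also have "\<dots> \<le> (\<integral>x. 2 * (poly (p k) x - ?i x)\<^sup>2 + 2 * (poly (p l) x - ?i x)\<^sup>2 \<partial>moments u)"
      proof (rule integral_mono)
        show "integrable (moments u) (\<lambda>x. (poly (p k) x - poly (p l) x)\<^sup>2)"
        proof (rule integrable_moments_bounded)
          fix x :: real assume "x \<in> {0..1}"
          then have "\<bar>poly (p k) x - poly (p l) x\<bar>\<^sup>2 \<le> 4\<^sup>2" using p_bd[of x k] p_bd[of x l] by (intro power_mono) auto
          then show "\<bar>(poly (p k) x - poly (p l) x)\<^sup>2\<bar> \<le> 16" by simp
        qed measurable
        fix x
        show "(poly (p k) x - poly (p l) x)\<^sup>2 \<le> 2 * (poly (p k) x - ?i x)\<^sup>2 + 2 * (poly (p l) x - ?i x)\<^sup>2"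
          using zero_le_power2[of "(poly (p k) x - ?i x) + (poly (p l) x - ?i x)"] by (simp add: power2_eq_square algebra_simps)
      qed (use int in simp)
      finally show "(norm (polyop (p k) u - polyop (p l) u))\<^sup>2 \<le>
          2 * (\<integral>x. (poly (p k) x - ?i x)\<^sup>2 \<partial>moments u) + 2 * (\<integral>x. (poly (p l) x - ?i x)\<^sup>2 \<partial>moments u)"
        using int by simp
    qed
    show "(\<lambda>n. inner u (polyop (p n) u)) \<longlonglongrightarrow> measure (moments u) {..a}" for u
      using lim[of "\<lambda>y x. y" u] by (simp add: moments(4))
    have sq: "(?i x)\<^sup>2 = ?i x" for x by (simp add: indicator_def)
    have "\<bar>y\<^sup>2\<bar> \<le> 9" if "\<bar>y\<bar> \<le> 2" for y :: real
      using power_mono[OF that, of 2] by simp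
    then show "(\<lambda>n. (norm (polyop (p n) u))\<^sup>2) \<longlonglongrightarrow> measure (moments u) {..a}" for u
      using lim[of "\<lambda>y x. y\<^sup>2" u] by (simp add: norm_polyop_integral sq)
  qed
  then show ?thesis by blast
qed

lemma represents_partial_unions:
  assumes F: "range F \<subseteq> sets borel" "disjoint_family F" and P: "\<And>n::nat. represents (P n) (F n)"
  shows "represents (\<lambda>u. \<Sum>i<n. P i u) (\<Union>i<n. F i)"
proof (induction n)
  case 0
  show ?case by (auto simp: represents_def intro: linear_zero)
next
  case (Suc n)
  have disj: "F i \<inter> F n = {}" if "i < n" for i
    using disjoint_family_onD[OF F(2), of i n] that by simp
  have Fn: "F k \<in> sets borel" for k using F(1) by (rule range_subsetD)
  have "represents (\<lambda>u. (\<Sum>i<n. P i u) + P n u) ((\<Union>i<n. F i) \<union> F n)"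
  proof (rule represents_Un[OF Suc P[of n]])
    show "(\<Union>i<n. F i) \<in> sets borel" by (intro sets.finite_UN Fn) simp
    show "(\<Union>i<n. F i) \<inter> F n = {}" using disj by blast
  qed (rule Fn)
  moreover have "(\<Union>i<Suc n. F i) = (\<Union>i<n. F i) \<union> F n"
    by (simp only: lessThan_Suc UN_insert Un_commute[of "F n"])
  ultimately show ?case by (simp only: sum.lessThan_Suc)
qed

lemma incseq_partial_unions: "incseq (\<lambda>n::nat. \<Union>i<n. F i)"
  unfolding incseq_def by (intro allI impI UN_mono) auto

lemma UN_partial_unions: "(\<Union>n::nat. \<Union>i<n. F i) = (\<Union>i. F i)"
  by auto

lemma represents_disjoint_union:
  assumes F: "range F \<subseteq> sets borel" "disjoint_family F" and P: "\<And>n::nat. represents (P n) (F n)"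
  shows "\<exists>Q. represents Q (\<Union>n. F n) \<and> (\<forall>u. (\<lambda>n. P n u) sums Q u)"
proof -
  have "range (\<lambda>n. \<Union>i<n. F i) \<subseteq> sets borel" using F(1) by auto
  from represents_incseq[OF represents_partial_unions[OF F P] incseq_partial_unions this]
  show ?thesis by (simp only: UN_partial_unions sums_def)
qed

text \<open>
  Dynkin's theorem: half-lines generate the Borel sets and are closed under intersection.
\<close>

lemma represents_exists:
  assumes "B \<in> sets borel"
  shows "\<exists>P. represents P B"
proof -
  have "sets (borel :: real measure) = sets (sigma UNIV (range atMost))"
    by (rule arg_cong[OF borel_eq_atMost])
  also have "\<dots> = sigma_sets UNIV (range atMost)"
    by (rule sets_measure_of) simp
  finally have borel: "sets (borel :: real measure) = sigma_sets UNIV (range atMost)" .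
  have "Int_stable (range (atMost :: real \<Rightarrow> real set))"
  proof (rule Int_stableI)
    fix A B :: "real set" assume "A \<in> range atMost" "B \<in> range atMost"
    then obtain a b where "A = {..a}" "B = {..b}" by blast
    then have "A \<inter> B = {..min a b}" by simp
    then show "A \<inter> B \<in> range atMost" by blast
  qed
  moreover have "range (atMost :: real \<Rightarrow> real set) \<subseteq> Pow UNIV" by simp
  moreover have "B \<in> sigma_sets UNIV (range atMost)" using assms by (simp add: borel)
  ultimately show ?thesis
  proof (induction rule: sigma_sets_induct_disjoint)
    case (basic A)
    then show ?case using represents_atMost by auto
  next
    case empty
    show ?case by (intro exI[of _ "\<lambda>u. 0"]) (auto simp: represents_def intro: linear_zero)
  next
    case (compl A)
    then obtain P where P: "represents P A" by blast
    have "A \<in> sets borel" using compl(1) unfolding borel .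
    from represents_Compl[OF P this] show ?case unfolding Compl_eq_Diff_UNIV by blast
  next
    case (union F)
    have "\<forall>n. \<exists>P. represents P (F n)" using union(3) by blast
    then obtain P where "\<forall>n. represents (P n) (F n)" by (rule choice[THEN exE])
    then have P: "represents (P n) (F n)" for n by blast
    have "range F \<subseteq> sets borel" using union(2) unfolding borel .
    from represents_disjoint_union[OF this union(1) P] show ?case by blast
  qed
qed

definition spectral_projection :: "real set \<Rightarrow> 'a \<Rightarrow> 'a" where
  "spectral_projection B = (SOME P. represents P B)"

lemma represents_spectral_projection: "B \<in> sets borel \<Longrightarrow> represents (spectral_projection B) B"
  unfolding spectral_projection_def using someI_ex[OF represents_exists] .

lemma projection_valued_measure_spectral_projection: "projection_valued_measure spectral_projection"
  unfolding projection_valued_measure_def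
proof (intro conjI ballI allI impI)
  fix B :: "real set" assume B: "B \<in> sets borel"
  note R = representsD[OF represents_spectral_projection[OF B]]
  show "bounded_linear (spectral_projection B)"
  proof (rule bounded_linear_intro)
    show "spectral_projection B (u + v) = spectral_projection B u + spectral_projection B v" "spectral_projection B (c *\<^sub>R u) = c *\<^sub>R spectral_projection B u" for u v c
      using R(1) by (simp_all add: linear_add linear_scale)
    have "(norm (spectral_projection B u))\<^sup>2 \<le> (norm u)\<^sup>2" for u
      using R(4)[of u] finite_measure.finite_measure_mono[OF moments(2)[of u], of B UNIV] by (simp add: moments_UNIV)
    then show "norm (spectral_projection B u) \<le> norm u * 1" for u using power2_le_imp_le by fastforce
  qed
  show "spectral_projection B (spectral_projection B u) = spectral_projection B u" for u by (rule represents_idem[OF represents_spectral_projection[OF B]])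
  show "inner (spectral_projection B u) v = inner u (spectral_projection B v)" for u v by (rule R(2))
next
  fix u
  have "represents (\<lambda>u. u) UNIV"
    unfolding represents_def by (auto simp: moments_UNIV power2_norm_eq_inner linear_ident)
  then show "spectral_projection UNIV u = u" using represents_unique[OF represents_spectral_projection[of UNIV]] by simp
next
  fix F :: "nat \<Rightarrow> real set" and u assume F: "range F \<subseteq> sets borel" "disjoint_family F"
  then have "represents (spectral_projection (F n)) (F n)" for n by (intro represents_spectral_projection) auto
  then obtain Q where Q: "represents Q (\<Union>n. F n)" "\<And>u. (\<lambda>n. spectral_projection (F n) u) sums Q u"
    using represents_disjoint_union[OF F, of "\<lambda>n. spectral_projection (F n)"] by blast
  have "(\<Union>n. F n) \<in> sets borel" using F by auto
  from represents_unique[OF Q(1) represents_spectral_projection[OF this]] show "(\<lambda>n. spectral_projection (F n) u) sums spectral_projection (\<Union>n. F n) u"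
    using Q(2)[of u] by simp
qed

sublocale pvm spectral_projection
  by unfold_locales (rule projection_valued_measure_spectral_projection)

lemma vector_measure_spectral_projection: "M u = moments u"
proof (rule measure_eqI)
  fix B assume "B \<in> sets (M u)"
  then have B: "B \<in> sets borel" by simp
  have "emeasure (moments u) B = ennreal (measure (moments u) B)"
    by (rule finite_measure.emeasure_eq_measure[OF moments(2)])
  then show "emeasure (M u) B = emeasure (moments u) B"
    using representsD(4)[OF represents_spectral_projection[OF B], of u] by (simp add: emeasure_M B)
qed simp

lemma M_unit_interval: "AE x in M u. x \<in> {0..1}"
  unfolding vector_measure_spectral_projection by (rule moments(3))

lemma L2_dom_ident: "u \<in> L2_dom (\<lambda>x. x)"
  by (rule L2_dom_bounded[where c = 1]) (use M_unit_interval[of u] in auto)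

lemma Phi_ident: "Phi (\<lambda>x. x) u = N u"
proof (rule Phi_eqI)
  have "(\<integral>x. x \<partial>M w) = inner w (N w)" for w
    using moments(4)[of w X] by (simp add: vector_measure_spectral_projection)
  then have polar: "polar (\<lambda>x. x) v u = (inner (v + u) (N (v + u)) - inner (v - u) (N (v - u))) / 4" for v
    by (simp add: polar_def)
  show "inner v (N u) = polar (\<lambda>x. x) v u" for v
    using polar[of v] sym_N[of u v] by (simp add: N_add N_diff inner_add_left inner_add_right inner_diff_left
        inner_diff_right inner_commute)
qed simp

end

lemma projection_valued_measure_vimage:
  fixes E :: "real set \<Rightarrow> 'a::{real_inner, banach} \<Rightarrow> 'a"
  assumes E: "projection_valued_measure E" and g: "g \<in> borel_measurable borel"
  shows "projection_valued_measure (\<lambda>B. E (g -` B))"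
proof -
  have g': "g -` B \<in> sets borel" if "B \<in> sets borel" for B
    using measurable_sets[OF g that] by simp
  show ?thesis
    unfolding projection_valued_measure_def
  proof (intro conjI ballI allI impI)
    fix B :: "real set" assume "B \<in> sets borel"
    from g'[OF this] E show "bounded_linear (E (g -` B))" "E (g -` B) (E (g -` B) u) = E (g -` B) u"
      "inner (E (g -` B) u) v = inner u (E (g -` B) v)" for u v
      unfolding projection_valued_measure_def by blast+
  next
    fix u show "E (g -` UNIV) u = u" using E by (simp add: projection_valued_measure_def)
  next
    fix F :: "nat \<Rightarrow> real set" and u assume F: "range F \<subseteq> sets borel" "disjoint_family F"
    have "range (\<lambda>n. g -` F n) \<subseteq> sets borel" using F(1) g' by blast
    moreover have "disjoint_family (\<lambda>n. g -` F n)" using F(2) by (auto simp: disjoint_family_on_def)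
    ultimately have "(\<lambda>n. E (g -` F n) u) sums E (\<Union>n. g -` F n) u"
      using E unfolding projection_valued_measure_def by blast
    then show "(\<lambda>n. E (g -` F n) u) sums E (g -` (\<Union>n. F n)) u" by (simp add: vimage_Union)
  qed
qed

lemma spectral_integral_vimage:
  fixes E :: "real set \<Rightarrow> 'a::{real_inner, banach} \<Rightarrow> 'a"
  assumes E: "projection_valued_measure E" and g[measurable]: "g \<in> borel_measurable borel"
    and f[measurable]: "f \<in> borel_measurable borel"
  shows "spectral_integral (\<lambda>B. E (g -` B)) f = spectral_integral E (\<lambda>x. f (g x))"
proof -
  interpret E: pvm E by unfold_locales (rule E)
  interpret E': pvm "\<lambda>B. E (g -` B)"
    by unfold_locales (rule projection_valued_measure_vimage[OF E g])
  have "vector_measure (\<lambda>B. E (g -` B)) u = distr (vector_measure E u) borel g" for u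
  proof (rule measure_eqI)
    fix B assume "B \<in> sets (vector_measure (\<lambda>B. E (g -` B)) u)"
    then have B: "B \<in> sets borel" by simp
    have "g -` B \<in> sets borel" using measurable_sets[OF g B] by simp
    then show "emeasure (vector_measure (\<lambda>B. E (g -` B)) u) B = emeasure (distr (vector_measure E u) borel g) B"
      using B by (simp add: E'.emeasure_M E.emeasure_M emeasure_distr)
  qed simp
  then show ?thesis
    unfolding spectral_integral_def Let_def by (simp add: integrable_distr_eq integral_distr)
qed

text \<open>
  Let \<open>N = k (A - l)\<^sup>-\<^sup>1\<close>. As \<open>A = k N\<^sup>-\<^sup>1 + l\<close>, the spectral measure of \<open>A\<close> is the image of that of \<open>N\<close>
  under \<open>g x = k / x + l\<close>. The point \<open>0\<close>, where \<open>g\<close> takes the default value \<open>l\<close>, is a null set because \<open>N\<close> is injective.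
\<close>

theorem spectral_measure_exists:
  fixes A :: "'a::{real_inner, banach} unbounded_operator"
  assumes A: "symmetric_operator A"
    and k: "0 < k"
    and bound: "\<And>u. u \<in> Dom A \<Longrightarrow> k * (norm u)\<^sup>2 \<le> inner u (app A u) - l * (norm u)\<^sup>2"
    and surj: "\<And>w. \<exists>u\<in>Dom A. app A u - l *\<^sub>R u = w"
  shows "\<exists>E. is_spectral_measure A E"
proof -
  note AD = symmetric_operatorD[OF A]
  obtain R where res: "is_resolvent A l R" and sym: "\<And>u v. inner (R u) v = inner u (R v)"
    and form: "\<And>w. k * (norm (R w))\<^sup>2 \<le> inner w (R w)"
    by (rule resolvent_if_surjective[OF A k _ surj]) (use bound in auto)
  have R: "bounded_linear R" "\<And>w. R w \<in> Dom A" "\<And>w. app A (R w) - l *\<^sub>R R w = w"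
    "\<And>u. u \<in> Dom A \<Longrightarrow> R (app A u - l *\<^sub>R u) = u"
    using res unfolding is_resolvent_def by auto
  \<comment> \<open>The factor \<open>k\<close> normalises the resolvent to a contraction.\<close>
  define N where "N w = k *\<^sub>R R w" for w
  have N: "N w \<in> Dom A" "app A (N w) - l *\<^sub>R N w = k *\<^sub>R w" for w
  proof -
    show "N w \<in> Dom A" unfolding N_def by (rule subspace_scale[OF AD(1) R(2)])
    have "k *\<^sub>R (app A (R w) - l *\<^sub>R R w) = k *\<^sub>R w" using R(3)[of w] by simp
    then show "app A (N w) - l *\<^sub>R N w = k *\<^sub>R w"
      using AD(4)[OF R(2), of k w] by (simp add: N_def scaleR_diff_right mult.commute)
  qed
  interpret positive_contraction N
  proof (rule positive_contraction.intro)
    show "bounded_linear N"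
      unfolding N_def[abs_def] by (rule bounded_linear_compose[OF bounded_linear_scaleR_right R(1)])
    show "inner (N u) v = inner u (N v)" for u v by (simp add: N_def sym)
    show "(norm (N w))\<^sup>2 \<le> inner w (N w)" for w
      using mult_left_mono[OF form[of w], of k] k by (simp add: N_def power_mult_distrib power2_eq_square mult_ac)
  qed
  have injective: "w = 0" if "N w = 0" for w
    using N(2)[of w] N(2)[of 0] that N_zero k by simp
  define g where "g x = k / x + l" for x :: real
  have g[measurable]: "g \<in> borel_measurable borel" unfolding g_def by measurable
  have "spectral_projection {0} u = 0" for u
  proof (rule injective)
    let ?w = "spectral_projection {0} u"
    have "(norm (N ?w))\<^sup>2 = (\<integral>x. x\<^sup>2 \<partial>M ?w)"
      using Phi_norm[OF _ L2_dom_ident, of ?w] by (simp add: Phi_ident)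
    also have "\<dots> = (\<integral>x. 0 \<partial>M ?w)"
      using AE_E[of "{0}" u] by (intro integral_cong_AE) auto
    finally show "N ?w = 0" by simp
  qed
  then have "emeasure (M u) {0} = 0" for u by (simp add: emeasure_M)
  then have nz: "AE x in M u. x \<noteq> 0" for u
    by (intro AE_I[of _ _ "{0}"]) auto
  have Dom_range: "\<exists>w. u = N w" if "u \<in> Dom A" for u
    using R(4)[OF that] k by (intro exI[of _ "(1 / k) *\<^sub>R (app A u - l *\<^sub>R u)"])
      (simp add: N_def linear_scale[OF bounded_linear.linear[OF R(1)]])
  have "Dom A = L2_dom g \<and> (\<forall>u\<in>Dom A. app A u = Phi g u)"
  proof (intro conjI equalityI subsetI ballI)
    \<comment> \<open>Every element of the domain is some \<open>N w\<close>, and \<open>g x * x = k + l * x\<close> away from the null set \<open>{0}\<close>.\<close>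
    have Nw: "N w \<in> L2_dom g \<and> Phi g (N w) = app A (N w)" for w
    proof -
      have ae: "AE x in M w. k + l * x = g x * x"
        using nz[of w] by eventually_elim (simp add: g_def field_simps)
      have d: "w \<in> L2_dom (\<lambda>x. k + l * x)"
        by (intro L2_dom_add_fun L2_dom_const L2_dom_cmult L2_dom_ident) auto
      have "Phi (\<lambda>x. k + l * x) w = k *\<^sub>R w + l *\<^sub>R N w"
        using Phi_add_fun[of "\<lambda>x. k" "\<lambda>x. l * x" w] L2_dom_const[of w k] L2_dom_cmult[OF L2_dom_ident, of w l]
          Phi_cmult_fun[OF _ L2_dom_ident, of l w] by (simp add: Phi_ident Phi_const)
      then have 1: "Phi (\<lambda>x. g x * x) w = k *\<^sub>R w + l *\<^sub>R N w" "w \<in> L2_dom (\<lambda>x. g x * x)"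
        using Phi_cong_AE[OF _ _ d ae] by simp_all
      then have "N w \<in> L2_dom g"
        using L2_dom_Phi_iff[OF _ L2_dom_ident g, of w] by (simp add: Phi_ident)
      moreover have "Phi g (N w) = k *\<^sub>R w + l *\<^sub>R N w"
        using Phi_Phi[OF _ L2_dom_ident g, of w] calculation 1(1) by (simp add: Phi_ident)
      moreover have "app A (N w) = k *\<^sub>R w + l *\<^sub>R N w" using N(2)[of w] by (simp add: algebra_simps)
      ultimately show ?thesis by simp
    qed
    show "u \<in> L2_dom g" if "u \<in> Dom A" for u using Nw Dom_range[OF that] by metis
    show "app A u = Phi g u" if "u \<in> Dom A" for u using Nw Dom_range[OF that] by metis
    show "u \<in> Dom A" if u: "u \<in> L2_dom g" for u
    proof -
      have dh: "u \<in> L2_dom (\<lambda>x. g x - l)" by (intro L2_dom_diff_fun u L2_dom_const) auto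
      let ?w = "Phi (\<lambda>x. g x - l) u"
      have ae: "AE x in M u. k = x * (g x - l)"
        using nz[of u] by eventually_elim (simp add: g_def)
      have "(\<lambda>x. g x - l) \<in> borel_measurable borel" by measurable
      from Phi_Phi[OF this dh measurable_ident_sets[OF refl] L2_dom_ident]
      have "N ?w = Phi (\<lambda>x. x * (g x - l)) u" unfolding Phi_ident .
      also have "\<dots> = Phi (\<lambda>x. k) u"
        by (rule Phi_cong_AE(1)[OF _ _ L2_dom_const ae]) auto
      also have "\<dots> = k *\<^sub>R u" by (rule Phi_const)
      finally have "u = (1 / k) *\<^sub>R N ?w" using k by simp
      then show ?thesis using subspace_scale[OF AD(1) N(1)] by metis
    qed
  qed
  then have "op_eq A (spectral_integral spectral_projection g)"
    by (simp add: op_eq_def spectral_integral_eq)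
  then have "op_eq A (spectral_integral (\<lambda>B. spectral_projection (g -` B)) (\<lambda>x. x))"
    by (simp add: spectral_integral_vimage[OF projection_valued_measure_spectral_projection g])
  then show ?thesis
    unfolding is_spectral_measure_def using projection_valued_measure_vimage[OF projection_valued_measure_spectral_projection g] by blast
qed

section \<open>The semigroup generated by a semibounded operator\<close>

lemma exp_minus_linear_bound: "\<bar>exp y - 1 - y\<bar> \<le> y\<^sup>2 * exp \<bar>y\<bar>" for y :: real
proof -
  have up: "exp y - 1 \<le> y * exp y"
    using mult_left_mono[OF exp_ge_add_one_self[of "- y"], of "exp y"] by (simp add: exp_minus field_simps)
  have lo: "0 \<le> exp y - 1 - y" using exp_ge_add_one_self[of y] by linarith
  have "exp y - 1 - y \<le> y * (exp y - 1)" using up by (simp add: algebra_simps)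
  also have "\<dots> \<le> y\<^sup>2 * exp \<bar>y\<bar>"
  proof (cases "0 \<le> y")
    case True
    then have "y * (exp y - 1) \<le> y * (y * exp y)" using up by (intro mult_left_mono)
    then show ?thesis using True by (simp add: power2_eq_square)
  next
    case False
    have "y * (exp y - 1) \<le> y * y" using False lo by (intro mult_left_mono_neg) auto
    also have "\<dots> \<le> (y * y) * exp \<bar>y\<bar>" using mult_left_mono[of 1 "exp \<bar>y\<bar>" "y * y"] by simp
    finally show ?thesis by (simp add: power2_eq_square)
  qed
  finally show ?thesis using lo by simp
qed

lemma exp_remainder_bound:
  fixes s t x :: real
  shows "\<bar>exp (- t * x) - exp (- s * x) + (t - s) * (x * exp (- s * x))\<bar>
    \<le> (t - s)\<^sup>2 * (x\<^sup>2 * exp (- s * x + \<bar>t - s\<bar> * \<bar>x\<bar>))"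
proof -
  define z where "z = - ((t - s) * x)"
  have tz: "- t * x = - s * x + z" by (simp add: z_def left_diff_distrib)
  have "exp (- t * x) - exp (- s * x) + (t - s) * (x * exp (- s * x)) = exp (- s * x) * (exp z - 1 - z)"
    unfolding tz exp_add by (simp add: z_def algebra_simps)
  then have "\<bar>exp (- t * x) - exp (- s * x) + (t - s) * (x * exp (- s * x))\<bar> = exp (- s * x) * \<bar>exp z - 1 - z\<bar>"
    by (simp only: abs_mult abs_exp_cancel)
  also have "\<dots> \<le> exp (- s * x) * (z\<^sup>2 * exp \<bar>z\<bar>)"
    by (intro mult_left_mono exp_minus_linear_bound) simp
  also have "\<dots> = (t - s)\<^sup>2 * (x\<^sup>2 * exp (- s * x + \<bar>z\<bar>))"
    unfolding exp_add by (simp add: z_def power_mult_distrib)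
  also have "\<bar>z\<bar> = \<bar>t - s\<bar> * \<bar>x\<bar>" by (simp only: z_def abs_minus_cancel abs_mult)
  finally show ?thesis .
qed

text \<open>
  Provides an integrable majorant for the second derivative of \<open>s \<mapsto> exp (- s * x)\<close> on \<open>x \<ge> l\<close>, uniform for
  parameters within distance \<open>s / 2\<close> of \<open>s\<close>.
\<close>

lemma exp_decay_bound:
  fixes l s :: real
  assumes s: "0 < s"
  obtains C where "\<And>x. l \<le> x \<Longrightarrow> x\<^sup>2 * exp (- s * x + s / 2 * \<bar>x\<bar>) \<le> C" "0 \<le> C"
proof -
  \<comment> \<open>For \<open>x \<ge> 0\<close> use \<open>y\<^sup>2 / 2 \<le> exp y\<close> with \<open>y = s * x / 2\<close>; the second term covers \<open>l \<le> x < 0\<close>.\<close>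
  define C where "C = 8 / s\<^sup>2 + l\<^sup>2 * exp (2 * s * \<bar>l\<bar>)"
  have "x\<^sup>2 * exp (- s * x + s / 2 * \<bar>x\<bar>) \<le> C" if x: "l \<le> x" for x
  proof (cases "0 \<le> x")
    case True
    define y where "y = s * x / 2"
    have y: "0 \<le> y" using True s by (simp add: y_def)
    have "y\<^sup>2 / 2 \<le> exp y" using exp_lower_Taylor_quadratic[OF y] y by simp
    then have "y\<^sup>2 * exp (- y) \<le> 2" by (simp add: exp_minus field_simps)
    moreover have "x\<^sup>2 = 4 * y\<^sup>2 / s\<^sup>2" using s by (simp add: y_def power2_eq_square field_simps)
    moreover have "- s * x + s / 2 * \<bar>x\<bar> = - y" using True by (simp add: y_def)
    ultimately have "x\<^sup>2 * exp (- s * x + s / 2 * \<bar>x\<bar>) = 4 / s\<^sup>2 * (y\<^sup>2 * exp (- y))" "y\<^sup>2 * exp (- y) \<le> 2" by auto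
    then have "x\<^sup>2 * exp (- s * x + s / 2 * \<bar>x\<bar>) \<le> 4 / s\<^sup>2 * 2" using mult_left_mono[of "y\<^sup>2 * exp (- y)" 2 "4 / s\<^sup>2"] by simp
    then show ?thesis by (simp add: C_def add_increasing2)
  next
    case False
    have lx: "\<bar>x\<bar> \<le> \<bar>l\<bar>" using False x by simp
    have "s * \<bar>x\<bar> \<le> s * \<bar>l\<bar>" using lx s by (intro mult_left_mono) auto
    moreover have "- s * x + s / 2 * \<bar>x\<bar> = 3 / 2 * (s * \<bar>x\<bar>)" using False by simp
    moreover have "0 \<le> s * \<bar>l\<bar>" using s by simp
    ultimately have "- s * x + s / 2 * \<bar>x\<bar> \<le> 2 * s * \<bar>l\<bar>" by linarith
    moreover have "x\<^sup>2 \<le> l\<^sup>2" using power_mono[OF lx, of 2] by simp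
    ultimately have "x\<^sup>2 * exp (- s * x + s / 2 * \<bar>x\<bar>) \<le> l\<^sup>2 * exp (2 * s * \<bar>l\<bar>)"
      by (intro mult_mono) auto
    then show ?thesis by (simp add: C_def add_increasing)
  qed
  moreover have "0 \<le> C" by (simp add: C_def)
  ultimately show ?thesis using that by blast
qed

locale spectral_operator = pvm E for E :: "real set \<Rightarrow> 'a::{real_inner, banach} \<Rightarrow> 'a" +
  fixes A :: "'a unbounded_operator"
  assumes op: "op_eq A (spectral_integral E (\<lambda>x. x))"
begin

lemma Dom_A: "Dom A = L2_dom (\<lambda>x. x)" and app_A: "u \<in> Dom A \<Longrightarrow> app A u = Phi (\<lambda>x. x) u"
  using op by (auto simp: op_eq_def spectral_integral_eq)

lemma inner_A: "u \<in> Dom A \<Longrightarrow> inner u (app A u) = (\<integral>x. x \<partial>M u)"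
  by (simp add: app_A Dom_A inner_Phi_self)

lemma integrable_id: "u \<in> Dom A \<Longrightarrow> integrable (M u) (\<lambda>x. x)"
  unfolding Dom_A by (rule integrable_M) auto

lemma integrable_M_const [simp]: "integrable (M u) (\<lambda>x. c::real)"
  by (rule integrable_M[OF _ L2_dom_const]) simp

lemma measure_M_UNIV [simp]: "measure (M u) UNIV = (norm u)\<^sup>2"
  by (simp add: measure_M E_UNIV)

lemma integral_M_const: "(\<integral>x. c \<partial>M u) = c * (norm u)\<^sup>2" for c :: real
  by simp

text \<open>
  A vector \<open>w\<close> in the range of \<open>E {- n..<l}\<close> satisfies \<open>\<langle>w, A w\<rangle> < l \<parallel>w\<parallel>\<^sup>2\<close> unless it is zero.
\<close>

lemma AE_ge_if_form_bound:
  assumes bound: "\<And>u. u \<in> Dom A \<Longrightarrow> l * (norm u)\<^sup>2 \<le> inner u (app A u)"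
  shows "AE x in M u. l \<le> x"
proof -
  let ?B = "\<lambda>n::nat. {- real n..<l}"
  have zero: "E (?B n) u = 0" for n
  proof -
    let ?w = "E (?B n) u"
    have "?w \<in> L2_dom (\<lambda>x. x)" by (rule E_in_L2_dom[where c = "real n + \<bar>l\<bar>"]) auto
    then have w: "?w \<in> Dom A" by (simp add: Dom_A)
    have ae: "AE x in M ?w. x \<in> ?B n" by (rule AE_E) simp
    have "(\<integral>x. l - x \<partial>M ?w) = l * (norm ?w)\<^sup>2 - inner ?w (app A ?w)"
      using integrable_id[OF w] by (simp add: inner_A[OF w])
    also have "\<dots> \<le> 0" using bound[OF w] by simp
    finally have "(\<integral>x. l - x \<partial>M ?w) \<le> 0" .
    moreover have nn: "AE x in M ?w. 0 \<le> l - x" using ae by eventually_elim auto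
    ultimately have "(\<integral>x. l - x \<partial>M ?w) = 0"
      using integral_nonneg_AE[OF nn] by simp
    then have "AE x in M ?w. l - x = 0"
      using integral_nonneg_eq_0_iff_AE[OF _ nn] integrable_id[OF w] by simp
    then have "AE x in M ?w. False" using ae by eventually_elim auto
    then have "emeasure (M ?w) UNIV = 0" by (simp add: AE_iff_null null_sets_def)
    then show ?thesis by (simp add: emeasure_M E_UNIV)
  qed
  have "AE x in M u. x \<notin> ?B n" for n
    by (rule AE_not_in) (simp add: null_sets_def emeasure_M zero)
  then have "AE x in M u. \<forall>n. x \<notin> ?B n" unfolding AE_all_countable by blast
  then show ?thesis
  proof eventually_elim
    case (elim x)
    obtain n where "- x \<le> real n" using real_arch_simple by blast
    then show ?case using elim[rule_format, of n] by auto
  qed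
qed

end

locale semibounded_spectral_operator = spectral_operator +
  fixes l :: real
  assumes AE_ge: "AE x in M u. l \<le> x"
begin

abbreviation semigroup :: "real \<Rightarrow> 'a \<Rightarrow> 'a" where
  "semigroup s \<equiv> Phi (\<lambda>x. exp (- s * x))"

lemma exp_le: "0 \<le> s \<Longrightarrow> l \<le> x \<Longrightarrow> exp (- s * x) \<le> exp (s * \<bar>l\<bar>)" for s x :: real
proof -
  assume "0 \<le> s" "l \<le> x"
  then have "s * (- x) \<le> s * \<bar>l\<bar>" by (intro mult_left_mono) auto
  then show ?thesis by simp
qed

lemma AE_exp_le: "0 \<le> s \<Longrightarrow> AE x in M u. \<bar>exp (- s * x)\<bar> \<le> exp (s * \<bar>l\<bar>)"
  using AE_ge[of u] by eventually_elim (use exp_le in simp)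

lemma L2_dom_exp: "0 \<le> s \<Longrightarrow> u \<in> L2_dom (\<lambda>x. exp (- s * x))"
  by (rule L2_dom_bounded[OF _ AE_exp_le]) auto

lemma bounded_operator_semigroup:
  assumes s: "0 \<le> s"
  shows "bounded_operator (spectral_integral E (\<lambda>x. exp (- s * x)))"
  unfolding bounded_operator_def spectral_integral_eq unbounded_operator.sel
proof
  show "L2_dom (\<lambda>x. exp (- s * x)) = UNIV" using L2_dom_exp[OF s] by blast
  show "bounded_linear (semigroup s)"
  proof (rule bounded_linear_intro)
    show "semigroup s (u + v) = semigroup s u + semigroup s v" for u v
      by (rule Phi_add[OF _ L2_dom_exp[OF s] L2_dom_exp[OF s]]) simp
    show "semigroup s (c *\<^sub>R u) = c *\<^sub>R semigroup s u" for c u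
      by (rule Phi_scale[OF _ L2_dom_exp[OF s]]) simp
    fix u
    have "(norm (semigroup s u))\<^sup>2 = (\<integral>x. (exp (- s * x))\<^sup>2 \<partial>M u)"
      by (rule Phi_norm[OF _ L2_dom_exp[OF s]]) simp
    also have "\<dots> \<le> (\<integral>x. (exp (s * \<bar>l\<bar>))\<^sup>2 \<partial>M u)"
    proof (rule integral_mono_AE)
      show "integrable (M u) (\<lambda>x. (exp (- s * x))\<^sup>2)" using L2_dom_exp[OF s, of u] by (simp add: L2_dom_def)
      show "AE x in M u. (exp (- s * x))\<^sup>2 \<le> (exp (s * \<bar>l\<bar>))\<^sup>2"
        using AE_exp_le[OF s, of u] by eventually_elim (intro power_mono, auto)
    qed simp
    also have "\<dots> = (norm u * exp (s * \<bar>l\<bar>))\<^sup>2" by (simp add: power_mult_distrib)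
    finally show "norm (semigroup s u) \<le> norm u * exp (s * \<bar>l\<bar>)"
      by (rule power2_le_imp_le) simp
  qed
qed

lemma exp_square: "(exp (- (s * x)))\<^sup>2 = exp (- (2 * s * x))" for s x :: real
  by (simp add: power2_eq_square mult_exp_exp)

text \<open>
  The Laplace transform of the spectral measure. Inner products and norms along the semigroup are
  combinations of such transforms, which reduces their regularity to that of scalar integrals.
\<close>

definition Laplace :: "'a \<Rightarrow> real \<Rightarrow> real" where
  "Laplace u s = (\<integral>x. exp (- s * x) \<partial>M u)"

lemma inner_semigroup: "0 \<le> s \<Longrightarrow> inner v (semigroup s u) = (Laplace (v + u) s - Laplace (v - u) s) / 4"
  using Phi_inner[OF _ L2_dom_exp L2_dom_exp, of s v u] by (simp add: polar_def Laplace_def)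

lemma norm_semigroup: "0 \<le> s \<Longrightarrow> (norm (semigroup s u))\<^sup>2 = Laplace u (2 * s)"
  using Phi_norm[OF _ L2_dom_exp, of s u] by (simp add: Laplace_def exp_square)

lemma AE_x_exp_le:
  assumes s: "0 < s"
  obtains C where "\<And>u. AE x in M u. \<bar>x * exp (- s * x)\<bar> \<le> C"
proof -
  obtain C where C: "\<And>x. l \<le> x \<Longrightarrow> x\<^sup>2 * exp (- s * x + s / 2 * \<bar>x\<bar>) \<le> C"
    using exp_decay_bound[OF s] by blast
  have "AE x in M u. \<bar>x * exp (- s * x)\<bar> \<le> exp (s * \<bar>l\<bar>) + C" for u
    using AE_ge[of u]
  proof eventually_elim
    case (elim x)
    have "\<bar>x\<bar> \<le> 1 + x\<^sup>2" using zero_le_power2[of "\<bar>x\<bar> - 1"] by (auto simp: power2_eq_square algebra_simps)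
    then have "\<bar>x\<bar> * exp (- s * x) \<le> (1 + x\<^sup>2) * exp (- s * x)" by (intro mult_right_mono) auto
    also have "\<dots> = exp (- s * x) + x\<^sup>2 * exp (- s * x)" by (simp add: algebra_simps)
    also have "x\<^sup>2 * exp (- s * x) \<le> x\<^sup>2 * exp (- s * x + s / 2 * \<bar>x\<bar>)"
      using s by (intro mult_left_mono) auto
    also have "\<dots> \<le> C" by (rule C[OF elim])
    also have "exp (- s * x) \<le> exp (s * \<bar>l\<bar>)" using exp_le[of s x] s elim by simp
    finally show ?case by (simp add: abs_mult)
  qed
  then show ?thesis using that by blast
qed

lemma L2_dom_x_exp: "0 < s \<Longrightarrow> u \<in> L2_dom (\<lambda>x. x * exp (- s * x))"
  by (rule AE_x_exp_le[of s]) (simp, rule L2_dom_bounded, auto)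

text \<open>
  The semigroup is smoothing: \<open>x * exp (- s * x)\<close> is bounded on \<open>x \<ge> l\<close> for \<open>s > 0\<close>.
\<close>

lemma semigroup_in_Dom:
  assumes s: "0 < s"
  shows "semigroup s u \<in> Dom A"
    and "app A (semigroup s u) = Phi (\<lambda>x. x * exp (- s * x)) u"
proof -
  have m: "(\<lambda>x::real. exp (- s * x)) \<in> borel_measurable borel" "(\<lambda>x::real. x) \<in> borel_measurable borel" by simp_all
  have d: "u \<in> L2_dom (\<lambda>x. exp (- s * x))" using L2_dom_exp s by simp
  show 1: "semigroup s u \<in> Dom A"
    unfolding Dom_A using L2_dom_Phi_iff[OF m(1) d m(2)] L2_dom_x_exp[OF s] by blast
  show "app A (semigroup s u) = Phi (\<lambda>x. x * exp (- s * x)) u"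
    unfolding app_A[OF 1] by (rule Phi_Phi[OF m(1) d m(2) 1[unfolded Dom_A]])
qed

lemma DERIV_Laplace:
  assumes s: "0 < s"
  shows "(Laplace u has_real_derivative - (\<integral>x. x * exp (- s * x) \<partial>M u)) (at s)"
proof -
  obtain C where C: "\<And>x. l \<le> x \<Longrightarrow> x\<^sup>2 * exp (- s * x + s / 2 * \<bar>x\<bar>) \<le> C" and "0 \<le> C"
    using exp_decay_bound[OF s] by blast
  let ?I = "\<integral>x. x * exp (- s * x) \<partial>M u"
  have int1: "integrable (M u) (\<lambda>x. exp (- t * x))" if "0 \<le> t" for t
    by (rule integrable_M[OF _ L2_dom_exp[OF that]]) simp
  have int2: "integrable (M u) (\<lambda>x. x * exp (- s * x))"
    by (rule integrable_M[OF _ L2_dom_x_exp[OF s]]) simp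
  have lin: "(\<integral>x. f x - g x + c * h x \<partial>M u) = (\<integral>x. f x \<partial>M u) - (\<integral>x. g x \<partial>M u) + c * (\<integral>x. h x \<partial>M u)"
    if "integrable (M u) f" "integrable (M u) g" "integrable (M u) h" for f g h :: "real \<Rightarrow> real" and c
    using that by simp
  have bound: "\<bar>Laplace u t - Laplace u s + (t - s) * ?I\<bar> \<le> (t - s)\<^sup>2 * C * (norm u)\<^sup>2" if t: "\<bar>t - s\<bar> \<le> s / 2" for t
  proof -
    have t0: "0 \<le> t" using t s by linarith
    let ?r = "\<lambda>x. exp (- t * x) - exp (- s * x) + (t - s) * (x * exp (- s * x))"
    note ints = int1[OF t0] int1[OF less_imp_le[OF s]] int2
    have i: "integrable (M u) ?r"
      by (intro Bochner_Integration.integrable_add Bochner_Integration.integrable_diff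
          integrable_mult_right ints)
    have "Laplace u t - Laplace u s + (t - s) * ?I = (\<integral>x. ?r x \<partial>M u)"
      unfolding Laplace_def by (rule lin[OF ints, symmetric])
    then have "\<bar>Laplace u t - Laplace u s + (t - s) * ?I\<bar> \<le> (\<integral>x. \<bar>?r x\<bar> \<partial>M u)"
      by (simp only: integral_abs_bound)
    also have "\<dots> \<le> (\<integral>x. (t - s)\<^sup>2 * C \<partial>M u)"
    proof (rule integral_mono_AE)
      show "integrable (M u) (\<lambda>x. \<bar>?r x\<bar>)" by (rule integrable_abs[OF i])
      show "integrable (M u) (\<lambda>x. (t - s)\<^sup>2 * C)" by (rule integrable_M_const)
      have "\<bar>?r x\<bar> \<le> (t - s)\<^sup>2 * C" if x: "l \<le> x" for x
      proof -
        have "\<bar>?r x\<bar> \<le> (t - s)\<^sup>2 * (x\<^sup>2 * exp (- s * x + \<bar>t - s\<bar> * \<bar>x\<bar>))"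
          by (rule exp_remainder_bound)
        also have "\<dots> \<le> (t - s)\<^sup>2 * (x\<^sup>2 * exp (- s * x + s / 2 * \<bar>x\<bar>))"
          by (intro mult_left_mono zero_le_power2 iffD2[OF exp_le_cancel_iff] add_left_mono mult_right_mono t abs_ge_zero)
        also have "\<dots> \<le> (t - s)\<^sup>2 * C" by (intro mult_left_mono zero_le_power2 C x)
        finally show ?thesis .
      qed
      with AE_ge[of u] show "AE x in M u. \<bar>?r x\<bar> \<le> (t - s)\<^sup>2 * C" by (rule eventually_mono)
    qed
    finally show ?thesis unfolding integral_M_const .
  qed
  have "((\<lambda>t. (Laplace u t - Laplace u s) / (t - s) - (- ?I)) \<longlongrightarrow> 0) (at s)"
  proof (rule Lim_null_comparison)
    have "\<forall>\<^sub>F t in at s. \<bar>t - s\<bar> < s / 2 \<and> t \<noteq> s"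
      unfolding eventually_at using s by (intro exI[of _ "s / 2"]) (simp add: dist_real_def)
    then show "\<forall>\<^sub>F t in at s. norm ((Laplace u t - Laplace u s) / (t - s) - (- ?I)) \<le> \<bar>t - s\<bar> * (C * (norm u)\<^sup>2)"
    proof eventually_elim
      case (elim t)
      have "(Laplace u t - Laplace u s) / (t - s) - (- ?I) = (Laplace u t - Laplace u s + (t - s) * ?I) / (t - s)"
        using elim by (simp add: add_divide_distrib)
      then have "norm ((Laplace u t - Laplace u s) / (t - s) - (- ?I)) = \<bar>Laplace u t - Laplace u s + (t - s) * ?I\<bar> / \<bar>t - s\<bar>"
        by (simp only: real_norm_def abs_divide)
      also have "\<dots> \<le> (t - s)\<^sup>2 * C * (norm u)\<^sup>2 / \<bar>t - s\<bar>"
        using bound[of t] elim by (intro divide_right_mono) auto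
      also have "\<dots> = \<bar>t - s\<bar> * (C * (norm u)\<^sup>2)"
      proof -
        have cancel: "d * d * C' * n / d = d * (C' * n)" if "d \<noteq> 0" for d C' n :: real using that by simp
        have sq: "(t - s)\<^sup>2 = \<bar>t - s\<bar> * \<bar>t - s\<bar>" by (simp add: power2_eq_square)
        show ?thesis unfolding sq by (rule cancel) (use elim in simp)
      qed
      finally show ?case .
    qed
    have "((\<lambda>t. \<bar>t - s\<bar> * (C * (norm u)\<^sup>2)) \<longlongrightarrow> \<bar>s - s\<bar> * (C * (norm u)\<^sup>2)) (at s)"
      by (intro tendsto_intros)
    then show "((\<lambda>t. \<bar>t - s\<bar> * (C * (norm u)\<^sup>2)) \<longlongrightarrow> 0) (at s)" by simp
  qed
  then show ?thesis
    unfolding has_field_derivative_iff by (rule LIM_zero_cancel)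
qed

lemma continuous_on_Laplace: "continuous_on {0..} (Laplace u)"
  unfolding continuous_on_sequentially
proof (intro allI impI ballI, elim conjE)
  fix X :: "nat \<Rightarrow> real" and s assume s: "s \<in> {0..}" and X: "\<forall>n. X n \<in> {0..}" "X \<longlonglongrightarrow> s"
  obtain K where K: "\<And>n. \<bar>X n\<bar> \<le> K"
    using convergent_imp_Bseq[of X] X(2) by (auto simp: convergent_def Bseq_def)
  have "(\<lambda>n. \<integral>x. exp (- X n * x) \<partial>M u) \<longlonglongrightarrow> (\<integral>x. exp (- s * x) \<partial>M u)"
  proof (rule integral_dominated_convergence[where w = "\<lambda>x. exp (K * \<bar>l\<bar>)"])
    show "AE x in M u. (\<lambda>n. exp (- X n * x)) \<longlonglongrightarrow> exp (- s * x)"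
      by (intro AE_I2 tendsto_intros X)
    show "AE x in M u. norm (exp (- X n * x)) \<le> exp (K * \<bar>l\<bar>)" for n
      using AE_ge[of u]
    proof eventually_elim
      case (elim x)
      have "exp (- X n * x) \<le> exp (X n * \<bar>l\<bar>)" by (rule exp_le) (use X(1) elim in auto)
      also have "\<dots> \<le> exp (K * \<bar>l\<bar>)" using K[of n] by (simp add: mult_right_mono)
      finally show ?case by simp
    qed
  qed auto
  then show "(Laplace u \<circ> X) \<longlonglongrightarrow> Laplace u s" by (simp add: Laplace_def comp_def)
qed

lemma semigroup_0: "semigroup 0 u = u"
  using Phi_const[of 1 u] by simp

lemma semigroup_nonzero:
  assumes s: "0 \<le> s" and u: "u \<noteq> 0"
  shows "semigroup s u \<noteq> 0"
proof
  assume "semigroup s u = 0"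
  then have "Laplace u (2 * s) = 0" using norm_semigroup[OF s, of u] by simp
  moreover have "integrable (M u) (\<lambda>x. exp (- (2 * s) * x))"
    by (rule integrable_M[OF _ L2_dom_exp]) (use s in auto)
  ultimately have "AE x in M u. exp (- (2 * s) * x) = 0"
    unfolding Laplace_def by (subst (asm) integral_nonneg_eq_0_iff_AE) auto
  then have "emeasure (M u) UNIV = 0" by (simp add: AE_iff_null null_sets_def)
  then show False using u by (simp add: emeasure_M E_UNIV)
qed

lemma DERIV_inner_semigroup:
  assumes s: "0 < s" and v: "v \<in> Dom A" and sym: "symmetric_operator A"
  shows "((\<lambda>s. inner v (semigroup s u)) has_real_derivative - inner (app A v) (semigroup s u)) (at s)"
proof (rule has_field_derivative_transform_within_open[where S = "{0<..}"])
  have "- inner (app A v) (semigroup s u) = - inner v (Phi (\<lambda>x. x * exp (- s * x)) u)"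
    unfolding symmetric_operatorD(5)[OF sym v semigroup_in_Dom(1)[OF s]] semigroup_in_Dom(2)[OF s] ..
  also have "\<dots> = - polar (\<lambda>x. x * exp (- s * x)) v u"
    using Phi_inner[OF _ L2_dom_x_exp[OF s] L2_dom_x_exp[OF s]] by simp
  finally have "- inner (app A v) (semigroup s u)
      = (- (\<integral>x. x * exp (- s * x) \<partial>M (v + u)) - - (\<integral>x. x * exp (- s * x) \<partial>M (v - u))) / 4"
    by (simp add: polar_def)
  then show "((\<lambda>s. (Laplace (v + u) s - Laplace (v - u) s) / 4)
      has_real_derivative - inner (app A v) (semigroup s u)) (at s)"
    using DERIV_cdivide[OF DERIV_diff[OF DERIV_Laplace[OF s] DERIV_Laplace[OF s]]] by metis
qed (use s inner_semigroup in auto)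

lemma DERIV_norm_semigroup:
  assumes s: "0 < s"
  shows "((\<lambda>s. (norm (semigroup s u))\<^sup>2) has_real_derivative
    - 2 * inner (semigroup s u) (app A (semigroup s u))) (at s)"
proof (rule has_field_derivative_transform_within_open[where S = "{0<..}"])
  have "inner (semigroup s u) (app A (semigroup s u)) = (\<integral>x. x \<partial>M (semigroup s u))"
    by (rule inner_A[OF semigroup_in_Dom(1)[OF s]])
  also have "\<dots> = (\<integral>x. (exp (- s * x))\<^sup>2 * x \<partial>M u)"
    by (rule integral_M_Phi[OF _ L2_dom_exp[OF less_imp_le[OF s]]]) simp_all
  also have "\<dots> = (\<integral>x. x * exp (- (2 * s) * x) \<partial>M u)"
    by (simp add: exp_square mult.commute[of "exp _"])
  finally have eq: "inner (semigroup s u) (app A (semigroup s u)) = (\<integral>x. x * exp (- (2 * s) * x) \<partial>M u)" .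
  have "((\<lambda>s. Laplace u (2 * s)) has_real_derivative - (\<integral>x. x * exp (- (2 * s) * x) \<partial>M u) * 2) (at s)"
    by (rule DERIV_chain2[OF DERIV_Laplace]) (use s in \<open>auto intro!: derivative_eq_intros\<close>)
  then show "((\<lambda>s. Laplace u (2 * s)) has_real_derivative
    - 2 * inner (semigroup s u) (app A (semigroup s u))) (at s)"
    unfolding eq by (simp add: mult.commute)
qed (use s norm_semigroup in auto)

end

section \<open>Positivity improvement for the circular cone\<close>

lemma orthogonal_decomposition:
  fixes e :: "'a::real_inner"
  assumes "norm e = 1"
  shows "inner e (x - inner e x *\<^sub>R e) = 0"
    and "(norm x)\<^sup>2 = (inner e x)\<^sup>2 + (norm (x - inner e x *\<^sub>R e))\<^sup>2"
proof -
  have "inner e e = 1" using assms by (simp add: norm_eq_sqrt_inner)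
  then show "inner e (x - inner e x *\<^sub>R e) = 0" "(norm x)\<^sup>2 = (inner e x)\<^sup>2 + (norm (x - inner e x *\<^sub>R e))\<^sup>2"
    unfolding power2_norm_eq_inner
    by (simp_all add: inner_diff_left inner_diff_right inner_commute[of x e] power2_eq_square del: inner_eq_zero_iff)
qed

lemma axis_cone_iff: "u \<in> axis_cone e \<longleftrightarrow> 0 \<le> inner e u \<and> (norm u)\<^sup>2 \<le> 2 * (inner e u)\<^sup>2"
proof -
  have "u \<in> axis_cone e \<longleftrightarrow> norm u \<le> sqrt 2 * inner e u"
    by (simp add: axis_cone_def divide_le_eq mult.commute)
  also have "\<dots> \<longleftrightarrow> 0 \<le> inner e u \<and> (norm u)\<^sup>2 \<le> 2 * (inner e u)\<^sup>2"
  proof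
    assume le: "norm u \<le> sqrt 2 * inner e u"
    then have "0 \<le> sqrt 2 * inner e u" using norm_ge_zero order_trans by blast
    moreover have "(norm u)\<^sup>2 \<le> (sqrt 2 * inner e u)\<^sup>2" by (rule power_mono[OF le norm_ge_zero])
    ultimately show "0 \<le> inner e u \<and> (norm u)\<^sup>2 \<le> 2 * (inner e u)\<^sup>2"
      by (simp add: zero_le_mult_iff power_mult_distrib)
  next
    assume "0 \<le> inner e u \<and> (norm u)\<^sup>2 \<le> 2 * (inner e u)\<^sup>2"
    then have "(norm u)\<^sup>2 \<le> (sqrt 2 * inner e u)\<^sup>2" "0 \<le> sqrt 2 * inner e u"
      by (simp_all add: power_mult_distrib)
    then show "norm u \<le> sqrt 2 * inner e u" by (rule power2_le_imp_le)
  qed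
  finally show ?thesis .
qed

text \<open>
  The cone consists of the vectors at angle at most \<open>\<pi>/4\<close> from \<open>e\<close>. If \<open>w\<close> is in its interior and \<open>v\<close> in the
  cone, the angle between them is less than \<open>\<pi>/2\<close>.
\<close>

lemma strictly_positive_axis_coneI:
  fixes e w :: "'a::real_inner"
  assumes e: "norm e = 1" and pos: "0 < inner e w" and K: "(norm w)\<^sup>2 < 2 * (inner e w)\<^sup>2"
  shows "w \<in> strictly_positive (axis_cone e)"
  unfolding strictly_positive_def
proof (intro CollectI conjI ballI)
  have "w \<noteq> 0" using pos by auto
  then show "w \<in> axis_cone e - {0}" using pos K by (simp add: axis_cone_iff)
  fix v assume v: "v \<in> axis_cone e - {0}"
  define p q where "p = inner e w" and "q = inner e v"
  define y z where "y = w - p *\<^sub>R e" and "z = v - q *\<^sub>R e"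
  have ee: "inner e e = 1" using e by (simp add: norm_eq_sqrt_inner)
  have "(norm y)\<^sup>2 < p\<^sup>2" using orthogonal_decomposition(2)[OF e, of w] K by (simp add: p_def y_def)
  then have yp: "norm y < p" using pos by (intro power_less_imp_less_base[of "norm y" 2 p]) (auto simp: p_def)
  have v2: "0 \<le> q" "(norm v)\<^sup>2 \<le> 2 * q\<^sup>2" using v by (auto simp: axis_cone_iff q_def)
  then have "(norm z)\<^sup>2 \<le> q\<^sup>2" using orthogonal_decomposition(2)[OF e, of v] by (simp add: q_def z_def)
  then have zq: "norm z \<le> q" using v2(1) by (rule power2_le_imp_le)
  have "q \<noteq> 0" using v v2 by auto
  then have "0 < q" using v2(1) by simp
  have "inner v w = q * p + inner z y"
    unfolding y_def z_def p_def q_def using ee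
    by (simp add: inner_diff_left inner_diff_right inner_commute[of v e])
  moreover have "\<bar>inner z y\<bar> \<le> norm z * norm y" by (rule Cauchy_Schwarz_ineq2)
  moreover have "norm z * norm y \<le> q * norm y" using zq by (intro mult_right_mono) auto
  moreover have "q * norm y < q * p" using yp \<open>0 < q\<close> by simp
  ultimately show "0 < inner v w" by linarith
qed

context semibounded_spectral_operator
begin

text \<open>
  The monotone quantity is \<open>H t = exp (2 b t) (p\<^sup>2 - \<parallel>y\<parallel>\<^sup>2)\<close> for \<open>w = p e + y\<close>. By the mean value theorem it can
  vanish at a positive time only if \<open>y\<close> vanishes at an earlier one, but there \<open>H = exp (2 b t) \<parallel>w\<parallel>\<^sup>2 > 0\<close>.
  As \<open>H > 0\<close> keeps \<open>p\<close> away from zero, \<open>p\<close> stays positive.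
\<close>

theorem positivity_improving_semigroup:
  assumes sym: "symmetric_operator A"
    and e: "e \<in> Dom A" "norm e = 1" and g: "0 < g"
    and gap: "\<And>y. y \<in> Dom A \<Longrightarrow> inner e y = 0 \<Longrightarrow>
      (inner e (app A e) + g) * (norm y)\<^sup>2 \<le> inner y (app A y)"
    and s: "0 < s"
  shows "positivity_improving (axis_cone e) (spectral_integral E (\<lambda>x. exp (- s * x)))"
  unfolding positivity_improving_def
proof (intro conjI image_subsetI)
  show "bounded_operator (spectral_integral E (\<lambda>x. exp (- s * x)))"
    using bounded_operator_semigroup s by simp
  fix u assume u: "u \<in> axis_cone e - {0}"
  note AD = symmetric_operatorD[OF sym]
  define w where "w t = semigroup t u" for t
  define p where "p t = inner e (w t)" for t
  define y where "y t = w t - p t *\<^sub>R e" for t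
  define b where "b = inner e (app A e)"
  \<comment> \<open>\<open>K > 0\<close> describes the interior of the cone and its negative; \<open>H'\<close> will be the derivative of \<open>H\<close>.\<close>
  define K where "K t = 2 * (p t)\<^sup>2 - (norm (w t))\<^sup>2" for t
  define H where "H t = exp (2 * b * t) * K t" for t
  define H' where "H' t = exp (2 * b * t) * (2 * b * K t
      + (- 4 * p t * inner (app A e) (w t) + 2 * inner (w t) (app A (w t))))" for t
  have norm_w: "(norm (w t))\<^sup>2 = (p t)\<^sup>2 + (norm (y t))\<^sup>2" for t
    using orthogonal_decomposition(2)[OF e(2), of "w t"] by (simp add: p_def y_def)
  have w_nz: "w t \<noteq> 0" if "0 \<le> t" for t
    unfolding w_def using semigroup_nonzero that u by blast
  have wD: "w t \<in> Dom A" if "0 < t" for t unfolding w_def by (rule semigroup_in_Dom(1)[OF that])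
  \<comment> \<open>The cross terms between \<open>e\<close> and its complement cancel in the derivative of \<open>K\<close>.\<close>
  have H'_ge: "2 * g * exp (2 * b * t) * (norm (y t))\<^sup>2 \<le> H' t" if t: "0 < t" for t
  proof -
    have yD: "y t \<in> Dom A"
      unfolding y_def by (intro subspace_diff subspace_scale AD(1) wD t e)
    have "app A (w t) = app A (y t) + p t *\<^sub>R app A e"
      using AD(2)[OF yD subspace_scale[OF AD(1) e(1)], of "p t"] AD(4)[OF e(1)] by (simp add: y_def)
    moreover have wy: "w t = y t + p t *\<^sub>R e" by (simp add: y_def)
    moreover have "inner (y t) (app A e) = inner (app A e) (y t)" "inner e (app A (y t)) = inner (app A e) (y t)"
      using AD(5)[OF e(1) yD] by (simp_all add: inner_commute)
    ultimately have 1: "inner (w t) (app A (w t)) = inner (y t) (app A (y t)) + 2 * p t * inner (app A e) (y t) + (p t)\<^sup>2 * b"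
      by (simp add: inner_add_left inner_add_right b_def power2_eq_square distrib_left)
    have 2: "inner (app A e) (w t) = inner (app A e) (y t) + p t * b"
      by (subst wy) (simp add: inner_add_right b_def inner_commute)
    have "inner e (y t) = 0" using orthogonal_decomposition(1)[OF e(2), of "w t"] by (simp add: y_def p_def)
    from gap[OF yD this] have 3: "(b + g) * (norm (y t))\<^sup>2 \<le> inner (y t) (app A (y t))" by (simp add: b_def)
    have 4: "K t = (p t)\<^sup>2 - (norm (y t))\<^sup>2" by (simp add: K_def norm_w)
    have "2 * b * K t + (- 4 * p t * inner (app A e) (w t) + 2 * inner (w t) (app A (w t)))
       = 2 * inner (y t) (app A (y t)) - 2 * b * (norm (y t))\<^sup>2"
      unfolding 1 2 4 by (simp add: power2_eq_square algebra_simps)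
    also have "\<dots> \<ge> 2 * g * (norm (y t))\<^sup>2" using 3 by (simp add: algebra_simps)
    finally have "2 * g * (norm (y t))\<^sup>2
      \<le> 2 * b * K t + (- 4 * p t * inner (app A e) (w t) + 2 * inner (w t) (app A (w t)))" .
    from mult_left_mono[OF this, of "exp (2 * b * t)"] show ?thesis
      by (simp add: H'_def mult_ac)
  qed
  have H'_nonneg: "0 \<le> H' t" if "0 < t" for t
    using order_trans[OF _ H'_ge[OF that], of 0] g by simp
  have DH: "(H has_real_derivative H' t) (at t)" if t: "0 < t" for t
  proof -
    have dp: "(p has_real_derivative - inner (app A e) (w t)) (at t)"
      unfolding p_def[abs_def] w_def by (rule DERIV_inner_semigroup[OF t e(1) sym])
    have dn: "((\<lambda>t. (norm (w t))\<^sup>2) has_real_derivative - 2 * inner (w t) (app A (w t))) (at t)"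
      unfolding w_def by (rule DERIV_norm_semigroup[OF t])
    have "(K has_real_derivative (- 4 * p t * inner (app A e) (w t) + 2 * inner (w t) (app A (w t)))) (at t)"
      unfolding K_def[abs_def]
      by (rule DERIV_cong[OF DERIV_diff[OF DERIV_cmult[OF DERIV_power[OF dp, of 2], of 2] dn]]) simp
    then show ?thesis
      unfolding H_def[abs_def] H'_def by (auto intro!: derivative_eq_intros simp: algebra_simps)
  qed
  have p_eq: "p t = (Laplace (e + u) t - Laplace (e - u) t) / 4" if "0 \<le> t" for t
    unfolding p_def w_def by (rule inner_semigroup[OF that])
  have cont_p: "continuous_on {0..} p"
  proof (rule continuous_on_eq)
    show "continuous_on {0..} (\<lambda>t. (Laplace (e + u) t - Laplace (e - u) t) / 4)"
      by (intro continuous_intros continuous_on_Laplace) auto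
  qed (use p_eq in auto)
  have cont_n: "continuous_on {0..} (\<lambda>t. (norm (w t))\<^sup>2)"
  proof (rule continuous_on_eq)
    show "continuous_on {0..} (\<lambda>t. Laplace u (2 * t))"
      by (rule continuous_on_compose2[OF continuous_on_Laplace]) (auto intro!: continuous_intros)
  qed (use norm_semigroup w_def in auto)
  have cont_H: "continuous_on {0..} H"
    unfolding H_def[abs_def] K_def by (intro continuous_intros cont_p cont_n)
  have MVT: "\<exists>t>a. t < c \<and> H c - H a = (c - a) * H' t" if "0 \<le> a" "a < c" for a c
  proof -
    have "continuous_on {a..c} H" by (rule continuous_on_subset[OF cont_H]) (use that in auto)
    moreover have "(H has_derivative (\<lambda>h. h * H' t)) (at t)" if "a < t" "t < c" for t
      using DH[of t] \<open>0 \<le> a\<close> that by (simp add: has_field_derivative_def mult_commute_abs)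
    ultimately obtain t where "a < t" "t < c" "H c - H a = (c - a) * H' t"
      using mvt[OF \<open>a < c\<close>, of H "\<lambda>t h. h * H' t"] by auto
    then show ?thesis by blast
  qed
  have mono: "H a \<le> H c" if ac: "0 \<le> a" "a < c" for a c
  proof -
    obtain t where t: "a < t" "H c - H a = (c - a) * H' t" using MVT[OF ac] by blast
    have "0 \<le> (c - a) * H' t" using ac t(1) by (intro mult_nonneg_nonneg H'_nonneg) auto
    then show ?thesis using t(2) by simp
  qed
  have w0: "w 0 = u" unfolding w_def by (rule semigroup_0)
  have p0: "0 < p 0"
  proof -
    have "0 \<le> inner e u" "(norm u)\<^sup>2 \<le> 2 * (inner e u)\<^sup>2" using u by (auto simp: axis_cone_iff)
    moreover have "0 < (norm u)\<^sup>2" using u by simp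
    ultimately have "0 < (inner e u)\<^sup>2" by linarith
    then show ?thesis using \<open>0 \<le> inner e u\<close> by (simp add: p_def w0)
  qed
  have H0: "0 \<le> H 0" using u by (simp add: H_def K_def p_def w0 axis_cone_iff)
  have Hpos: "0 < H t" if t: "0 < t" for t
  proof (rule ccontr)
    assume "\<not> 0 < H t"
    then have "H t = 0" "H 0 = 0" using mono[of 0 t] H0 t by auto
    then obtain r where r: "0 < r" "r < t" "H' r = 0" using MVT[of 0 t] t by auto
    have "(norm (y r))\<^sup>2 \<le> 0"
      using H'_ge[OF r(1)] r(3) g by (simp add: mult_le_0_iff)
    then have "y r = 0" by simp
    then have "K r = (norm (w r))\<^sup>2" by (simp add: K_def norm_w)
    then have "0 < H r" using w_nz[of r] r(1) by (simp add: H_def)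
    then show False using mono[of r t] r \<open>H t = 0\<close> by simp
  qed
  have Kpos: "0 < K t" if "0 < t" for t
    using Hpos[OF that] by (simp add: H_def zero_less_mult_iff)
  have p_nz: "p t \<noteq> 0" if "0 \<le> t" for t
  proof (cases "t = 0")
    case False
    then have "0 < K t" using Kpos that by simp
    then show ?thesis by (auto simp: K_def)
  qed (use p0 in simp)
  have "0 < p s"
  proof (rule ccontr)
    assume "\<not> 0 < p s"
    then have "\<exists>t\<ge>0. t \<le> s \<and> p t = 0"
      using s p0 by (intro IVT2') (auto intro: continuous_on_subset[OF cont_p])
    then show False using p_nz by blast
  qed
  moreover have "(norm (w s))\<^sup>2 < 2 * (p s)\<^sup>2" using Kpos[OF s] by (simp add: K_def)
  ultimately have "w s \<in> strictly_positive (axis_cone e)"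
    unfolding p_def by (intro strictly_positive_axis_coneI e(2))
  then show "app (spectral_integral E (\<lambda>x. exp (- s * x))) u \<in> strictly_positive (axis_cone e)"
    by (simp add: spectral_integral_eq w_def)
qed

end

section \<open>Spectral gaps and quadratic forms\<close>

text \<open>
  The complexified resolvent, applied to real vectors \<open>(u, 0)\<close>.
\<close>

lemma resolvent_set_real_bound:
  assumes x: "complex_of_real x \<in> resolvent_set A" and zero: "0 \<in> Dom A" "app A 0 = 0"
  obtains C where "0 < C" "\<And>u. u \<in> Dom A \<Longrightarrow> norm u \<le> C * norm (app A u - x *\<^sub>R u)"
proof -
  obtain R where R: "bounded_linear R"
    and left: "\<And>w. w \<in> Dom (complexification A) \<Longrightarrow>
      R (app (complexification A) w - complex_scale (complex_of_real x) w) = w"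
    using x unfolding resolvent_set_def by blast
  obtain C where C: "0 < C" "\<And>w. norm (R w) \<le> norm w * C"
    using bounded_linear.pos_bounded[OF R] by blast
  have "norm u \<le> C * norm (app A u - x *\<^sub>R u)" if u: "u \<in> Dom A" for u
  proof -
    have "R (app A u - x *\<^sub>R u, 0) = (u, 0)"
      using left[of "(u, 0)"] u zero by (simp add: complexification_def complex_scale_def zero_prod_def)
    then have "norm (u, 0::'a) \<le> norm (app A u - x *\<^sub>R u, 0::'a) * C" by (metis C(2))
    then show ?thesis by (simp add: norm_Pair mult.commute)
  qed
  with C(1) that show ?thesis by blast
qed

lemma eigenvalue_in_spectrum:
  assumes l: "is_eigenvalue A l" and zero: "0 \<in> Dom A" "app A 0 = 0"
  shows "complex_of_real l \<in> op_spectrum A"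
proof (rule ccontr)
  assume "complex_of_real l \<notin> op_spectrum A"
  then have "complex_of_real l \<in> resolvent_set A" by (simp add: op_spectrum_def)
  then obtain C where "\<And>u. u \<in> Dom A \<Longrightarrow> norm u \<le> C * norm (app A u - l *\<^sub>R u)"
    using resolvent_set_real_bound zero by metis
  moreover obtain u where "u \<in> Dom A" "app A u = l *\<^sub>R u" "u \<noteq> 0"
    using l by (auto simp: is_eigenvalue_def eigenspace_def)
  ultimately show False by fastforce
qed

lemma resolvent_set_if_resolvent:
  assumes "is_resolvent A x N"
  shows "complex_of_real x \<in> resolvent_set A"
proof -
  have N: "bounded_linear N" "\<And>w. N w \<in> Dom A" "\<And>w. app A (N w) - x *\<^sub>R N w = w"
    "\<And>u. u \<in> Dom A \<Longrightarrow> N (app A u - x *\<^sub>R u) = u"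
    using assms unfolding is_resolvent_def by auto
  let ?R = "\<lambda>w. (N (fst w), N (snd w))"
  have "bounded_linear ?R"
    by (intro bounded_linear_Pair bounded_linear_compose[OF N(1)] bounded_linear_fst bounded_linear_snd)
  then show ?thesis
    unfolding resolvent_set_def complexification_def complex_scale_def
    by (intro CollectI exI[of _ ?R]) (auto simp: N(2-4) split: prod.splits)
qed

context spectral_operator
begin

lemma Phi_minus_const:
  assumes u: "u \<in> Dom A"
  shows "app A u - x *\<^sub>R u = Phi (\<lambda>t. t - x) u" and "u \<in> L2_dom (\<lambda>t. t - x)"
proof -
  have d: "u \<in> L2_dom (\<lambda>t. t)" using u Dom_A by simp
  show "app A u - x *\<^sub>R u = Phi (\<lambda>t. t - x) u"
    using Phi_diff_fun[of "\<lambda>t. t" "\<lambda>t. x" u] d L2_dom_const[of u x] by (simp add: app_A[OF u] Phi_const)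
  show "u \<in> L2_dom (\<lambda>t. t - x)" using L2_dom_diff_fun[OF d L2_dom_const] by simp
qed

lemma norm_minus_const:
  assumes u: "u \<in> Dom A"
  shows "(norm (app A u - x *\<^sub>R u))\<^sup>2 = (\<integral>t. (t - x)\<^sup>2 \<partial>M u)"
  unfolding Phi_minus_const(1)[OF u] by (rule Phi_norm[OF _ Phi_minus_const(2)[OF u]]) simp

text \<open>
  On the range of \<open>E\<close> of an interval of radius \<open>h\<close> around \<open>x\<close>, the operator \<open>A - x\<close> has norm at most \<open>h\<close>; for
  \<open>h = 1 / (2 C)\<close> this contradicts the lower bound \<open>1 / C\<close> unless the range is trivial.
\<close>

lemma null_near_resolvent_point:
  assumes C: "0 < C" "\<And>u. u \<in> Dom A \<Longrightarrow> norm u \<le> C * norm (app A u - x *\<^sub>R u)"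
  shows "E {x - 1 / (2 * C)<..<x + 1 / (2 * C)} v = 0"
proof -
  let ?h = "1 / (2 * C)"
  let ?B = "{x - ?h<..<x + ?h}"
  let ?w = "E ?B v"
  have "?w \<in> L2_dom (\<lambda>x. x)" by (rule E_in_L2_dom[where c = "\<bar>x\<bar> + ?h"]) auto
  then have w: "?w \<in> Dom A" by (simp add: Dom_A)
  have "(norm (app A ?w - x *\<^sub>R ?w))\<^sup>2 \<le> (\<integral>t. ?h\<^sup>2 \<partial>M ?w)"
    unfolding norm_minus_const[OF w]
  proof (rule integral_mono_AE)
    show "integrable (M ?w) (\<lambda>t. (t - x)\<^sup>2)" using Phi_minus_const(2)[OF w] by (simp add: L2_dom_def)
    have "(t - x)\<^sup>2 \<le> ?h\<^sup>2" if "t \<in> ?B" for t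
    proof -
      have "\<bar>t - x\<bar> \<le> ?h" using that by auto
      from power_mono[OF this abs_ge_zero, of 2] show ?thesis by simp
    qed
    moreover have "AE t in M ?w. t \<in> ?B" by (rule AE_E) simp
    ultimately show "AE t in M ?w. (t - x)\<^sup>2 \<le> ?h\<^sup>2" by (rule eventually_mono[rotated])
  qed simp
  also have "\<dots> = (?h * norm ?w)\<^sup>2" by (simp add: power_mult_distrib power_divide)
  finally have "norm (app A ?w - x *\<^sub>R ?w) \<le> ?h * norm ?w"
    by (rule power2_le_imp_le) (use C(1) in simp)
  then have "C * norm (app A ?w - x *\<^sub>R ?w) \<le> C * (?h * norm ?w)"
    using C(1) by (intro mult_left_mono) auto
  also have "\<dots> = norm ?w / 2" using C(1) by simp
  finally have "norm ?w \<le> norm ?w / 2" by (rule order_trans[OF C(2)[OF w]])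
  then show ?thesis by simp
qed

text \<open>
  By Lindelof's theorem, countably many null intervals cover \<open>U\<close>.
\<close>

lemma AE_not_in_resolvent:
  assumes "\<And>x. x \<in> U \<Longrightarrow> \<exists>C>0. \<forall>u\<in>Dom A. norm u \<le> C * norm (app A u - x *\<^sub>R u)"
  shows "AE x in M u. x \<notin> U"
proof -
  have "\<forall>x\<in>U. \<exists>C. 0 < C \<and> (\<forall>u\<in>Dom A. norm u \<le> C * norm (app A u - x *\<^sub>R u))" using assms by blast
  then obtain C where C: "\<And>x. x \<in> U \<Longrightarrow> 0 < C x"
    "\<And>x u. x \<in> U \<Longrightarrow> u \<in> Dom A \<Longrightarrow> norm u \<le> C x * norm (app A u - x *\<^sub>R u)"
    by (auto dest!: bchoice)
  define I where "I x = {x - 1 / (2 * C x)<..<x + 1 / (2 * C x)}" for x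
  obtain F' where F': "F' \<subseteq> I ` U" "countable F'" "\<Union>F' = \<Union>(I ` U)"
  proof (rule Lindelof)
    show "open B" if "B \<in> I ` U" for B using that by (auto simp: I_def)
  qed blast
  have "B \<in> null_sets (M u)" if B: "B \<in> F'" for B
  proof -
    obtain x where x: "x \<in> U" "B = I x" using F'(1) B by blast
    have "E (I x) u = 0" unfolding I_def by (rule null_near_resolvent_point) (use C x in auto)
    moreover have "I x \<in> sets borel" by (simp add: I_def)
    ultimately show ?thesis by (simp add: x(2) null_sets_def emeasure_M)
  qed
  then have "\<Union>F' \<in> null_sets (M u)"
    using null_sets_UN'[OF F'(2), of "\<lambda>B. B"] by simp
  then have "AE x in M u. x \<notin> \<Union>F'" by (rule AE_not_in)
  moreover have "U \<subseteq> \<Union>F'"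
    unfolding F'(3) using C(1) by (force simp: I_def)
  ultimately show ?thesis by (elim eventually_mono) blast
qed

lemma E_singleton_eigenspace: "E {x} v \<in> eigenspace A x"
proof -
  let ?w = "E {x} v"
  have "?w \<in> L2_dom (\<lambda>x. x)" by (rule E_in_L2_dom[where c = "\<bar>x\<bar>"]) auto
  then have w: "?w \<in> Dom A" by (simp add: Dom_A)
  have "(norm (app A ?w - x *\<^sub>R ?w))\<^sup>2 = (\<integral>t. 0 \<partial>M ?w)"
    unfolding norm_minus_const[OF w]
    by (rule integral_cong_AE) (use AE_E[of "{x}" v] in auto)
  then show ?thesis using w by (simp add: eigenspace_def)
qed

lemma form_bound_if_AE_ge:
  assumes u: "u \<in> Dom A" and ae: "AE x in M u. l \<le> x"
  shows "l * (norm u)\<^sup>2 \<le> inner u (app A u)"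
proof -
  have "l * (norm u)\<^sup>2 = (\<integral>x. l \<partial>M u)" by simp
  also have "\<dots> \<le> (\<integral>x. x \<partial>M u)"
    by (rule integral_mono_AE) (use ae integrable_id[OF u] in auto)
  finally show ?thesis by (simp add: inner_A[OF u])
qed

text \<open>
  The interval below \<open>\<mu> + \<delta>\<close> carries spectral measure only at \<open>\<mu>\<close>, and \<open>E {\<mu>} y\<close> is a multiple of \<open>e\<close> whose
  squared norm is \<open>\<langle>y, E {\<mu>} y\<rangle> = 0\<close>.
\<close>

lemma spectral_gap_form_bound:
  assumes res: "\<And>x. x < \<mu> + \<delta> \<Longrightarrow> x \<noteq> \<mu> \<Longrightarrow>
      \<exists>C>0. \<forall>u\<in>Dom A. norm u \<le> C * norm (app A u - x *\<^sub>R u)"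
    and simple: "\<And>u. u \<in> eigenspace A \<mu> \<Longrightarrow> \<exists>t. u = t *\<^sub>R e"
    and y: "y \<in> Dom A" "inner e y = 0"
  shows "(\<mu> + \<delta>) * (norm y)\<^sup>2 \<le> inner y (app A y)"
proof (rule form_bound_if_AE_ge[OF y(1)])
  obtain t where t: "E {\<mu>} y = t *\<^sub>R e" using simple E_singleton_eigenspace by blast
  have "(norm (E {\<mu>} y))\<^sup>2 = inner y (t *\<^sub>R e)" using inner_E[of "{\<mu>}" y] t by simp
  then have "E {\<mu>} y = 0" using y(2) by (simp add: inner_commute)
  then have "{\<mu>} \<in> null_sets (M y)" by (simp add: null_sets_def emeasure_M)
  then have "AE x in M y. x \<notin> {\<mu>}" by (rule AE_not_in)
  moreover have "AE x in M y. x \<notin> {x. x < \<mu> + \<delta> \<and> x \<noteq> \<mu>}"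
    by (rule AE_not_in_resolvent) (use res in auto)
  ultimately show "AE x in M y. \<mu> + \<delta> \<le> x" by eventually_elim auto
qed

end

section \<open>Relatively bounded perturbations\<close>

lemma semi_inner_Cauchy_Schwarz:
  fixes N :: "'a::real_inner \<Rightarrow> 'a"
  assumes N: "linear N" "\<And>u v. inner (N u) v = inner u (N v)" "\<And>u. 0 \<le> inner u (N u)"
  shows "(inner u (N v))\<^sup>2 \<le> inner u (N u) * inner v (N v)"
proof -
  define a b d where "a = inner u (N u)" and "b = inner u (N v)" and "d = inner v (N v)"
  have b': "inner v (N u) = b" using N(2)[of u v] by (simp add: b_def inner_commute)
  have q: "0 \<le> a + 2 * t * b + t\<^sup>2 * d" for t
  proof -
    have "0 \<le> inner (u + t *\<^sub>R v) (N (u + t *\<^sub>R v))" by (rule N(3))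
    then show ?thesis
      using b' by (simp add: linear_add[OF N(1)] linear_scale[OF N(1)] inner_add_left inner_add_right
          power2_eq_square algebra_simps flip: a_def b_def d_def)
  qed
  have d0: "0 \<le> d" using N(3) by (simp add: d_def)
  have "b\<^sup>2 \<le> a * d"
  proof (cases "d = 0")
    case True
    have "b = 0"
    proof (rule ccontr)
      assume "b \<noteq> 0"
      \<comment> \<open>At this \<open>t\<close> the affine function \<open>a + 2 t b\<close> takes the value \<open>-1\<close>.\<close>
      then show False using q[of "- (a + 1) / (2 * b)"] True by (simp add: field_simps)
    qed
    then show ?thesis using True by simp
  next
    case False
    have "a + 2 * (- b / d) * b + (- b / d)\<^sup>2 * d = (a * d - b\<^sup>2) / d"
      using False by (simp add: power2_eq_square field_simps)
    then have "0 \<le> (a * d - b\<^sup>2) / d" using q[of "- b / d"] by simp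
    then show ?thesis using False d0 by (simp add: zero_le_divide_iff)
  qed
  then show ?thesis by (simp add: a_def b_def d_def)
qed

text \<open>
  Reid's inequality. With \<open>q k = \<langle>w, N B\<^sup>k w\<rangle>\<close>, the Cauchy-Schwarz inequality for the form of \<open>N\<close> and the symmetry
  of \<open>N B\<close> give \<open>(q k)\<^sup>2 \<le> q 0 * q (2 k)\<close>. A ratio \<open>\<bar>q 1\<bar> / q 0\<close> larger than \<open>c\<close> would therefore make
  \<open>q (2\<^sup>n)\<close> grow faster than the trivial bound \<open>L \<parallel>w\<parallel>\<^sup>2 c^(2\<^sup>n)\<close>.
\<close>

lemma Reid_inequality:
  fixes N B :: "'a::real_inner \<Rightarrow> 'a"
  assumes N: "linear N" "\<And>u v. inner (N u) v = inner u (N v)" "\<And>u. 0 \<le> inner u (N u)"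
    and norm_N: "\<And>u. norm (N u) \<le> L * norm u"
    and B: "\<And>u v. inner (B u) (N v) = inner u (N (B v))" "\<And>u. norm (B u) \<le> c * norm u"
    and c: "0 \<le> c" and L: "0 \<le> L"
  shows "\<bar>inner w (N (B w))\<bar> \<le> c * inner w (N w)"
proof -
  define p where "p = inner w (N w)"
  define q where "q k = inner w (N ((B ^^ k) w))" for k
  have p0: "0 \<le> p" using N(3) by (simp add: p_def)
  have shift: "inner ((B ^^ k) u) (N v) = inner u (N ((B ^^ k) v))" for k u v
    by (induction k arbitrary: v) (simp_all add: B(1), simp add: funpow_swap1)
  have double: "(q k)\<^sup>2 \<le> p * \<bar>q (2 * k)\<bar>" for k
  proof -
    have "(q k)\<^sup>2 \<le> p * inner ((B ^^ k) w) (N ((B ^^ k) w))"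
      unfolding q_def p_def by (rule semi_inner_Cauchy_Schwarz[OF N])
    also have "inner ((B ^^ k) w) (N ((B ^^ k) w)) = q (2 * k)"
      unfolding shift q_def by (simp add: mult_2 funpow_add)
    also have "p * q (2 * k) \<le> p * \<bar>q (2 * k)\<bar>" using p0 by (intro mult_left_mono) auto
    finally show ?thesis .
  qed
  have norm_Bk: "norm ((B ^^ k) w) \<le> c ^ k * norm w" for k
  proof (induction k)
    case (Suc k)
    have "norm ((B ^^ Suc k) w) \<le> c * norm ((B ^^ k) w)" using B(2) by simp
    also have "\<dots> \<le> c * (c ^ k * norm w)" using Suc c by (intro mult_left_mono)
    finally show ?case by simp
  qed simp
  have upper: "\<bar>q k\<bar> \<le> L * (norm w)\<^sup>2 * c ^ k" for k
  proof -
    have "\<bar>q k\<bar> \<le> norm w * norm (N ((B ^^ k) w))"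
      unfolding q_def by (rule Cauchy_Schwarz_ineq2)
    also have "\<dots> \<le> norm w * (L * (c ^ k * norm w))"
      using order_trans[OF norm_N mult_left_mono[OF norm_Bk L]] by (intro mult_left_mono) auto
    finally show ?thesis by (simp add: power2_eq_square mult_ac)
  qed
  show ?thesis
  proof (cases "p = 0")
    case True
    then have "q 1 = 0" using double[of 1] by simp
    then show ?thesis using True by (simp add: p_def q_def)
  next
    case False
    then have p: "0 < p" using p0 by simp
    define \<theta> where "\<theta> = \<bar>q 1\<bar> / p"
    \<comment> \<open>Doubling the exponent squares the normalised moments, so they grow at least like powers of \<open>\<theta>\<close>.\<close>
    have lower: "\<theta> ^ (2 ^ n) * p \<le> \<bar>q (2 ^ n)\<bar>" for n
    proof (induction n)
      case 0
      show ?case using p by (simp add: \<theta>_def)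
    next
      case (Suc n)
      have "(\<theta> ^ (2 ^ n) * p)\<^sup>2 \<le> \<bar>q (2 ^ n)\<bar>\<^sup>2"
        using Suc p by (intro power_mono) (auto simp: \<theta>_def)
      also have "\<dots> \<le> p * \<bar>q (2 ^ Suc n)\<bar>" using double[of "2 ^ n"] by simp
      finally have "p * (\<theta> ^ (2 ^ Suc n) * p) \<le> p * \<bar>q (2 ^ Suc n)\<bar>"
        by (simp add: power_mult_distrib power2_eq_square mult_ac flip: power_mult power_add mult_2)
      then show ?case using p by simp
    qed
    have "\<theta> \<le> c"
    proof (rule ccontr)
      assume "\<not> \<theta> \<le> c"
      then have th: "c < \<theta>" "0 < \<theta>" using c by auto
      define x where "x = c / \<theta>"
      have x: "0 \<le> x" "x < 1" using th c by (auto simp: x_def)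
      define K where "K = L * (norm w)\<^sup>2 + 1"
      have K: "0 < K" using L by (simp add: K_def add_nonneg_pos)
      obtain n where n: "x ^ n < p / K" using real_arch_pow_inv[of "p / K" x] x p K by auto
      have "\<theta> ^ (2 ^ n) * p \<le> L * (norm w)\<^sup>2 * c ^ (2 ^ n)" using lower upper order_trans by blast
      also have "\<dots> \<le> K * c ^ (2 ^ n)" using c by (intro mult_right_mono) (auto simp: K_def)
      also have "c ^ (2 ^ n) = \<theta> ^ (2 ^ n) * x ^ (2 ^ n)" using th by (simp add: x_def power_divide)
      finally have "\<theta> ^ (2 ^ n) * p \<le> \<theta> ^ (2 ^ n) * (K * x ^ (2 ^ n))" by (simp add: mult_ac)
      then have "p \<le> K * x ^ (2 ^ n)" using th by simp
      also have "\<dots> \<le> K * x ^ n"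
        using K x by (intro mult_left_mono power_decreasing) (auto simp: less_imp_le[OF less_exp])
      also have "\<dots> < p" using n K by (simp add: field_simps)
      finally show False by simp
    qed
    then show ?thesis using p by (simp add: \<theta>_def q_def p_def divide_le_eq)
  qed
qed

text \<open>
  An operator bound relative to \<open>T - l\<close> implies a form bound with the same constant: Reid's inequality for
  \<open>N = (T - l)\<^sup>-\<^sup>1\<close> and \<open>B = S N\<close>, since \<open>N S N\<close> is symmetric.
\<close>

lemma form_bound_if_relatively_bounded:
  assumes T: "symmetric_operator T" and res: "is_resolvent T l N"
    and N: "\<And>u v. inner (N u) v = inner u (N v)" "\<And>w. 0 \<le> inner w (N w)"
    and S: "symmetric_operator S" "Dom T \<subseteq> Dom S"
    and c: "0 \<le> c" "\<And>v. v \<in> Dom T \<Longrightarrow> norm (app S v) \<le> c * norm (app T v - l *\<^sub>R v)"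
    and v: "v \<in> Dom T"
  shows "\<bar>inner v (app S v)\<bar> \<le> c * (inner v (app T v) - l * (norm v)\<^sup>2)"
proof -
  have NN: "bounded_linear N" "\<And>w. N w \<in> Dom T" "\<And>w. app T (N w) - l *\<^sub>R N w = w"
    "\<And>u. u \<in> Dom T \<Longrightarrow> N (app T u - l *\<^sub>R u) = u"
    using res unfolding is_resolvent_def by auto
  obtain L where L: "0 < L" "\<And>u. norm (N u) \<le> norm u * L"
    using bounded_linear.pos_bounded[OF NN(1)] by blast
  define w where "w = app T v - l *\<^sub>R v"
  have v_eq: "N w = v" unfolding w_def by (rule NN(4)[OF v])
  have "\<bar>inner w (N (app S (N w)))\<bar> \<le> c * inner w (N w)"
  proof (rule Reid_inequality[where B = "\<lambda>w. app S (N w)"])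
    show "linear N" by (rule bounded_linear.linear[OF NN(1)])
    show "norm (N u) \<le> L * norm u" for u using L(2)[of u] by (simp add: mult.commute)
    show "norm (app S (N u)) \<le> c * norm u" for u using c(2)[OF NN(2), of u] NN(3)[of u] by simp
    show "inner (app S (N u)) (N v) = inner u (N (app S (N v)))" for u v
      using symmetric_operatorD(5)[OF S(1), of "N u" "N v"] S(2) NN(2) N(1) by (simp add: subset_iff)
  qed (use N c(1) L(1) in auto)
  then show ?thesis
    using N(1)[of w "app S v", symmetric] unfolding v_eq
    by (simp add: w_def inner_diff_left inner_diff_right power2_norm_eq_inner inner_commute)
qed

lemma symmetric_op_add:
  assumes T: "symmetric_operator T" and S: "symmetric_operator S" and sub: "Dom T \<subseteq> Dom S"
  shows "symmetric_operator (op_add T S)" "Dom (op_add T S) = Dom T"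
    "app (op_add T S) u = app T u + app S u"
proof -
  note TD = symmetric_operatorD[OF T] and SD = symmetric_operatorD[OF S]
  show dom: "Dom (op_add T S) = Dom T" and app: "app (op_add T S) u = app T u + app S u" for u
    using sub by (auto simp: op_add_def)
  have mem: "u \<in> Dom S" if "u \<in> Dom T" for u using sub that by blast
  show "symmetric_operator (op_add T S)"
    unfolding symmetric_operator_def linear_operator_def densely_defined_def dom app
    using T TD SD mem
    by (auto simp: symmetric_operator_def densely_defined_def inner_add_left inner_add_right scaleR_right_distrib)
qed

text \<open>
  \<open>T + S - l = (1 + S N) (T - l)\<close>, and \<open>1 + S N\<close> is onto because \<open>x \<mapsto> y - S N x\<close> is a contraction.
\<close>

lemma surjective_perturbation:
  fixes T S :: "'a::{real_inner, banach} unbounded_operator"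
  assumes T: "symmetric_operator T" and res: "is_resolvent T l N"
    and S: "symmetric_operator S" "Dom T \<subseteq> Dom S"
    and c: "0 \<le> c" "c < 1" "\<And>v. v \<in> Dom T \<Longrightarrow> norm (app S v) \<le> c * norm (app T v - l *\<^sub>R v)"
  shows "\<exists>v\<in>Dom T. app T v + app S v - l *\<^sub>R v = y"
proof -
  have N: "bounded_linear N" "\<And>w. N w \<in> Dom T" "\<And>w. app T (N w) - l *\<^sub>R N w = w"
    using res unfolding is_resolvent_def by auto
  have "\<exists>!x. y - app S (N x) = x"
  proof (rule banach_fix_type[OF c(1,2)])
    show "\<forall>x x'. dist (y - app S (N x)) (y - app S (N x')) \<le> c * dist x x'"
    proof (intro allI)
      fix x x'
      have "app S (N (x - x')) = app S (N x) - app S (N x')"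
        using symmetric_operatorD(3)[OF S(1)] S(2) N(2) linear_diff[OF bounded_linear.linear[OF N(1)]] by (simp add: subset_iff)
      then have "dist (y - app S (N x)) (y - app S (N x')) = norm (app S (N (x - x')))"
        by (simp add: dist_norm norm_minus_commute)
      also have "\<dots> \<le> c * norm (x - x')" using c(3)[OF N(2), of "x - x'"] N(3)[of "x - x'"] by simp
      finally show "dist (y - app S (N x)) (y - app S (N x')) \<le> c * dist x x'" by (simp add: dist_norm)
    qed
  qed
  then obtain x where x: "y - app S (N x) = x" by blast
  have "app T (N x) + app S (N x) - l *\<^sub>R N x = y" using N(3)[of x] x by (simp add: algebra_simps)
  then show ?thesis using N(2) by blast
qed

section \<open>Perturbation of a simple lowest eigenvalue\<close>

lemma one_dimensional_multiple:
  fixes V :: "'a::real_vector set"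
  assumes "dim V = 1" "e \<in> V" "e \<noteq> 0" "u \<in> V"
  shows "\<exists>t. u = t *\<^sub>R e"
proof -
  obtain B where B: "V \<subseteq> span B" "card B = dim V" using basis_exists[of V] by blast
  then obtain b where "B = {b}" using assms(1) card_1_singletonE by metis
  then have multiple: "\<exists>t. v = t *\<^sub>R b" if "v \<in> V" for v
    using B(1) that by (auto simp: span_singleton)
  obtain t where t: "e = t *\<^sub>R b" using multiple[OF assms(2)] by blast
  obtain t' where t': "u = t' *\<^sub>R b" using multiple[OF assms(4)] by blast
  have "t \<noteq> 0" using t assms(3) by auto
  then show ?thesis using t t' by (intro exI[of _ "t' / t"]) simp
qed

theorem theorem4p2:
  fixes T :: "'a::{real_inner, banach} unbounded_operator"
    and S :: "real \<Rightarrow> 'a unbounded_operator"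
    and T\<kappa> :: "real \<Rightarrow> 'a unbounded_operator"
    and u0 :: 'a
    and J :: "real set"
    and a b c \<mu>\<kappa> :: "real \<Rightarrow> real"
    and \<mu> \<kappa>0 \<delta> s0 \<epsilon> \<alpha> r :: real
  assumes "self_adjoint T" and "lower_semibounded T"
    and "\<mu> = Inf {x::real. complex_of_real x \<in> op_spectrum T}"
    and "simple_eigenvalue T \<mu>"
    and "u0 \<in> eigenspace T \<mu>" and "norm u0 = 1"
    and "open J" and "is_interval J" and "0 \<in> J"
    and "\<And>\<kappa>. \<kappa> \<in> J \<Longrightarrow> symmetric_operator (S \<kappa>)"
    and "\<And>\<kappa>. \<kappa> \<in> J \<Longrightarrow> T\<kappa> \<kappa> = op_add T (S \<kappa>)"
    and "\<And>\<kappa>. \<kappa> \<in> J \<Longrightarrow> Dom T \<subseteq> Dom (S \<kappa>)"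
    and "continuous_on J a" and "continuous_on J b"
    and "\<And>\<kappa>. \<kappa> \<in> J \<Longrightarrow> a \<kappa> \<ge> 0" and "\<And>\<kappa>. \<kappa> \<in> J \<Longrightarrow> b \<kappa> \<ge> 0"
    and "\<And>\<kappa> u. \<kappa> \<in> J \<Longrightarrow> u \<in> Dom T \<Longrightarrow>
           norm (app (S \<kappa>) u) \<le> a \<kappa> * norm (app T u) + b \<kappa> * norm u"
    and "a 0 = 0" and "b 0 = 0"
    and "\<kappa>0 > 0" and "{-\<kappa>0<..<\<kappa>0} \<subseteq> J"
    and "\<And>\<kappa>. \<bar>\<kappa>\<bar> < \<kappa>0 \<Longrightarrow> lowest_eigenvalue (T\<kappa> \<kappa>) (\<mu>\<kappa> \<kappa>)"
    and "ereal \<delta> = (INF \<kappa>\<in>{\<kappa>. \<bar>\<kappa>\<bar> < \<kappa>0}.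
           dist_to_set (complex_of_real (\<mu>\<kappa> \<kappa>))
             (op_spectrum (T\<kappa> \<kappa>) - {complex_of_real (\<mu>\<kappa> \<kappa>)}))"
    and "\<delta> > 0"
    and "s0 > 0"
    and "\<epsilon> = \<delta> / 2"
    and "\<And>\<kappa>. \<kappa> \<in> J \<Longrightarrow> c \<kappa> = a \<kappa> + ((\<bar>\<mu>\<bar> + \<epsilon>) * a \<kappa> + b \<kappa>) / \<epsilon>"
    and "\<alpha> = 1 - exp (- s0 * \<delta>)"
    and "r = (1 - \<alpha>\<^sup>2) / (4 * sqrt 2 * (1 + \<alpha>\<^sup>2))"
  shows "\<forall>s \<kappa>. 0 < s \<and> s \<le> s0 \<and> \<bar>\<kappa>\<bar> < \<kappa>0
           \<and> c \<kappa> < r * sqrt (1 - r\<^sup>2 / 4) / (1 + r * sqrt (1 - r\<^sup>2 / 4)) \<longrightarrow>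
         positivity_improving (axis_cone u0) (functional_calculus (\<lambda>x. exp (- s * x)) (T\<kappa> \<kappa>))"
proof (intro allI impI, elim conjE)
  note T_sa = assms(1) and T_lb = assms(2) and \<mu>_def = assms(3) and simple = assms(4)
    and u0 = assms(5,6) and zero_J = assms(9) and S_sym = assms(10) and T\<kappa>_eq = assms(11) and Dom_sub = assms(12)
    and a_nn = assms(15) and b_nn = assms(16) and rel = assms(17) and a0 = assms(18) and b0 = assms(19)
    and \<kappa>0 = assms(20,21) and lowest = assms(22) and gap = assms(23) and \<delta>_pos = assms(24) and s0_pos = assms(25)
    and \<epsilon>_eq = assms(26) and c_eq = assms(27) and \<alpha>_eq = assms(28) and r_eq = assms(29)
  fix s \<kappa> :: real
  assume s: "0 < s" "s \<le> s0" and \<kappa>: "\<bar>\<kappa>\<bar> < \<kappa>0"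
    and c_lt: "c \<kappa> < r * sqrt (1 - r\<^sup>2 / 4) / (1 + r * sqrt (1 - r\<^sup>2 / 4))"
  have "\<kappa> \<in> {- \<kappa>0<..<\<kappa>0}" using \<kappa> by (simp add: abs_less_iff minus_less_iff)
  then have \<kappa>J: "\<kappa> \<in> J" using \<kappa>0(2) by (rule subsetD[rotated])
  have \<epsilon>_pos: "0 < \<epsilon>" using \<delta>_pos \<epsilon>_eq by simp
  have T_sym: "symmetric_operator T" by (rule self_adjoint_imp_symmetric[OF T_sa])
  note TD = symmetric_operatorD[OF T_sym]
  have T_zero: "0 \<in> Dom T" "app T 0 = 0"
    using subspace_0[OF TD(1)] TD(4)[of 0 0] by auto
  obtain m where m: "\<And>u. u \<in> Dom T \<Longrightarrow> m * (norm u)\<^sup>2 \<le> inner u (app T u)"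
    using T_lb by (auto simp: lower_semibounded_def)

  \<comment> \<open>As \<open>S 0\<close> vanishes on the domain of \<open>T\<close>, the gap at \<open>\<kappa> = 0\<close> is a gap in the spectrum of \<open>T\<close> above \<open>\<mu>\<close>.\<close>
  have res_below: "complex_of_real x \<in> resolvent_set T" if x: "x < m" for x
  proof -
    have bound: "(m - x) * (norm u)\<^sup>2 \<le> inner u (app T u) - x * (norm u)\<^sup>2" if "u \<in> Dom T" for u
      using m[OF that] by (simp add: algebra_simps)
    have "0 < m - x" using x by simp
    from resolvent_if_surjective[OF T_sym this bound self_adjoint_surjective[OF T_sa this bound]]
    obtain N where "is_resolvent T x N" .
    then show ?thesis by (rule resolvent_set_if_resolvent)
  qed
  have bdd: "bdd_below {x::real. complex_of_real x \<in> op_spectrum T}"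
    by (rule bdd_belowI[where m = m]) (use res_below in \<open>force simp: op_spectrum_def\<close>)
  have spec_ge: "\<mu> \<le> x" if "complex_of_real x \<in> op_spectrum T" for x
    unfolding \<mu>_def by (rule cInf_lower[OF _ bdd]) (use that in simp)
  have T0: "Dom (T\<kappa> 0) = Dom T" "\<And>u. u \<in> Dom T \<Longrightarrow> app (T\<kappa> 0) u = app T u"
    using symmetric_op_add(2,3)[OF T_sym S_sym[OF zero_J] Dom_sub[OF zero_J]] T\<kappa>_eq[OF zero_J]
      rel[OF zero_J] a0 b0 by auto
  have eig0: "is_eigenvalue (T\<kappa> 0) x \<longleftrightarrow> is_eigenvalue T x" for x
    by (auto simp: is_eigenvalue_def eigenspace_def T0)
  have \<mu>0: "\<mu>\<kappa> 0 = \<mu>"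
  proof (rule antisym)
    have low: "is_eigenvalue (T\<kappa> 0) (\<mu>\<kappa> 0)" "\<And>x. is_eigenvalue (T\<kappa> 0) x \<Longrightarrow> \<mu>\<kappa> 0 \<le> x"
      using lowest[of 0] \<kappa>0(1) by (auto simp: lowest_eigenvalue_def)
    show "\<mu>\<kappa> 0 \<le> \<mu>" using simple by (intro low(2)) (simp add: eig0 simple_eigenvalue_def)
    show "\<mu> \<le> \<mu>\<kappa> 0"
      using low(1) by (intro spec_ge eigenvalue_in_spectrum T_zero) (simp add: eig0)
  qed
  have res_bound: "\<exists>C>0. \<forall>u\<in>Dom T. norm u \<le> C * norm (app T u - x *\<^sub>R u)"
    if x: "x < \<mu> + \<delta>" "x \<noteq> \<mu>" for x
  proof (cases "x < \<mu>")
    case True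
    then have "complex_of_real x \<in> resolvent_set T" using spec_ge[of x] by (auto simp: op_spectrum_def)
    then show ?thesis using resolvent_set_real_bound[of x T] T_zero by metis
  next
    case False
    have "complex_of_real x \<in> resolvent_set (T\<kappa> 0)"
    proof (rule ccontr)
      assume "complex_of_real x \<notin> resolvent_set (T\<kappa> 0)"
      then have mem: "complex_of_real x \<in> op_spectrum (T\<kappa> 0) - {complex_of_real (\<mu>\<kappa> 0)}"
        using x(2) \<mu>0 by (simp add: op_spectrum_def)
      have "ereal \<delta> \<le> dist_to_set (complex_of_real (\<mu>\<kappa> 0)) (op_spectrum (T\<kappa> 0) - {complex_of_real (\<mu>\<kappa> 0)})"
        unfolding gap by (rule INF_lower) (use \<kappa>0(1) in simp)
      also have "\<dots> \<le> ereal (dist (complex_of_real (\<mu>\<kappa> 0)) (complex_of_real x))"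
        unfolding dist_to_set_def by (rule INF_lower[OF mem])
      finally have "\<delta> \<le> dist (complex_of_real \<mu>) (complex_of_real x)" by (simp add: \<mu>0)
      also have "\<dots> = \<bar>\<mu> - x\<bar>" by (simp only: dist_norm norm_of_real flip: of_real_diff)
      finally show False using False x by simp
    qed
    then obtain C where "0 < C" "\<And>u. u \<in> Dom (T\<kappa> 0) \<Longrightarrow> norm u \<le> C * norm (app (T\<kappa> 0) u - x *\<^sub>R u)"
      using resolvent_set_real_bound[of x "T\<kappa> 0"] T_zero T0 by metis
    then show ?thesis using T0 by (intro exI[of _ C]) simp
  qed
  obtain E\<^sub>T where "is_spectral_measure T E\<^sub>T"
  proof -
    have bound: "1 * (norm u)\<^sup>2 \<le> inner u (app T u) - (m - 1) * (norm u)\<^sup>2" if "u \<in> Dom T" for u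
      using m[OF that] by (simp add: algebra_simps)
    show thesis
      using spectral_measure_exists[OF T_sym zero_less_one bound self_adjoint_surjective[OF T_sa zero_less_one bound]]
        that by blast
  qed
  then interpret T: spectral_operator E\<^sub>T T
    by unfold_locales (simp_all add: is_spectral_measure_def)
  have T_form: "\<mu> * (norm u)\<^sup>2 \<le> inner u (app T u)" if u: "u \<in> Dom T" for u
  proof (rule T.form_bound_if_AE_ge[OF u])
    have "AE x in T.M u. x \<notin> {..<\<mu>}"
      by (rule T.AE_not_in_resolvent) (use res_bound \<delta>_pos in auto)
    then show "AE x in T.M u. \<mu> \<le> x" by eventually_elim auto
  qed
  have T_gap: "(\<mu> + \<delta>) * (norm y)\<^sup>2 \<le> inner y (app T y)" if y: "y \<in> Dom T" "inner u0 y = 0" for y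
  proof (rule T.spectral_gap_form_bound[OF res_bound _ y])
    show "\<exists>t. u = t *\<^sub>R u0" if "u \<in> eigenspace T \<mu>" for u
    proof (rule one_dimensional_multiple)
      show "dim (eigenspace T \<mu>) = 1" using simple by (simp add: simple_eigenvalue_def)
      show "u0 \<noteq> 0" using u0(2) by auto
    qed (rule u0(1), rule that)
  qed

  \<comment> \<open>The comparison operator \<open>T - l = T - \<mu> + \<epsilon>\<close> is coercive with constant \<open>\<epsilon>\<close>, and \<open>c\<close> is the bound of \<open>S\<close>
    relative to it.\<close>
  define l where "l = \<mu> - \<epsilon>"
  have coercive: "\<epsilon> * (norm u)\<^sup>2 \<le> inner u (app T u) - l * (norm u)\<^sup>2" if "u \<in> Dom T" for u
    using T_form[OF that] by (simp add: l_def algebra_simps)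
  obtain N where N: "is_resolvent T l N" "\<And>u v. inner (N u) v = inner u (N v)"
      "\<And>w. \<epsilon> * (norm (N w))\<^sup>2 \<le> inner w (N w)"
    by (rule resolvent_if_surjective[OF T_sym \<epsilon>_pos coercive self_adjoint_surjective[OF T_sa \<epsilon>_pos coercive]])
      (assumption, assumption, rule that)
  have N_nonneg: "0 \<le> inner w (N w)" for w
    using order_trans[OF _ N(3)[of w], of 0] \<epsilon>_pos by simp
  note \<kappa>S = S_sym[OF \<kappa>J] Dom_sub[OF \<kappa>J]
  have c_nn: "0 \<le> c \<kappa>"
    using a_nn[OF \<kappa>J] b_nn[OF \<kappa>J] \<epsilon>_pos by (simp add: c_eq[OF \<kappa>J])
  have c_half: "c \<kappa> < 1 / 2"
  proof -
    have "0 < exp (- s0 * \<delta>)" "exp (- s0 * \<delta>) \<le> 1" using s0_pos \<delta>_pos by simp_all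
    then have "0 \<le> \<alpha>" "\<alpha> < 1" by (simp_all add: \<alpha>_eq)
    then have "\<alpha>\<^sup>2 < 1" by (simp add: power_less_one_iff abs_square_less_1)
    then have r0: "0 < r" by (simp add: r_eq add_pos_nonneg)
    have "r \<le> (1 - \<alpha>\<^sup>2) / 4"
      unfolding r_eq
    proof (rule divide_left_mono)
      have "1 \<le> sqrt 2 * (1 + \<alpha>\<^sup>2)" using mult_mono[of 1 "sqrt 2" 1 "1 + \<alpha>\<^sup>2"] by simp
      then show "4 \<le> 4 * sqrt 2 * (1 + \<alpha>\<^sup>2)" by simp
      show "0 < 4 * sqrt 2 * (1 + \<alpha>\<^sup>2) * 4" by (simp add: add_pos_nonneg)
    qed (use \<open>\<alpha>\<^sup>2 < 1\<close> in simp)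
    also have "(1 - \<alpha>\<^sup>2) / 4 \<le> 1 / 4" by simp
    finally have r4: "r \<le> 1 / 4" .
    define x where "x = r * sqrt (1 - r\<^sup>2 / 4)"
    have "r\<^sup>2 \<le> 1" using r0 r4 by (simp add: power_le_one)
    then have "0 \<le> sqrt (1 - r\<^sup>2 / 4)" "sqrt (1 - r\<^sup>2 / 4) \<le> 1" by simp_all
    then have x: "0 \<le> x" "x \<le> r" using r0 by (simp_all add: x_def mult_left_le)
    have "c \<kappa> < x / (1 + x)" using c_lt by (simp add: x_def)
    also have "\<dots> \<le> x / 1" using x by (intro divide_left_mono) auto
    finally show ?thesis using x r4 by simp
  qed
  have rel_bound: "norm (app (S \<kappa>) v) \<le> c \<kappa> * norm (app T v - l *\<^sub>R v)" if v: "v \<in> Dom T" for v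
  proof -
    let ?n = "norm (app T v - l *\<^sub>R v)"
    have nv: "norm v \<le> ?n / \<epsilon>"
      using coercive_norm_bound[OF coercive[OF v]] \<epsilon>_pos by (simp add: field_simps)
    have "app T v = (app T v - l *\<^sub>R v) + l *\<^sub>R v" by simp
    then have "norm (app T v) \<le> ?n + \<bar>l\<bar> * norm v" by (metis norm_scaleR norm_triangle_ineq)
    also have "\<bar>l\<bar> * norm v \<le> (\<bar>\<mu>\<bar> + \<epsilon>) * (?n / \<epsilon>)"
      using nv \<epsilon>_pos by (intro mult_mono) (auto simp: l_def)
    finally have nT: "norm (app T v) \<le> ?n + (\<bar>\<mu>\<bar> + \<epsilon>) * (?n / \<epsilon>)" by simp
    have "norm (app (S \<kappa>) v) \<le> a \<kappa> * norm (app T v) + b \<kappa> * norm v" by (rule rel[OF \<kappa>J v])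
    also have "\<dots> \<le> a \<kappa> * (?n + (\<bar>\<mu>\<bar> + \<epsilon>) * (?n / \<epsilon>)) + b \<kappa> * (?n / \<epsilon>)"
      using nT nv a_nn[OF \<kappa>J] b_nn[OF \<kappa>J] by (intro add_mono mult_left_mono)
    also have "\<dots> = c \<kappa> * ?n" using \<epsilon>_pos by (simp add: c_eq[OF \<kappa>J] field_simps)
    finally show ?thesis .
  qed
  have S_form: "\<bar>inner v (app (S \<kappa>) v)\<bar> \<le> c \<kappa> * (inner v (app T v) - l * (norm v)\<^sup>2)" if "v \<in> Dom T" for v
    by (rule form_bound_if_relatively_bounded[OF T_sym N(1,2) N_nonneg \<kappa>S c_nn rel_bound that])

  \<comment> \<open>The form bound keeps \<open>A - l\<close> coercive and the fixed point argument makes it onto; this yields the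
    spectral measure of \<open>A\<close>.\<close>
  define A where "A = T\<kappa> \<kappa>"
  have A_sym: "symmetric_operator A" and A_Dom: "Dom A = Dom T"
    and A_app: "\<And>u. app A u = app T u + app (S \<kappa>) u"
    unfolding A_def T\<kappa>_eq[OF \<kappa>J] by (rule symmetric_op_add[OF T_sym \<kappa>S])+
  define k where "k = (1 - c \<kappa>) * \<epsilon>"
  have k: "0 < k" using c_half \<epsilon>_pos by (simp add: k_def)
  have A_coercive: "k * (norm u)\<^sup>2 \<le> inner u (app A u) - l * (norm u)\<^sup>2" if "u \<in> Dom A" for u
  proof -
    have u: "u \<in> Dom T" using that A_Dom by simp
    let ?q = "inner u (app T u) - l * (norm u)\<^sup>2"
    have "(1 - c \<kappa>) * (\<epsilon> * (norm u)\<^sup>2) \<le> (1 - c \<kappa>) * ?q"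
      using coercive[OF u] c_half by (intro mult_left_mono) auto
    also have "\<dots> \<le> ?q + inner u (app (S \<kappa>) u)" using S_form[OF u] by (simp add: left_diff_distrib)
    finally show ?thesis by (simp add: k_def A_app inner_add_right mult.assoc)
  qed
  have "\<exists>u\<in>Dom A. app A u - l *\<^sub>R u = w" for w
    using surjective_perturbation[OF T_sym N(1) \<kappa>S c_nn _ rel_bound, of w] c_half by (simp add: A_Dom A_app)
  from someI_ex[OF spectral_measure_exists[OF A_sym k A_coercive this]]
  interpret A: spectral_operator "SOME E. is_spectral_measure A E" A
    by unfold_locales (simp_all add: is_spectral_measure_def)
  interpret A: semibounded_spectral_operator "SOME E. is_spectral_measure A E" A l
  proof (unfold_locales, rule A.AE_ge_if_form_bound)
    fix u assume "u \<in> Dom A"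
    have "0 \<le> k * (norm u)\<^sup>2" using k by simp
    also have "\<dots> \<le> inner u (app A u) - l * (norm u)\<^sup>2" by (rule A_coercive) fact
    finally show "l * (norm u)\<^sup>2 \<le> inner u (app A u)" by simp
  qed
  have u0D: "u0 \<in> Dom T" and Tu0: "app T u0 = \<mu> *\<^sub>R u0" using u0(1) by (auto simp: eigenspace_def)
  have u0u0: "inner u0 u0 = 1" using u0(2) by (simp add: norm_eq_sqrt_inner)
  have u0A: "inner u0 (app A u0) \<le> \<mu> + c \<kappa> * \<epsilon>"
    using S_form[OF u0D] by (simp add: A_app Tu0 inner_add_right u0u0 u0(2) l_def algebra_simps)
  have "positivity_improving (axis_cone u0) (spectral_integral (SOME E. is_spectral_measure A E) (\<lambda>x. exp (- s * x)))"
  proof (rule A.positivity_improving_semigroup[OF A_sym _ u0(2) _ _ s(1)])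
    show "u0 \<in> Dom A" using u0D A_Dom by simp
    \<comment> \<open>Above \<open>\<mu>\<close>, the form of \<open>A\<close> is at least \<open>(1 - c) * 2 * \<epsilon> - c * \<epsilon>\<close> on unit vectors orthogonal to \<open>u0\<close>
      and at most \<open>c * \<epsilon>\<close> at \<open>u0\<close>; the witness is the difference.\<close>
    show "0 < \<epsilon> * (2 - 4 * c \<kappa>)" using \<epsilon>_pos c_half by simp
    fix y assume "y \<in> Dom A" and orth: "inner u0 y = 0"
    then have y: "y \<in> Dom T" using A_Dom by simp
    define n where "n = (norm y)\<^sup>2"
    define \<tau> where "\<tau> = inner y (app T y) - \<mu> * n"
    have n: "0 \<le> n" by (simp add: n_def)
    have \<tau>: "2 * \<epsilon> * n \<le> \<tau>" using T_gap[OF y orth] by (simp add: \<tau>_def n_def \<epsilon>_eq algebra_simps)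
    have "(inner u0 (app A u0) + \<epsilon> * (2 - 4 * c \<kappa>)) * n \<le> (\<mu> + c \<kappa> * \<epsilon> + \<epsilon> * (2 - 4 * c \<kappa>)) * n"
      using u0A n by (intro mult_right_mono) auto
    also have "\<dots> = \<mu> * n + (1 - c \<kappa>) * (2 * \<epsilon> * n) - c \<kappa> * \<epsilon> * n" by (simp add: algebra_simps)
    also have "\<dots> \<le> \<mu> * n + (1 - c \<kappa>) * \<tau> - c \<kappa> * \<epsilon> * n"
      using mult_left_mono[OF \<tau>, of "1 - c \<kappa>"] c_half by simp
    also have "\<dots> = inner y (app T y) - c \<kappa> * (inner y (app T y) - l * (norm y)\<^sup>2)"
      by (simp add: \<tau>_def l_def n_def algebra_simps)
    also have "\<dots> \<le> inner y (app A y)"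
      using S_form[OF y] by (simp add: A_app inner_add_right)
    finally show "(inner u0 (app A u0) + \<epsilon> * (2 - 4 * c \<kappa>)) * (norm y)\<^sup>2 \<le> inner y (app A y)"
      by (simp add: n_def)
  qed
  then show "positivity_improving (axis_cone u0) (functional_calculus (\<lambda>x. exp (- s * x)) (T\<kappa> \<kappa>))"
    by (simp add: functional_calculus_def A_def)
qed

end
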